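(* Let $G$ be a connected compact semisimple Lie group, $0\ne\mu_\diamond\in\mathfrak g'$, and let $K$ be the stability subgroup of $\mu_\diamond$ for the coadjoint action. The Levi--Civita connection $\nabla^\diamond$ for the Riemannian metric $g_\diamond$ on $G/K$ is given, for $\alpha,\beta\in\Delta_\diamond$, $V\in\mathcal T^\alpha(G/K)$ and $W\in\mathcal T^\beta(G/K)$, by $$\begin{aligned}(\nabla^\diamond_VW)(x)={}&(\nabla^c_VW)(x)\\&+\tfrac14\Big(2\beta(Z_\diamond)\big(\alpha(Z_\diamond)+\beta(Z_\diamond)\big)^{-1}\big([V(x),W(x)]-[J_\diamond V(x),J_\diamond W(x)]\big)\\&\quad+\big(1+\mathrm{sign}(\beta(Z_\diamond)-\alpha(Z_\diamond))\big)P\big([V(x),W(x)]+[J_\diamond V(x),J_\diamond W(x)]\big)\Big)\end{aligned}$$ for all $x\in G$.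
   Context: $\mathfrak g$ is the Lie algebra of $G$, $\mathfrak g'$ its dual, $\mathrm{Kil}$ the negative of the Killing form (positive-definite). $Z_\diamond\in\mathfrak g$ is determined by $\mu_\diamond(X)=\mathrm{Kil}(X,Z_\diamond)$ for all $X\in\mathfrak g$. $\mathfrak k$ is the Lie algebra of $K$; $\mathfrak m=\mathfrak k^\perp$ with respect to $\mathrm{Kil}$; $P$ is the projection of $\mathfrak g$ onto $\mathfrak m$ along $\mathfrak k$. $T_\diamond$ is the closure in $G$ of $\{\exp(rZ_\diamond):r\in\mathbb R\}$ (a torus), with Lie algebra $\mathfrak t_\diamond$. $\Gamma_\diamond$ is the operator on $\mathfrak m$ with $\mu_\diamond([X,Y])=\mathrm{Kil}(\Gamma_\diamond X,Y)$ for $X,Y\in\mathfrak m$; it equals $\mathrm{ad}_{Z_\diamond}|_{\mathfrak m}$ and is skew-symmetric and invertible. $\Gamma_\diamond=|\Gamma_\diamond|J_\diamond$ is its polar decomposition (with respect to $\mathrm{Kil}$); $J_\diamond$ is orthogonal with $J_\diamond^2=-I$ and commutes with $|\Gamma_\diamond|$ and with the $\mathrm{Ad}$-action of $K$. The inner product $g_\diamond$ on $\mathfrak m$ is $g_\diamond(X,Y)=\mu_\diamond([X,J_\diamond Y])=\mathrm{Kil}(|\Gamma_\diamond|X,Y)$. For a real-linear functional $\alpha:\mathfrak t_\diamond\to\mathbb R$ put $\mathfrak m_\alpha=\{X\in\mathfrak m:[Z,X]=\alpha(Z)J_\diamond X\text{ for all }Z\in\mathfrak t_\diamond\}$; $\Delta_\diamond$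 is the (finite) set of $\alpha$ with $\mathfrak m_\alpha\ne\{0\}$. Convention: $\mathrm{sign}(0)=0$. $\mathcal T(G/K)=\{V\in C^\infty(G,\mathfrak m):V(xs)=\mathrm{Ad}_s^{-1}(V(x)),\ x\in G,s\in K\}$ is the module of tangent vector fields over $A=C^\infty(G/K,\mathbb R)\subseteq C^\infty(G,\mathbb R)$, $V$ acting on $A$ as the derivation $(\delta_Vf)(x)=\frac{d}{dt}|_{t=0}f(x\exp(tV(x)))$. $\mathcal T^\alpha(G/K)$ is the subspace of $V\in\mathcal T(G/K)$ with values in $\mathfrak m_\alpha$. The canonical connection is $(\nabla^c_VW)(x)=\frac{d}{dt}|_{t=0}W(x\exp(tV(x)))$. The Riemannian metric $g_\diamond$ on $G/K$ is $(g_\diamond(V,W))(x)=g_\diamond(V(x),W(x))$; the Levi--Civita connection is the unique torsion-free connection on $\mathcal T(G/K)$ compatible with it. Brackets in the formula are pointwise brackets in $\mathfrak g$. *)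

theory Defs
  imports "HOL-Analysis.Analysis"
begin

section \<open>Smooth maps between smooth manifolds\<close>

(* Meant for open S.  Ck_on k S f: all iterated directional derivatives of f of order at most k
   exist and are continuous, and f is Frechet differentiable up to order k. *)
primrec Ck_on :: "nat \<Rightarrow> 'a::euclidean_space set \<Rightarrow> ('a \<Rightarrow> 'b::euclidean_space) \<Rightarrow> bool" where
  "Ck_on 0 S f \<longleftrightarrow> continuous_on S f"
| "Ck_on (Suc k) S f \<longleftrightarrow>
     f differentiable_on S \<and> (\<forall>v. Ck_on k S (\<lambda>x. frechet_derivative f (at x) v))"

definition smooth_on :: "'a::euclidean_space set \<Rightarrow> ('a \<Rightarrow> 'b::euclidean_space) \<Rightarrow> bool" where
  "smooth_on S f \<longleftrightarrow> (\<forall>k. Ck_on k S f)"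

(* A chart is a pair of a domain and a coordinate map that is only relevant on the domain. *)
type_synonym ('m, 'e) chart = "'m set \<times> ('m \<Rightarrow> 'e)"

definition chart_inv :: "('m, 'e) chart \<Rightarrow> 'e \<Rightarrow> 'm" where
  "chart_inv c = inv_into (fst c) (snd c)"

definition smooth_atlas :: "('m::topological_space, 'e::euclidean_space) chart set \<Rightarrow> bool" where
  "smooth_atlas A \<longleftrightarrow>
     (\<Union>c\<in>A. fst c) = UNIV \<and>
     (\<forall>c\<in>A. open (fst c) \<and> open (snd c ` fst c) \<and>
        homeomorphism (fst c) (snd c ` fst c) (snd c) (chart_inv c)) \<and>
     (\<forall>c\<in>A. \<forall>d\<in>A. smooth_on (snd c ` (fst c \<inter> fst d)) (snd d \<circ> chart_inv c))"

definition smooth_map ::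
  "('m::topological_space, 'd::euclidean_space) chart set \<Rightarrow>
   ('n::topological_space, 'e::euclidean_space) chart set \<Rightarrow> ('m \<Rightarrow> 'n) \<Rightarrow> bool" where
  "smooth_map A B f \<longleftrightarrow> continuous_on UNIV f \<and>
     (\<forall>c\<in>A. \<forall>d\<in>B. smooth_on (snd c ` (fst c \<inter> f -` fst d)) (snd d \<circ> f \<circ> chart_inv c))"

definition euclid_atlas :: "('e, 'e) chart set" where
  "euclid_atlas = {(UNIV, \<lambda>x. x)}"

definition prod_atlas ::
  "('m, 'd) chart set \<Rightarrow> ('n, 'e) chart set \<Rightarrow> ('m \<times> 'n, 'd \<times> 'e) chart set" where
  "prod_atlas A B = {(fst c \<times> fst d, \<lambda>(x, y). (snd c x, snd d y)) | c d. c \<in> A \<and> d \<in> B}"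


section \<open>Lie groups\<close>

class group_mult = monoid_mult + inverse +
  assumes group_left_inverse: "inverse x * x = 1"
    and group_divide: "x / y = x * inverse y"

definition lie_group ::
  "('g::{group_mult, t2_space, second_countable_topology}, 'e::euclidean_space) chart set \<Rightarrow> bool"
  where
  "lie_group A \<longleftrightarrow> smooth_atlas A \<and>
     smooth_map (prod_atlas A A) A (\<lambda>(x, y). x * y) \<and>
     smooth_map A A inverse"

(* The tangent space at 1, i.e. the Lie algebra, is identified with the model space 'e by means of
   a chart c around 1: X in 'e stands for the tangent vector whose coordinates in c are X.
   A is always the atlas of the Lie group, and c a chart of A around 1. *)

context
  fixes A :: "('g::{group_mult, topological_space}, 'e::euclidean_space) chart set"
    and c :: "('g, 'e) chart"
begin

(* The value at time 1 of the one-parameter subgroup with initial velocity X. *)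
definition lie_exp :: "'e \<Rightarrow> 'g" where
  "lie_exp X = (THE y. \<exists>\<gamma>::real \<Rightarrow> 'g.
     smooth_map euclid_atlas A \<gamma> \<and> (\<forall>s t. \<gamma> (s + t) = \<gamma> s * \<gamma> t) \<and>
     ((\<lambda>t. snd c (\<gamma> t)) has_vector_derivative X) (at 0) \<and> y = \<gamma> 1)"

(* Ad_x is the differential at 1 of conjugation by x. *)
definition Ad :: "'g \<Rightarrow> 'e \<Rightarrow> 'e" where
  "Ad x X = frechet_derivative (\<lambda>u. snd c (x * chart_inv c u * inverse x)) (at (snd c 1)) X"

(* ad is the differential at 1 of Ad, and [X, Y] = ad X Y; this is the bracket of left-invariant
   vector fields. *)
definition lie_bracket :: "'e \<Rightarrow> 'e \<Rightarrow> 'e" where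
  "lie_bracket X Y = frechet_derivative (\<lambda>u. Ad (chart_inv c u) Y) (at (snd c 1)) X"

(* The Lie algebra of a closed subgroup. *)
definition subgroup_lie_algebra :: "'g set \<Rightarrow> 'e set" where
  "subgroup_lie_algebra H = {X. \<forall>t::real. lie_exp (t *\<^sub>R X) \<in> H}"

definition linear_trace :: "('e \<Rightarrow> 'e) \<Rightarrow> real" where
  "linear_trace f = (\<Sum>b\<in>Basis. f b \<bullet> b)"

(* The negative of the Killing form. *)
definition Kil :: "'e \<Rightarrow> 'e \<Rightarrow> real" where
  "Kil X Y = - linear_trace (\<lambda>W. lie_bracket X (lie_bracket Y W))"

definition lie_ideal :: "'e set \<Rightarrow> bool" where
  "lie_ideal I \<longleftrightarrow> subspace I \<and> (\<forall>X. \<forall>Y\<in>I. lie_bracket X Y \<in> I)"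

definition derived_algebra :: "'e set \<Rightarrow> 'e set" where
  "derived_algebra I = span {lie_bracket X Y | X Y. X \<in> I \<and> Y \<in> I}"

definition semisimple_lie_algebra :: bool where
  "semisimple_lie_algebra \<longleftrightarrow>
     (\<forall>I. lie_ideal I \<and> (\<exists>n. (derived_algebra ^^ n) I = {0}) \<longrightarrow> I = {0})"

(* For f real-valued this is (\<delta>_V f)(x); for f with values in the Lie algebra it is the canonical
   connection (\<nabla>^c_V f)(x). *)
definition deriv_along :: "('g \<Rightarrow> 'e) \<Rightarrow> ('g \<Rightarrow> 'b::real_normed_vector) \<Rightarrow> 'g \<Rightarrow> 'b" where
  "deriv_along V f x = vector_derivative (\<lambda>t. f (x * lie_exp (t *\<^sub>R V x))) (at 0)"

end


section \<open>Linear algebra on subspaces\<close>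

definition linear_on_subspace ::
  "'a::real_vector set \<Rightarrow> ('a \<Rightarrow> 'b::real_vector) \<Rightarrow> bool" where
  "linear_on_subspace M f \<longleftrightarrow>
     (\<forall>x\<in>M. \<forall>y\<in>M. f (x + y) = f x + f y) \<and> (\<forall>r. \<forall>x\<in>M. f (r *\<^sub>R x) = r *\<^sub>R f x)"

(* T = S J on M with S = |T| positive self-adjoint and J orthogonal for the inner product B. *)
definition polar_decomposition_on ::
  "'a::real_vector set \<Rightarrow> ('a \<Rightarrow> 'a \<Rightarrow> real) \<Rightarrow> ('a \<Rightarrow> 'a) \<Rightarrow> ('a \<Rightarrow> 'a) \<Rightarrow> ('a \<Rightarrow> 'a) \<Rightarrow> bool"
  where
  "polar_decomposition_on M B T S J \<longleftrightarrow>
     linear_on_subspace M S \<and> S ` M \<subseteq> M \<and>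
     (\<forall>X\<in>M. \<forall>Y\<in>M. B (S X) Y = B X (S Y)) \<and> (\<forall>X\<in>M. 0 \<le> B (S X) X) \<and>
     linear_on_subspace M J \<and> J ` M = M \<and>
     (\<forall>X\<in>M. \<forall>Y\<in>M. B (J X) (J Y) = B X Y) \<and>
     (\<forall>X\<in>M. T X = S (J X))"


section \<open>The coadjoint orbit of a functional\<close>

context
  fixes A :: "('g::{group_mult, topological_space}, 'e::euclidean_space) chart set"
    and c :: "('g, 'e) chart"
    and \<mu> :: "'e \<Rightarrow> real"
begin

definition coadjoint :: "'g \<Rightarrow> 'e \<Rightarrow> real" where
  "coadjoint x = (\<lambda>X. \<mu> (Ad c (inverse x) X))"

definition stab :: "'g set" where
  "stab = {x. coadjoint x = \<mu>}"

definition Zmu :: 'e where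
  "Zmu = (THE Z. \<forall>X. \<mu> X = Kil c X Z)"

definition kalg :: "'e set" where
  "kalg = subgroup_lie_algebra A c stab"

definition mperp :: "'e set" where
  "mperp = {X. \<forall>Y\<in>kalg. Kil c X Y = 0}"

definition proj_m :: "'e \<Rightarrow> 'e" where
  "proj_m X = (THE Y. Y \<in> mperp \<and> X - Y \<in> kalg)"

definition torus :: "'g set" where
  "torus = closure (range (\<lambda>r::real. lie_exp A c (r *\<^sub>R Zmu)))"

definition talg :: "'e set" where
  "talg = subgroup_lie_algebra A c torus"

definition Gam :: "'e \<Rightarrow> 'e" where
  "Gam X = (THE W. W \<in> mperp \<and> (\<forall>Y\<in>mperp. \<mu> (lie_bracket c X Y) = Kil c W Y))"

(* Vector fields on G/K, and functions on G/K, viewed as equivariant functions on G. *)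
definition vector_fields :: "('g \<Rightarrow> 'e) set" where
  "vector_fields = {V. smooth_map A euclid_atlas V \<and> (\<forall>x. V x \<in> mperp) \<and>
     (\<forall>x. \<forall>s\<in>stab. V (x * s) = Ad c (inverse s) (V x))}"

definition orbit_functions :: "('g \<Rightarrow> real) set" where
  "orbit_functions = {f. smooth_map A euclid_atlas f \<and> (\<forall>x. \<forall>s\<in>stab. f (x * s) = f x)}"

definition connection :: "(('g \<Rightarrow> 'e) \<Rightarrow> ('g \<Rightarrow> 'e) \<Rightarrow> 'g \<Rightarrow> 'e) \<Rightarrow> bool" where
  "connection nabla \<longleftrightarrow>
     (\<forall>V\<in>vector_fields. \<forall>W\<in>vector_fields. nabla V W \<in> vector_fields) \<and>
     (\<forall>V\<in>vector_fields. \<forall>V'\<in>vector_fields. \<forall>W\<in>vector_fields.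
        nabla (\<lambda>x. V x + V' x) W = (\<lambda>x. nabla V W x + nabla V' W x)) \<and>
     (\<forall>f\<in>orbit_functions. \<forall>V\<in>vector_fields. \<forall>W\<in>vector_fields.
        nabla (\<lambda>x. f x *\<^sub>R V x) W = (\<lambda>x. f x *\<^sub>R nabla V W x)) \<and>
     (\<forall>V\<in>vector_fields. \<forall>W\<in>vector_fields. \<forall>W'\<in>vector_fields.
        nabla V (\<lambda>x. W x + W' x) = (\<lambda>x. nabla V W x + nabla V W' x)) \<and>
     (\<forall>f\<in>orbit_functions. \<forall>V\<in>vector_fields. \<forall>W\<in>vector_fields.
        nabla V (\<lambda>x. f x *\<^sub>R W x) =
          (\<lambda>x. deriv_along A c V f x *\<^sub>R W x + f x *\<^sub>R nabla V W x))"

(* A vector field is determined by the derivation it induces, and the bracket of vector fields is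
   the commutator of derivations. *)
definition torsion_free :: "(('g \<Rightarrow> 'e) \<Rightarrow> ('g \<Rightarrow> 'e) \<Rightarrow> 'g \<Rightarrow> 'e) \<Rightarrow> bool" where
  "torsion_free nabla \<longleftrightarrow>
     (\<forall>V\<in>vector_fields. \<forall>W\<in>vector_fields. \<forall>f\<in>orbit_functions. \<forall>x.
        deriv_along A c (\<lambda>y. nabla V W y - nabla W V y) f x =
          deriv_along A c V (deriv_along A c W f) x - deriv_along A c W (deriv_along A c V f) x)"

context
  fixes J :: "'e \<Rightarrow> 'e"
begin

definition orbit_metric :: "'e \<Rightarrow> 'e \<Rightarrow> real" where
  "orbit_metric X Y = \<mu> (lie_bracket c X (J Y))"

definition metric_compatible :: "(('g \<Rightarrow> 'e) \<Rightarrow> ('g \<Rightarrow> 'e) \<Rightarrow> 'g \<Rightarrow> 'e) \<Rightarrow> bool" where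
  "metric_compatible nabla \<longleftrightarrow>
     (\<forall>U\<in>vector_fields. \<forall>V\<in>vector_fields. \<forall>W\<in>vector_fields. \<forall>x.
        deriv_along A c U (\<lambda>y. orbit_metric (V y) (W y)) x =
          orbit_metric (nabla U V x) (W x) + orbit_metric (V x) (nabla U W x))"

definition levi_civita :: "(('g \<Rightarrow> 'e) \<Rightarrow> ('g \<Rightarrow> 'e) \<Rightarrow> 'g \<Rightarrow> 'e) \<Rightarrow> bool" where
  "levi_civita nabla \<longleftrightarrow> connection nabla \<and> torsion_free nabla \<and> metric_compatible nabla"

definition weight_space :: "('e \<Rightarrow> real) \<Rightarrow> 'e set" where
  "weight_space \<alpha> = {X\<in>mperp. \<forall>Z\<in>talg. lie_bracket c Z X = \<alpha> Z *\<^sub>R J X}"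

(* Functionals on talg are represented as functions that are undefined outside talg. *)
definition weights :: "('e \<Rightarrow> real) set" where
  "weights = {\<alpha>\<in>extensional talg. linear_on_subspace talg \<alpha> \<and> weight_space \<alpha> \<noteq> {0}}"

definition weight_fields :: "('e \<Rightarrow> real) \<Rightarrow> ('g \<Rightarrow> 'e) set" where
  "weight_fields \<alpha> = {V\<in>vector_fields. \<forall>x. V x \<in> weight_space \<alpha>}"

end

end

end

theory Submission
  imports Defs
begin

text \<open>Let \<open>D\<close> be the difference of the Levi-Civita and the canonical connection. The canonical
  connection is compatible with the metric and has torsion \<open>- P [V, W]\<close>, so \<open>D\<close> satisfies
  \<open>D(V, W) - D(W, V) = P [V, W]\<close> and \<open>D(U, -)\<close> is skew, and the Koszul trick determines it.
  Torsion is tested on the coordinate functions \<open>x \<mapsto> \<mu> (Ad x\<^sup>-\<^sup>1 Y)\<close> of the orbit, and every tangent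
  vector \<open>X\<close> at \<open>x\<close> extends to the global field \<open>y \<mapsto> P (Ad y\<^sup>-\<^sup>1 (Ad x X))\<close>.

  On weight spaces, with \<open>a = \<alpha>(Z)\<close> and \<open>b = \<beta>(Z)\<close>, the vectors \<open>E = [V, W] - [J V, J W]\<close> and
  \<open>F = [V, W] + [J V, J W]\<close> are eigenvectors of \<open>(ad Z)\<^sup>2\<close> with eigenvalues \<open>- (a + b)\<^sup>2\<close> and
  \<open>- (a - b)\<^sup>2\<close>. Hence \<open>E\<close> lies in the complement of the stabilizer algebra, and the metric is
  \<open>a + b\<close> resp. \<open>\<bar>a - b\<bar>\<close> times the Killing form on \<open>E\<close> resp. \<open>P F\<close>, which turns the Koszul
  identity into the stated formula.

  The Killing form is definite because \<open>exp (t ad X)\<close> is a bounded flow, so that \<open>ad X\<close> is skew for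
  some inner product.\<close>

section \<open>Smooth maps\<close>

text \<open>Origin of the constants: with \<open>br X Y = (E + F) / 2\<close>, the Koszul identity
  on weight vectors reads \<open>2 g(D, U) = g([X, Y], U) + (b - a) Kil([X, Y], U)\<close>. On
  \<open>E\<close> the Killing form is the metric divided by \<open>a + b\<close>, so the factor is
  \<open>1 + (b - a) / (a + b) = 2 b / (a + b)\<close>; on \<open>P F\<close> it is divided by the
  absolute value of \<open>a - b\<close>, so the factor is \<open>1 + sgn (b - a)\<close>. The
  quarter is one half from Koszul times one half from the splitting. Definiteness of the Killing
  form concerns only the values \<open>Kil X X\<close>, so each \<open>X\<close> may use its own
  inner product, averaged along the single flow \<open>exp (t X)\<close>. \<open>lie_exp\<close> is
  a definite description; existence and uniqueness of one-parameter subgroups therefore have to be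
  established from the group law and the charts. Tangent vectors occur only at 1, as velocities of
  curves, and identities for \<open>Ad\<close> and the bracket come from computing one velocity in
  two ways. The polar decomposition provides \<open>J\<close> merely as an isometry of
  \<open>mm\<close> onto itself. Its square and its relation to \<open>S\<close> are recovered from
  skewness of \<open>ad Z\<close>, and on eigenvectors from positivity of \<open>S\<close>.\<close>

lemma Ck_on_subset: "Ck_on k S f \<Longrightarrow> T \<subseteq> S \<Longrightarrow> Ck_on k T f"
  by (induction k arbitrary: f) (auto intro: continuous_on_subset differentiable_on_subset)

text \<open>Openness makes the two functions agree near each point, so their Frechet derivatives
  agree on \<open>S\<close> too and the induction can pass to them.\<close>

lemma Ck_on_cong:
  assumes "open S" "\<And>x. x \<in> S \<Longrightarrow> f x = g x"
  shows "Ck_on k S f \<longleftrightarrow> Ck_on k S g"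
proof -
  have "Ck_on k S g" if "Ck_on k S f" "\<And>x. x \<in> S \<Longrightarrow> f x = g x" for f g :: "'a \<Rightarrow> 'b"
    using that
  proof (induction k arbitrary: f g)
    case 0
    then show ?case by (simp cong: continuous_on_cong)
  next
    case (Suc k)
    have d: "f differentiable (at x)" if "x \<in> S" for x
      using Suc.prems(1) that \<open>open S\<close> by (auto simp: differentiable_on_eq_differentiable_at)
    have e: "frechet_derivative f (at x) = frechet_derivative g (at x)" if "x \<in> S" for x
      by (rule frechet_derivative_transform_within_open[OF d[OF that] \<open>open S\<close> that])
        (rule Suc.prems(2))
    have "g differentiable (at x)" if "x \<in> S" for x
    proof -
      have "(g has_derivative frechet_derivative f (at x)) (at x)"
        using d[OF that] Suc.prems(2) unfolding frechet_derivative_works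
        by (rule has_derivative_transform_within_open[OF _ \<open>open S\<close> that])
      then show ?thesis by (rule differentiableI)
    qed
    moreover have "Ck_on k S (\<lambda>x. frechet_derivative g (at x) v)" for v
    proof (rule Suc.IH)
      show "Ck_on k S (\<lambda>x. frechet_derivative f (at x) v)" using Suc.prems(1) by simp
    qed (simp add: e)
    ultimately show ?case
      using \<open>open S\<close> by (auto simp: differentiable_on_eq_differentiable_at)
  qed
  from this[of f g] this[of g f] assms(2) show ?thesis by auto
qed

text \<open>The derivatives in \<open>Ck_on\<close> are taken at a point of the full space, so they
  do not depend on the set. This is what allows smoothness of a map of manifolds to be checked in
  one convenient chart around each point.\<close>

lemma Ck_on_local:
  assumes "\<And>x. x \<in> S \<Longrightarrow> \<exists>N. open N \<and> x \<in> N \<and> Ck_on k N f"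
  shows "Ck_on k S f"
  using assms
proof (induction k arbitrary: f)
  case 0
  have "continuous (at x within S) f" if x: "x \<in> S" for x
  proof -
    from 0[OF x] obtain N where "open N" "x \<in> N" "continuous_on N f" by auto
    then show ?thesis by (metis continuous_at_imp_continuous_at_within
        continuous_on_eq_continuous_at)
  qed
  then show ?case by (simp add: continuous_on_eq_continuous_within)
next
  case (Suc k)
  have "f differentiable (at x within S)" if x: "x \<in> S" for x
  proof -
    from Suc.prems[OF x] obtain N where "open N" "x \<in> N" "f differentiable_on N" by auto
    then have "f differentiable (at x)" by (auto simp: differentiable_on_eq_differentiable_at)
    then show ?thesis by (rule differentiable_at_withinI)
  qed
  moreover have "Ck_on k S (\<lambda>x. frechet_derivative f (at x) v)" for v
  proof (rule Suc.IH)
    fix x assume "x \<in> S"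
    from Suc.prems[OF this] show "\<exists>N. open N \<and> x \<in> N \<and> Ck_on k N (\<lambda>x. frechet_derivative f (at x)
        v)"
      unfolding Ck_on.simps by blast
  qed
  ultimately show ?case by (simp add: differentiable_on_def)
qed

lemma Ck_on_SucD: "Ck_on (Suc k) S f \<Longrightarrow> Ck_on k S f"
proof (induction k arbitrary: f)
  case 0
  then show ?case by (auto intro: differentiable_imp_continuous_on)
next
  case (Suc k)
  from Suc.prems have "f differentiable_on S"
    "\<And>v. Ck_on (Suc k) S (\<lambda>x. frechet_derivative f (at x) v)"
    unfolding Ck_on.simps(2)[of "Suc k"] by blast+
  with Suc.IH show ?case unfolding Ck_on.simps(2)[of k] by blast
qed

lemma Ck_on_const [simp]: "Ck_on k S (\<lambda>x. c)"
  by (induction k arbitrary: c) auto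

text \<open>Introduction rule with an explicit derivative, so that the calculus rules of
  \<open>has_derivative\<close> can be used in place of \<open>frechet_derivative\<close>.\<close>

lemma Ck_on_SucI:
  assumes "open S" "\<And>x. x \<in> S \<Longrightarrow> (f has_derivative f' x) (at x)"
    "\<And>v. Ck_on k S (\<lambda>x. f' x v)"
  shows "Ck_on (Suc k) S f"
proof -
  have e: "frechet_derivative f (at x) = f' x" if "x \<in> S" for x
    using frechet_derivative_at[OF assms(2)[OF that]] by simp
  have "Ck_on k S (\<lambda>x. frechet_derivative f (at x) v)" for v
    using Ck_on_cong[OF \<open>open S\<close>, of "\<lambda>x. frechet_derivative f (at x) v" "\<lambda>x. f' x v" k] e assms(3)
    by simp
  then show ?thesis using assms(1,2)
    by (auto simp: differentiable_on_eq_differentiable_at differentiable_def)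
qed

lemma Ck_on_has_derivative:
  assumes "open S" "Ck_on (Suc k) S f" "x \<in> S"
  shows "(f has_derivative frechet_derivative f (at x)) (at x)"
  using assms frechet_derivative_works[of f "at x"]
  by (auto simp: differentiable_on_eq_differentiable_at)

lemma Ck_on_linear_comp:
  assumes "open S" "bounded_linear h" "Ck_on k S f"
  shows "Ck_on k S (\<lambda>x. h (f x))"
  using assms(3)
proof (induction k arbitrary: f)
  case 0
  then show ?case by (simp add: bounded_linear.continuous_on[OF assms(2)])
next
  case (Suc k)
  show ?case
  proof (rule Ck_on_SucI[OF \<open>open S\<close>])
    show "((\<lambda>x. h (f x)) has_derivative (\<lambda>v. h (frechet_derivative f (at x) v))) (at x)"
      if "x \<in> S" for x
      using bounded_linear.has_derivative[OF assms(2) Ck_on_has_derivative[OF \<open>open S\<close> Suc.prems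
          that]] .
    show "Ck_on k S (\<lambda>x. h (frechet_derivative f (at x) v))" for v
      by (rule Suc.IH) (use Suc.prems in auto)
  qed
qed

lemma Ck_on_add:
  assumes "open S" "Ck_on k S f" "Ck_on k S g"
  shows "Ck_on k S (\<lambda>x. f x + g x)"
  using assms(2,3)
proof (induction k arbitrary: f g)
  case 0
  then show ?case by (auto intro: continuous_intros)
next
  case (Suc k)
  show ?case
  proof (rule Ck_on_SucI[OF \<open>open S\<close>])
    show "((\<lambda>x. f x + g x) has_derivative
        (\<lambda>v. frechet_derivative f (at x) v + frechet_derivative g (at x) v)) (at x)"
      if "x \<in> S" for x
      by (rule has_derivative_add; rule Ck_on_has_derivative[OF \<open>open S\<close> _ that]; rule Suc.prems)
    show "Ck_on k S (\<lambda>x. frechet_derivative f (at x) v + frechet_derivative g (at x) v)" for v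
      by (rule Suc.IH) (use Suc.prems in auto)
  qed
qed

lemma Ck_on_sum:
  assumes "open S" "finite I" "\<And>i. i \<in> I \<Longrightarrow> Ck_on k S (f i)"
  shows "Ck_on k S (\<lambda>x. \<Sum>i\<in>I. f i x)"
  using assms(2,3) by (induction I rule: finite_induct) (simp_all add: Ck_on_add[OF assms(1)])

text \<open>Each summand of the product rule keeps one factor undifferentiated;
  \<open>Ck_on_SucD\<close> lowers that factor to the order of the induction hypothesis.\<close>

lemma Ck_on_bilinear:
  fixes f :: "'a::euclidean_space \<Rightarrow> 'b::euclidean_space" and g :: "'a \<Rightarrow> 'c::euclidean_space"
    and h :: "'b \<Rightarrow> 'c \<Rightarrow> 'd::euclidean_space"
  assumes "open S" "bounded_bilinear h" "Ck_on k S f" "Ck_on k S g"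
  shows "Ck_on k S (\<lambda>x. h (f x) (g x))"
  using assms(3,4)
proof (induction k arbitrary: f g)
  case 0
  then show ?case by (auto intro: bounded_bilinear.continuous_on[OF assms(2)])
next
  case (Suc k)
  show ?case
  proof (rule Ck_on_SucI[OF \<open>open S\<close>])
    show "((\<lambda>x. h (f x) (g x)) has_derivative
        (\<lambda>v. h (f x) (frechet_derivative g (at x) v) + h (frechet_derivative f (at x) v) (g x)))
            (at x)"
      if "x \<in> S" for x
      by (rule bounded_bilinear.FDERIV[OF assms(2)]; rule Ck_on_has_derivative[OF \<open>open S\<close> _
          that]; rule Suc.prems)
    show "Ck_on k S (\<lambda>x. h (f x) (frechet_derivative g (at x) v)
        + h (frechet_derivative f (at x) v) (g x))" for v
      by (rule Ck_on_add[OF \<open>open S\<close>]; rule Suc.IH)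
        (use Suc.prems Suc.prems[THEN Ck_on_SucD] in auto)
  qed
qed

lemma linear_expand_Basis:
  fixes f :: "'a::euclidean_space \<Rightarrow> 'b::real_vector"
  assumes "linear f"
  shows "f w = (\<Sum>b\<in>Basis. (w \<bullet> b) *\<^sub>R f b)"
proof -
  have "f w = f (\<Sum>b\<in>Basis. (w \<bullet> b) *\<^sub>R b)"
    by (simp only: euclidean_representation)
  also have "\<dots> = (\<Sum>b\<in>Basis. (w \<bullet> b) *\<^sub>R f b)"
    by (simp only: linear_sum[OF assms] linear_cmul[OF assms])
  finally show ?thesis .
qed

text \<open>The chain rule differentiates \<open>g\<close> in a direction that varies with
  \<open>x\<close>, while \<open>Ck_on\<close> speaks only of fixed directions. Expanding that
  direction in \<open>Basis\<close> leaves scalar functions times derivatives of \<open>g\<close> in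
  basis directions, composed with \<open>f\<close>, and the induction hypothesis applies to
  these.\<close>

lemma Ck_on_compose:
  fixes f :: "'a::euclidean_space \<Rightarrow> 'b::euclidean_space" and g :: "'b \<Rightarrow> 'c::euclidean_space"
  assumes "open S" "open T" "f ` S \<subseteq> T" "Ck_on k S f" "Ck_on k T g"
  shows "Ck_on k S (\<lambda>x. g (f x))"
  using assms(4,5)
proof (induction k arbitrary: g)
  case 0
  then show ?case using assms(3) by (auto intro: continuous_on_compose2)
next
  case (Suc k)
  note fD = Ck_on_has_derivative[OF \<open>open S\<close> Suc.prems(1)]
  have gD: "(g has_derivative frechet_derivative g (at (f x))) (at (f x))" if "x \<in> S" for x
    using Ck_on_has_derivative[OF \<open>open T\<close> Suc.prems(2)] assms(3) that by auto
  show ?case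
  proof (rule Ck_on_SucI[OF \<open>open S\<close>])
    show "((\<lambda>x. g (f x)) has_derivative (\<lambda>v. \<Sum>b\<in>Basis. (frechet_derivative f (at x) v \<bullet> b) *\<^sub>R
        frechet_derivative g (at (f x)) b)) (at x)" if "x \<in> S" for x
    proof -
      have lin: "linear (frechet_derivative g (at (f x)))"
        using gD[OF that] by (rule has_derivative_linear)
      have "((\<lambda>x. g (f x)) has_derivative
          (\<lambda>v. frechet_derivative g (at (f x)) (frechet_derivative f (at x) v))) (at x)"
        using diff_chain_at[OF fD[OF that] gD[OF that]] by (simp add: o_def)
      also have "(\<lambda>v. frechet_derivative g (at (f x)) (frechet_derivative f (at x) v)) =
          (\<lambda>v. \<Sum>b\<in>Basis. (frechet_derivative f (at x) v \<bullet> b) *\<^sub>R frechet_derivative g (at (f x)) b)"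
        by (rule ext, rule linear_expand_Basis[OF lin])
      finally show ?thesis .
    qed
    show "Ck_on k S (\<lambda>x. \<Sum>b\<in>Basis. (frechet_derivative f (at x) v \<bullet> b) *\<^sub>R
        frechet_derivative g (at (f x)) b)" for v
    proof (rule Ck_on_sum[OF \<open>open S\<close> finite_Basis],
        rule Ck_on_bilinear[OF \<open>open S\<close> bounded_bilinear_scaleR])
      fix b :: 'b
      show "Ck_on k S (\<lambda>x. frechet_derivative f (at x) v \<bullet> b)"
        by (rule Ck_on_linear_comp[OF \<open>open S\<close> bounded_linear_inner_left]) (use Suc.prems(1) in
            auto)
      show "Ck_on k S (\<lambda>x. frechet_derivative g (at (f x)) b)"
        by (rule Suc.IH[OF Ck_on_SucD[OF Suc.prems(1)]]) (use Suc.prems(2) in auto)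
    qed
  qed
qed

lemma Ck_on_ident [simp]: "open S \<Longrightarrow> Ck_on k S (\<lambda>x. x)"
  by (cases k) auto

lemma smooth_on_subset: "smooth_on S f \<Longrightarrow> T \<subseteq> S \<Longrightarrow> smooth_on T f"
  unfolding smooth_on_def by (blast intro: Ck_on_subset)

lemma smooth_on_cong:
  "open S \<Longrightarrow> (\<And>x. x \<in> S \<Longrightarrow> f x = g x) \<Longrightarrow> smooth_on S f \<longleftrightarrow> smooth_on S g"
  unfolding smooth_on_def using Ck_on_cong[of S f g] by blast

lemma smooth_on_local:
  "(\<And>x. x \<in> S \<Longrightarrow> \<exists>N. open N \<and> x \<in> N \<and> smooth_on N f) \<Longrightarrow> smooth_on S f"
  unfolding smooth_on_def by (intro allI Ck_on_local) blast

lemma smooth_on_const [simp]: "smooth_on S (\<lambda>x. c)"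
  by (simp add: smooth_on_def)

lemma smooth_on_ident [simp]: "open S \<Longrightarrow> smooth_on S (\<lambda>x. x)"
  by (simp add: smooth_on_def)

lemma smooth_on_linear_comp:
  "open S \<Longrightarrow> bounded_linear h \<Longrightarrow> smooth_on S f \<Longrightarrow> smooth_on S (\<lambda>x. h (f x))"
  unfolding smooth_on_def by (intro allI; rule Ck_on_linear_comp[where f = f]; blast)

lemma smooth_on_add:
  "open S \<Longrightarrow> smooth_on S f \<Longrightarrow> smooth_on S g \<Longrightarrow> smooth_on S (\<lambda>x. f x + g x)"
  unfolding smooth_on_def by (intro allI; rule Ck_on_add; blast)

lemma smooth_on_Pair:
  assumes "open S" "smooth_on S f" "smooth_on S g"
  shows "smooth_on S (\<lambda>x. (f x, g x))"
proof -
  have l: "bounded_linear (\<lambda>x. (x, 0))" and r: "bounded_linear (\<lambda>x. (0, x))"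
    by (intro bounded_linear_Pair bounded_linear_ident bounded_linear_zero)+
  show ?thesis
    using smooth_on_add[OF assms(1) smooth_on_linear_comp[OF assms(1) l assms(2)]
      smooth_on_linear_comp[OF assms(1) r assms(3)]] by simp
qed

lemma smooth_on_compose:
  fixes f :: "'a::euclidean_space \<Rightarrow> 'b::euclidean_space" and g :: "'b \<Rightarrow> 'c::euclidean_space"
  shows "open S \<Longrightarrow> open T \<Longrightarrow> f ` S \<subseteq> T \<Longrightarrow> smooth_on S f \<Longrightarrow> smooth_on T g \<Longrightarrow>
    smooth_on S (\<lambda>x. g (f x))"
  unfolding smooth_on_def by (intro allI; rule Ck_on_compose[where f = f and g = g and T = T];
      blast)

lemma smooth_on_has_derivative:
  "open S \<Longrightarrow> smooth_on S f \<Longrightarrow> x \<in> S \<Longrightarrow> (f has_derivative frechet_derivative f (at x)) (at x)"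
  unfolding smooth_on_def by (rule Ck_on_has_derivative) blast+

lemma smooth_on_derivative:
  "smooth_on S f \<Longrightarrow> smooth_on S (\<lambda>x. frechet_derivative f (at x) v)"
  unfolding smooth_on_def using Ck_on.simps(2)[of _ S f] by blast

lemma smooth_on_imp_continuous_on: "smooth_on S f \<Longrightarrow> continuous_on S f"
  unfolding smooth_on_def using Ck_on.simps(1)[of S f] by blast

lemma smooth_on_transform:
  "smooth_on S f \<Longrightarrow> open S \<Longrightarrow> (\<And>x. x \<in> S \<Longrightarrow> f x = g x) \<Longrightarrow> smooth_on S g"
  using smooth_on_cong[of S f g] by blast

lemma smooth_on_differentiable:
  "open S \<Longrightarrow> smooth_on S f \<Longrightarrow> x \<in> S \<Longrightarrow> f differentiable (at x)"
  using smooth_on_has_derivative differentiableI by blast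

section \<open>Charts, atlases and smooth maps between manifolds\<close>

lemma
  assumes "smooth_atlas A"
  shows atlas_cover: "\<exists>c\<in>A. x \<in> fst c"
    and chart_open: "c \<in> A \<Longrightarrow> open (fst c)"
    and chart_open_image: "c \<in> A \<Longrightarrow> open (snd c ` fst c)"
    and chart_homeo: "c \<in> A \<Longrightarrow> homeomorphism (fst c) (snd c ` fst c) (snd c) (chart_inv c)"
    and chart_transition: "c \<in> A \<Longrightarrow> d \<in> A \<Longrightarrow>
      smooth_on (snd c ` (fst c \<inter> fst d)) (snd d \<circ> chart_inv c)"
  using assms unfolding smooth_atlas_def by auto

lemma chart_inv_left:
  assumes "smooth_atlas A" "c \<in> A" "x \<in> fst c"
  shows "chart_inv c (snd c x) = x"
  using chart_homeo[OF assms(1,2)] assms(3) by (simp add: homeomorphism_def)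

lemma chart_inv_right:
  assumes "smooth_atlas A" "c \<in> A" "u \<in> snd c ` fst c"
  shows "chart_inv c u \<in> fst c" "snd c (chart_inv c u) = u"
  using chart_homeo[OF assms(1,2)] assms(3) by (auto simp: homeomorphism_def)

lemma chart_image_open:
  assumes "smooth_atlas A" "c \<in> A" "open W"
  shows "open (snd c ` (fst c \<inter> W))"
proof -
  have "openin (top_of_set (snd c ` fst c)) (snd c ` (fst c \<inter> W))"
    by (rule homeomorphism_imp_open_map[OF chart_homeo[OF assms(1,2)]])
      (use \<open>open W\<close> in \<open>auto simp: openin_open\<close>)
  then show ?thesis using chart_open_image[OF assms(1,2)] openin_open_trans by blast
qed

lemma smooth_map_open_dom:
  assumes "smooth_atlas A" "smooth_atlas B" "c \<in> A" "d \<in> B" "continuous_on UNIV f"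
  shows "open (snd c ` (fst c \<inter> f -` fst d))"
  using chart_image_open[OF assms(1,3)] open_vimage[OF chart_open[OF assms(2,4)] assms(5)] .

lemma smooth_mapD:
  assumes "smooth_map A B f"
  shows "continuous_on UNIV f"
    and "c \<in> A \<Longrightarrow> d \<in> B \<Longrightarrow> smooth_on (snd c ` (fst c \<inter> f -` fst d)) (\<lambda>u. snd d (f (chart_inv c u)))"
  using assms unfolding smooth_map_def by (auto simp: o_def)

lemma smooth_mapI:
  assumes "continuous_on UNIV f"
    "\<And>c d. c \<in> A \<Longrightarrow> d \<in> B \<Longrightarrow>
      smooth_on (snd c ` (fst c \<inter> f -` fst d)) (\<lambda>u. snd d (f (chart_inv c u)))"
  shows "smooth_map A B f"
  using assms unfolding smooth_map_def by (auto simp: o_def)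

lemma smooth_map_compose:
  assumes A: "smooth_atlas A" and B: "smooth_atlas B" and C: "smooth_atlas C"
    and f: "smooth_map A B f" and g: "smooth_map B C g"
  shows "smooth_map A C (\<lambda>x. g (f x))"
proof (rule smooth_mapI)
  show "continuous_on UNIV (\<lambda>x. g (f x))"
    using smooth_mapD(1)[OF f] smooth_mapD(1)[OF g] continuous_on_compose2 by blast
  fix c e assume c: "c \<in> A" and e: "e \<in> C"
  show "smooth_on (snd c ` (fst c \<inter> (\<lambda>x. g (f x)) -` fst e)) (\<lambda>u. snd e (g (f (chart_inv c u))))"
  proof (rule smooth_on_local)
    fix u assume "u \<in> snd c ` (fst c \<inter> (\<lambda>x. g (f x)) -` fst e)"
    then obtain p where p: "u = snd c p" "p \<in> fst c" "g (f p) \<in> fst e" by auto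
    obtain d where d: "d \<in> B" "f p \<in> fst d" using atlas_cover[OF B] by blast
    \<comment> \<open>Both coordinate expressions are defined on the points of the chart
      \<open>d\<close> that \<open>g\<close> sends into the chart \<open>e\<close>.\<close>
    define W where "W = fst d \<inter> g -` fst e"
    have W: "open W" unfolding W_def
      by (intro open_Int chart_open[OF B] open_vimage chart_open[OF C] d e smooth_mapD(1)[OF g])
    define N where "N = snd c ` (fst c \<inter> f -` W)"
    have N: "open N" unfolding N_def
      by (intro chart_image_open[OF A] c open_vimage W smooth_mapD(1)[OF f])
    let ?h = "\<lambda>u. snd d (f (chart_inv c u))" and ?k = "\<lambda>v. snd e (g (chart_inv d v))"
    have sub: "?h ` N \<subseteq> snd d ` W"
      unfolding N_def by (auto simp: chart_inv_left[OF A c])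
    have "snd d ` W \<subseteq> snd d ` (fst d \<inter> g -` fst e)" by (auto simp: W_def)
    then have k: "smooth_on (snd d ` W) ?k"
      using smooth_on_subset[OF smooth_mapD(2)[OF g d(1) e]] by blast
    have "N \<subseteq> snd c ` (fst c \<inter> f -` fst d)" by (auto simp: N_def W_def)
    then have h: "smooth_on N ?h"
      using smooth_on_subset[OF smooth_mapD(2)[OF f c d(1)]] by blast
    have oW: "open (snd d ` W)"
      using chart_image_open[OF B d(1) W] by (simp add: W_def Int_absorb1)
    have "smooth_on N (\<lambda>u. ?k (?h u))"
      by (rule smooth_on_compose[where f = ?h and g = ?k, OF N oW sub h k])
    then have "smooth_on N (\<lambda>u. snd e (g (f (chart_inv c u))))"
      by (rule smooth_on_transform[OF _ N])
        (auto simp: N_def W_def chart_inv_left[OF A c] chart_inv_left[OF B d(1)])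
    then show "\<exists>N. open N \<and> u \<in> N \<and> smooth_on N (\<lambda>u. snd e (g (f (chart_inv c u))))"
      using N p d by (intro exI[of _ N]) (auto simp: N_def W_def)
  qed
qed

lemma smooth_map_ident:
  assumes "smooth_atlas A"
  shows "smooth_map A A (\<lambda>x. x)"
  using chart_transition[OF assms] by (intro smooth_mapI) (auto simp: o_def)

lemma smooth_map_const:
  assumes "smooth_atlas A"
  shows "smooth_map A B (\<lambda>x. y)"
  by (intro smooth_mapI) auto

text \<open>\<open>chart_inv\<close> is an \<open>inv_into\<close>, so injectivity fixes its value
  on the image of the chart domain, and only there.\<close>

lemma chart_inv_prod:
  assumes "smooth_atlas A" "smooth_atlas B" "c \<in> A" "d \<in> B"
    and "w \<in> snd c ` fst c \<times> snd d ` fst d"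
  shows "chart_inv (fst c \<times> fst d, \<lambda>(x, y). (snd c x, snd d y)) w =
    (chart_inv c (fst w), chart_inv d (snd w))"
proof -
  from assms(5) obtain x y where w: "w = (snd c x, snd d y)" "x \<in> fst c" "y \<in> fst d" by auto
  have "inj_on (\<lambda>(x, y). (snd c x, snd d y)) (fst c \<times> fst d)"
    by (rule inj_onI, clarsimp)
      (metis chart_inv_left[OF assms(1,3)] chart_inv_left[OF assms(2,4)])
  from inv_into_f_f[OF this, of "(x, y)"] show ?thesis
    using w by (simp add: chart_inv_def[of "(fst c \<times> fst d, _)"]
        chart_inv_left[OF assms(1,3)] chart_inv_left[OF assms(2,4)])
qed

lemma smooth_on_fst_comp:
  assumes "open S" "open T" "smooth_on S f"
  shows "smooth_on (S \<times> T) (\<lambda>w. f (fst w))"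
  by (rule smooth_on_compose[where f = fst and g = f, OF open_Times[OF assms(1,2)] assms(1) _ _
      assms(3)])
    (auto intro: smooth_on_linear_comp[OF open_Times bounded_linear_fst smooth_on_ident]
        open_Times assms)

lemma smooth_on_snd_comp:
  assumes "open S" "open T" "smooth_on T f"
  shows "smooth_on (S \<times> T) (\<lambda>w. f (snd w))"
  by (rule smooth_on_compose[where f = snd and g = f, OF open_Times[OF assms(1,2)] assms(2) _ _
      assms(3)])
    (auto intro: smooth_on_linear_comp[OF open_Times bounded_linear_snd smooth_on_ident]
        open_Times assms)

lemma smooth_map_fst:
  assumes A: "smooth_atlas A" and B: "smooth_atlas B"
  shows "smooth_map (prod_atlas A B) A fst"
proof (rule smooth_mapI)
  show "continuous_on UNIV fst" by (intro continuous_intros)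
  fix p e assume "p \<in> prod_atlas A B" and e: "e \<in> A"
  then obtain c d where p: "p = (fst c \<times> fst d, \<lambda>(x, y). (snd c x, snd d y))" "c \<in> A" "d \<in> B"
    unfolding prod_atlas_def by auto
  define S where "S = snd c ` (fst c \<inter> fst e)"
  define T where "T = snd d ` fst d"
  have oS: "open S" unfolding S_def by (rule chart_image_open[OF A p(2) chart_open[OF A e]])
  have oT: "open T" unfolding T_def by (rule chart_open_image[OF B p(3)])
  have "smooth_on (S \<times> T) (\<lambda>w. snd e (chart_inv c (fst w)))"
    by (rule smooth_on_fst_comp[OF oS oT])
      (use chart_transition[OF A p(2) e] in \<open>simp add: S_def o_def\<close>)
  then have "smooth_on (S \<times> T) (\<lambda>w. snd e (fst (chart_inv p w)))"
    by (rule smooth_on_transform[OF _ open_Times[OF oS oT]])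
      (auto simp: p(1) S_def T_def chart_inv_prod[OF A B p(2,3)])
  moreover have "snd p ` (fst p \<inter> fst -` fst e) = S \<times> T"
    by (force simp: p(1) S_def T_def)
  ultimately show "smooth_on (snd p ` (fst p \<inter> fst -` fst e)) (\<lambda>w. snd e (fst (chart_inv p w)))"
    by simp
qed

lemma smooth_map_snd:
  assumes A: "smooth_atlas A" and B: "smooth_atlas B"
  shows "smooth_map (prod_atlas A B) B snd"
proof (rule smooth_mapI)
  show "continuous_on UNIV snd" by (intro continuous_intros)
  fix p e assume "p \<in> prod_atlas A B" and e: "e \<in> B"
  then obtain c d where p: "p = (fst c \<times> fst d, \<lambda>(x, y). (snd c x, snd d y))" "c \<in> A" "d \<in> B"
    unfolding prod_atlas_def by auto
  define S where "S = snd c ` fst c"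
  define T where "T = snd d ` (fst d \<inter> fst e)"
  have oS: "open S" unfolding S_def by (rule chart_open_image[OF A p(2)])
  have oT: "open T" unfolding T_def by (rule chart_image_open[OF B p(3) chart_open[OF B e]])
  have "smooth_on (S \<times> T) (\<lambda>w. snd e (chart_inv d (snd w)))"
    by (rule smooth_on_snd_comp[OF oS oT])
      (use chart_transition[OF B p(3) e] in \<open>simp add: T_def o_def\<close>)
  then have "smooth_on (S \<times> T) (\<lambda>w. snd e (snd (chart_inv p w)))"
    by (rule smooth_on_transform[OF _ open_Times[OF oS oT]])
      (auto simp: p(1) S_def T_def chart_inv_prod[OF A B p(2,3)])
  moreover have "snd p ` (fst p \<inter> snd -` fst e) = S \<times> T"
    by (force simp: p(1) S_def T_def)
  ultimately show "smooth_on (snd p ` (fst p \<inter> snd -` fst e)) (\<lambda>w. snd e (snd (chart_inv p w)))"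
    by simp
qed

lemma homeomorphism_Times:
  assumes "homeomorphism S S' f f'" "homeomorphism T T' g g'"
  shows "homeomorphism (S \<times> T) (S' \<times> T') (\<lambda>(x, y). (f x, g y)) (\<lambda>(x, y). (f' x, g' y))"
proof (rule homeomorphismI)
  have "continuous_on S f" "continuous_on T g" "continuous_on S' f'" "continuous_on T' g'"
    using assms by (auto simp: homeomorphism_def)
  then show "continuous_on (S \<times> T) (\<lambda>(x, y). (f x, g y))"
    and "continuous_on (S' \<times> T') (\<lambda>(x, y). (f' x, g' y))"
    unfolding case_prod_unfold
    by (auto intro!: continuous_intros elim!: continuous_on_compose2)
qed (use assms in \<open>auto simp: homeomorphism_def\<close>)

lemma smooth_atlas_prod:
  assumes A: "smooth_atlas A" and B: "smooth_atlas B"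
  shows "smooth_atlas (prod_atlas A B)"
  unfolding smooth_atlas_def
proof (intro conjI ballI)
  have "\<exists>p\<in>prod_atlas A B. (x, y) \<in> fst p" for x y
  proof -
    obtain c where c: "c \<in> A" "x \<in> fst c" using atlas_cover[OF A] by blast
    obtain d where d: "d \<in> B" "y \<in> fst d" using atlas_cover[OF B] by blast
    have "(fst c \<times> fst d, \<lambda>(x, y). (snd c x, snd d y)) \<in> prod_atlas A B"
      using c(1) d(1) unfolding prod_atlas_def by blast
    then show ?thesis using c(2) d(2) by (intro bexI) auto
  qed
  then show "(\<Union>p\<in>prod_atlas A B. fst p) = UNIV" by fastforce
  fix p assume pp: "p \<in> prod_atlas A B"
  then obtain c d where p: "p = (fst c \<times> fst d, \<lambda>(x, y). (snd c x, snd d y))" "c \<in> A" "d \<in> B"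
    unfolding prod_atlas_def by auto
  show "open (fst p)" using p by (simp add: open_Times chart_open[OF A] chart_open[OF B])
  have im: "snd p ` fst p = snd c ` fst c \<times> snd d ` fst d" by (force simp: p(1))
  show "open (snd p ` fst p)"
    using p unfolding im by (simp add: open_Times chart_open_image[OF A] chart_open_image[OF B])
  have "homeomorphism (fst p) (snd p ` fst p) (snd p) (\<lambda>(x, y). (chart_inv c x, chart_inv d y))"
    unfolding im using homeomorphism_Times[OF chart_homeo[OF A p(2)] chart_homeo[OF B p(3)]]
    by (simp add: p(1))
  moreover have "chart_inv p w = (\<lambda>(x, y). (chart_inv c x, chart_inv d y)) w" if
      "w \<in> snd p ` fst p" for w
    using chart_inv_prod[OF A B p(2,3), of w] that unfolding im by (auto simp: p(1))
  ultimately show "homeomorphism (fst p) (snd p ` fst p) (snd p) (chart_inv p)"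
    by (metis (no_types, lifting) homeomorphism_cong)
  fix q assume "q \<in> prod_atlas A B"
  then obtain c' d' where q: "q = (fst c' \<times> fst d', \<lambda>(x, y). (snd c' x, snd d' y))" "c' \<in> A"
      "d' \<in> B"
    unfolding prod_atlas_def by auto
  define S where "S = snd c ` (fst c \<inter> fst c') \<times> snd d ` (fst d \<inter> fst d')"
  have S: "S = snd p ` (fst p \<inter> fst q)" by (force simp: p(1) q(1) S_def)
  have "S \<subseteq> snd p ` (fst p \<inter> fst -` fst c')" "S \<subseteq> snd p ` (fst p \<inter> snd -` fst d')"
    unfolding S by (auto simp: q(1))
  note * = smooth_on_subset[OF smooth_mapD(2)[OF smooth_map_fst[OF A B] pp q(2)] this(1)]
    smooth_on_subset[OF smooth_mapD(2)[OF smooth_map_snd[OF A B] pp q(3)] this(2)]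
  have "open S"
    unfolding S_def by (intro open_Times chart_image_open[OF A] chart_image_open[OF B] p q
        chart_open[OF A] chart_open[OF B])
  from smooth_on_Pair[OF this *]
  show "smooth_on (snd p ` (fst p \<inter> fst q)) (snd q \<circ> chart_inv p)"
    unfolding S[symmetric] by (simp add: q(1) o_def case_prod_unfold)
qed

lemma smooth_map_Pair:
  assumes A: "smooth_atlas A" and B: "smooth_atlas B" and C: "smooth_atlas C"
    and f: "smooth_map A B f" and g: "smooth_map A C g"
  shows "smooth_map A (prod_atlas B C) (\<lambda>x. (f x, g x))"
proof (rule smooth_mapI)
  show c: "continuous_on UNIV (\<lambda>x. (f x, g x))"
    by (intro continuous_intros smooth_mapD(1)[OF f] smooth_mapD(1)[OF g])
  fix c p assume c: "c \<in> A" and "p \<in> prod_atlas B C"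
  then obtain d e where p: "p = (fst d \<times> fst e, \<lambda>(x, y). (snd d x, snd e y))" "d \<in> B" "e \<in> C"
    unfolding prod_atlas_def by auto
  let ?S = "snd c ` (fst c \<inter> (\<lambda>x. (f x, g x)) -` fst p)"
  have "open ((\<lambda>x. (f x, g x)) -` fst p)"
    by (intro open_vimage) (auto simp: p(1) intro!: open_Times chart_open[OF B p(2)] chart_open[OF
        C p(3)]
        continuous_intros smooth_mapD(1)[OF f] smooth_mapD(1)[OF g])
  then have S: "open ?S" by (rule chart_image_open[OF A c])
  have "?S \<subseteq> snd c ` (fst c \<inter> f -` fst d)" "?S \<subseteq> snd c ` (fst c \<inter> g -` fst e)"
    by (auto simp: p(1))
  from smooth_on_Pair[OF S smooth_on_subset[OF smooth_mapD(2)[OF f c p(2)] this(1)]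
      smooth_on_subset[OF smooth_mapD(2)[OF g c p(3)] this(2)]]
  show "smooth_on ?S (\<lambda>u. snd p (f (chart_inv c u), g (chart_inv c u)))"
    by (simp add: p(1))
qed

lemma chart_inv_euclid [simp]: "chart_inv (UNIV, \<lambda>x. x) = (\<lambda>x. x)"
  by (auto simp: chart_inv_def inv_into_def)

lemma smooth_atlas_euclid: "smooth_atlas (euclid_atlas :: ('e::euclidean_space, 'e) chart set)"
  unfolding smooth_atlas_def euclid_atlas_def
  by (auto simp: o_def intro!: homeomorphismI continuous_intros)

lemma smooth_map_euclidD:
  assumes "smooth_map A euclid_atlas f" "c \<in> A"
  shows "smooth_on (snd c ` fst c) (\<lambda>u. f (chart_inv c u))"
  using smooth_mapD(2)[OF assms, of "(UNIV, \<lambda>x. x)"] by (simp add: euclid_atlas_def)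

text \<open>Continuity need not be supplied: it holds on each chart domain, and these are an open
  cover.\<close>

lemma smooth_map_euclidI:
  assumes "smooth_atlas A" "\<And>c. c \<in> A \<Longrightarrow> smooth_on (snd c ` fst c) (\<lambda>u. f (chart_inv c u))"
  shows "smooth_map A euclid_atlas f"
proof (rule smooth_mapI)
  have "continuous_on (fst c) f" if c: "c \<in> A" for c
  proof -
    have "continuous_on (fst c) (\<lambda>y. f (chart_inv c (snd c y)))"
      by (rule continuous_on_compose2[OF smooth_on_imp_continuous_on[OF assms(2)[OF c]]
            homeomorphism_cont1[OF chart_homeo[OF assms(1) c]]]) simp
    then show ?thesis
      by (rule continuous_on_eq) (simp add: chart_inv_left[OF assms(1) c])
  qed
  then have "continuous_on (\<Union>c\<in>A. fst c) f"
    by (intro continuous_on_open_UN chart_open[OF assms(1)])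
  then show "continuous_on UNIV f" using assms(1) by (simp add: smooth_atlas_def)
qed (use assms(2) in \<open>auto simp: euclid_atlas_def\<close>)

lemma smooth_map_linear_comp:
  assumes "smooth_atlas A" "smooth_map A euclid_atlas f" "linear h"
  shows "smooth_map A euclid_atlas (\<lambda>x. h (f x))"
  by (rule smooth_map_euclidI[OF assms(1)],
      rule smooth_on_linear_comp[OF chart_open_image[OF assms(1)]
        linear_conv_bounded_linear[THEN iffD1, OF assms(3)] smooth_map_euclidD[OF assms(2)]])

section \<open>Lie groups\<close>

lemma group_right_inverse: "x * inverse x = (1::'a::group_mult)"
proof -
  have "x * inverse x = inverse (inverse x) * inverse x * x * inverse x"
    by (simp add: group_left_inverse)
  also have "\<dots> = inverse (inverse x) * (inverse x * x) * inverse x"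
    by (simp only: mult.assoc)
  finally show ?thesis by (simp add: group_left_inverse)
qed

lemma group_inverse_cancel:
  fixes x y :: "'a::group_mult"
  shows "inverse x * (x * y) = y" "x * (inverse x * y) = y"
  by (simp_all add: mult.assoc[symmetric] group_left_inverse group_right_inverse)

lemma group_inverse_unique:
  fixes x y :: "'a::group_mult"
  assumes "x * y = 1"
  shows "inverse x = y"
  using group_inverse_cancel(1)[of x y] assms by simp

lemma group_inverse_mult: "inverse (x * y) = inverse y * inverse (x::'a::group_mult)"
  by (rule group_inverse_unique)
    (simp add: mult.assoc group_inverse_cancel group_right_inverse)

lemma group_inverse_inverse: "inverse (inverse x) = (x::'a::group_mult)"
  by (rule group_inverse_unique) (rule group_left_inverse)

lemma group_inverse_one: "inverse 1 = (1::'a::group_mult)"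
  by (rule group_inverse_unique) simp

lemmas group_simps = group_left_inverse group_right_inverse group_inverse_cancel
  group_inverse_mult group_inverse_inverse group_inverse_one mult.assoc

lemma isCont_eventually_in:
  assumes "isCont f t" "open S" "f t \<in> S"
  shows "\<forall>\<^sub>F s in nhds t. f s \<in> S"
  using assms topological_tendstoD[of f "f t" "nhds t" S]
  by (simp add: isCont_def tendsto_at_iff_tendsto_nhds)

locale lie_chart =
  fixes A :: "('g::{group_mult, t2_space, second_countable_topology}, 'e::euclidean_space) chart
      set"
    and c :: "('g, 'e) chart"
  assumes lie_group: "lie_group A" and chart: "c \<in> A" and one_in_chart: "1 \<in> fst c"
begin

abbreviation e0 :: 'e where "e0 \<equiv> snd c 1"

lemma atlas: "smooth_atlas A"
  using lie_group by (simp add: lie_group_def)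

text \<open>The source is an arbitrary manifold, so that smoothness of any word in the group
  operations follows by resolution; \<open>smooth_AI\<close> and \<open>smooth_PI\<close> collect
  the rules for the group and for its square.\<close>

lemma smooth_map_mult:
  assumes "smooth_atlas M" "smooth_map M A f" "smooth_map M A g"
  shows "smooth_map M A (\<lambda>x. f x * g x)"
proof -
  have "smooth_map (prod_atlas A A) A (\<lambda>(x, y). x * y)"
    using lie_group by (simp add: lie_group_def)
  from smooth_map_compose[OF assms(1) smooth_atlas_prod[OF atlas atlas] atlas
      smooth_map_Pair[OF assms(1) atlas atlas assms(2,3)] this]
  show ?thesis by simp
qed

lemma smooth_map_inverse:
  assumes "smooth_atlas M" "smooth_map M A f"
  shows "smooth_map M A (\<lambda>x. inverse (f x))"
  using smooth_map_compose[OF assms(1) atlas atlas assms(2)] lie_group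
  by (simp add: lie_group_def)

lemma tendsto_group_mult:
  fixes f g :: "'b \<Rightarrow> 'g"
  assumes "(f \<longlongrightarrow> a) F" "(g \<longlongrightarrow> b) F"
  shows "((\<lambda>x. f x * g x) \<longlongrightarrow> a * b) F"
proof -
  have "continuous_on UNIV (\<lambda>(x, y). x * y :: 'g)"
    using lie_group by (simp add: lie_group_def smooth_map_def)
  then have "((\<lambda>(x, y). x * y) \<longlongrightarrow> a * b) (nhds (a, b))"
    by (simp add: continuous_on_eq_continuous_at isCont_def tendsto_at_iff_tendsto_nhds)
  from filterlim_compose[OF this tendsto_Pair[OF assms, THEN filterlim_mono]]
  show ?thesis by simp
qed

lemma tendsto_group_inverse:
  fixes f :: "'b \<Rightarrow> 'g"
  assumes "(f \<longlongrightarrow> a) F"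
  shows "((\<lambda>x. inverse (f x)) \<longlongrightarrow> inverse a) F"
proof -
  have "continuous_on UNIV (inverse :: 'g \<Rightarrow> 'g)"
    using lie_group by (simp add: lie_group_def smooth_map_def)
  then have "(inverse \<longlongrightarrow> inverse a) (nhds a)"
    by (simp add: continuous_on_eq_continuous_at isCont_def tendsto_at_iff_tendsto_nhds)
  from filterlim_compose[OF this assms] show ?thesis .
qed

lemma isCont_group_mult:
  "isCont f t \<Longrightarrow> isCont g t \<Longrightarrow> isCont (\<lambda>s. f s * g s :: 'g) t"
  unfolding isCont_def by (rule tendsto_group_mult)

lemma isCont_group_inverse: "isCont f t \<Longrightarrow> isCont (\<lambda>s. inverse (f s) :: 'g) t"
  unfolding isCont_def by (rule tendsto_group_inverse)

lemmas inv_left = chart_inv_left[OF atlas chart]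
lemmas inv_right = chart_inv_right[OF atlas chart]
lemmas smooth_AI = smooth_map_mult[OF atlas] smooth_map_inverse[OF atlas] smooth_map_ident[OF atlas]
  smooth_map_const[OF atlas]
lemmas prod_atl = smooth_atlas_prod[OF atlas atlas]
lemmas smooth_PI = smooth_map_mult[OF prod_atl] smooth_map_inverse[OF prod_atl]
  smooth_map_fst[OF atlas atlas] smooth_map_snd[OF atlas atlas] smooth_map_const[OF prod_atl]

lemma inv_e0 [simp]: "chart_inv c e0 = 1"
  by (rule inv_left[OF one_in_chart])

lemma e0_in: "e0 \<in> snd c ` fst c"
  using one_in_chart by simp

section \<open>Coordinate expressions near the identity and curves through it\<close>

lemma smooth_translate:
  assumes "d \<in> A" "x \<in> fst d" "smooth_map A A f" "f x \<in> fst c"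
  shows "(\<lambda>u. snd c (f (chart_inv d u))) differentiable (at (snd d x))"
proof (rule smooth_on_differentiable)
  show "open (snd d ` (fst d \<inter> f -` fst c))"
    by (rule smooth_map_open_dom[OF atlas atlas assms(1) chart smooth_mapD(1)[OF assms(3)]])
  show "smooth_on (snd d ` (fst d \<inter> f -` fst c)) (\<lambda>u. snd c (f (chart_inv d u)))"
    by (rule smooth_mapD(2)[OF assms(3,1) chart])
  show "snd d x \<in> snd d ` (fst d \<inter> f -` fst c)" using assms by auto
qed

text \<open>Joint smoothness in coordinates of a map of two group variables. Its partial derivatives
  in the second variable then depend smoothly on the first, which yields smoothness of
  left-invariant fields and of \<open>Ad\<close>.\<close>

lemma smooth_map_prod_charts:
  assumes "smooth_map (prod_atlas A A) A F" "d \<in> A" "d' \<in> A"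
  defines "S \<equiv> {w \<in> snd d ` fst d \<times> snd d' ` fst d'. F (chart_inv d (fst w), chart_inv d' (snd w))
      \<in> fst c}"
  shows "open S"
    and "smooth_on S (\<lambda>w. snd c (F (chart_inv d (fst w), chart_inv d' (snd w))))"
proof -
  define p where "p = (fst d \<times> fst d', \<lambda>(x, y). (snd d x, snd d' y))"
  have p: "p \<in> prod_atlas A A" using assms(2,3) unfolding p_def prod_atlas_def by blast
  have pi: "chart_inv p w = (chart_inv d (fst w), chart_inv d' (snd w))"
    if "w \<in> snd d ` fst d \<times> snd d' ` fst d'" for w
    unfolding p_def by (rule chart_inv_prod[OF atlas atlas assms(2,3) that])
  have S: "S = snd p ` (fst p \<inter> F -` fst c)"
    unfolding S_def p_def
    by (force simp: chart_inv_left[OF atlas assms(2)] chart_inv_left[OF atlas assms(3)])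
  show oS: "open S"
    unfolding S by (rule smooth_map_open_dom[OF prod_atl atlas p chart smooth_mapD(1)[OF assms(1)]])
  have "smooth_on S (\<lambda>w. snd c (F (chart_inv p w)))"
    unfolding S by (rule smooth_mapD(2)[OF assms(1) p chart])
  then show "smooth_on S (\<lambda>w. snd c (F (chart_inv d (fst w), chart_inv d' (snd w))))"
    by (rule smooth_on_transform[OF _ oS]) (auto simp: S_def pi)
qed

text \<open>Continuity in the group is a separate demand because the coordinate map is arbitrary off
  its domain: differentiability of \<open>snd c (p s)\<close> alone would not keep \<open>p\<close>
  near 1.\<close>

definition curve1 :: "(real \<Rightarrow> 'g) \<Rightarrow> real \<Rightarrow> 'e \<Rightarrow> bool" where
  "curve1 p t X \<longleftrightarrow> isCont p t \<and> p t = 1 \<and> ((\<lambda>s. snd c (p s)) has_vector_derivative X) (at t)"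

lemma curve1_eventually:
  assumes "curve1 p t X"
  shows "\<forall>\<^sub>F s in nhds t. p s \<in> fst c \<and> chart_inv c (snd c (p s)) = p s"
proof -
  have "\<forall>\<^sub>F s in nhds t. p s \<in> fst c"
    using assms one_in_chart by (intro isCont_eventually_in chart_open[OF atlas chart]) (auto
        simp: curve1_def)
  then show ?thesis by eventually_elim (simp add: inv_left)
qed

lemma curve1_deriv:
  assumes p: "curve1 p t X" and f: "((\<lambda>u. f (chart_inv c u)) has_derivative D) (at e0)"
  shows "((\<lambda>s. f (p s)) has_vector_derivative D X) (at t)"
proof -
  have "((\<lambda>s. snd c (p s)) has_vector_derivative X) (at t)" "p t = 1"
    using p by (auto simp: curve1_def)
  then have "((\<lambda>s. f (chart_inv c (snd c (p s)))) has_vector_derivative D X) (at t)"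
    using vector_derivative_diff_chain_within[of "\<lambda>s. snd c (p s)" X t UNIV
        "\<lambda>u. f (chart_inv c u)" D]
      f by (simp add: o_def has_derivative_at_withinI)
  then show ?thesis unfolding has_vector_derivative_def
  proof (rule has_derivative_transform_eventually)
    show "\<forall>\<^sub>F s in at t. f (chart_inv c (snd c (p s))) = f (p s)"
      using curve1_eventually[OF p] by (auto simp: eventually_nhds_conv_at elim: eventually_mono)
    show "f (chart_inv c (snd c (p t))) = f (p t)"
      using curve1_eventually[OF p] by (simp add: eventually_nhds_conv_at)
  qed simp
qed

lemma Ad_has_derivative: "((\<lambda>u. snd c (x * chart_inv c u * inverse x))
    has_derivative Ad c x) (at e0)"
proof -
  have "(\<lambda>u. snd c (x * chart_inv c u * inverse x)) differentiable (at e0)"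
    by (rule smooth_translate[OF chart one_in_chart, of "\<lambda>y. x * y * inverse x"])
      (intro smooth_AI, simp add: group_simps one_in_chart)
  moreover have "Ad c x = frechet_derivative (\<lambda>u. snd c (x * chart_inv c u * inverse x)) (at e0)"
    by (rule ext) (simp add: Ad_def)
  ultimately show ?thesis by (simp add: frechet_derivative_works)
qed

lemma linear_Ad: "linear (Ad c x)"
  using has_derivative_linear[OF Ad_has_derivative] .

lemma curve1_conj:
  assumes "curve1 p t X"
  shows "curve1 (\<lambda>s. x * p s * inverse x) t (Ad c x X)"
  using assms curve1_deriv[OF assms Ad_has_derivative[of x]] unfolding curve1_def
  by (auto simp: group_simps intro!: isCont_group_mult)

text \<open>The derivative of \<open>(u, v) \<mapsto> g u v\<^sup>-\<^sup>1 g\<^sup>-\<^sup>1\<close> at \<open>(1, 1)\<close> vanishes on the diagonal because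
    the map is
  constant there.\<close>

lemma curve1_quotient:
  assumes p: "curve1 p t X" and q: "curve1 q t X"
  shows "curve1 (\<lambda>s. g * p s * inverse (q s) * inverse g) t 0"
proof -
  define F where "F = (\<lambda>z. g * fst z * inverse (snd z) * inverse g)"
  have F: "smooth_map (prod_atlas A A) A F" unfolding F_def by (intro smooth_PI)
  define H where "H = (\<lambda>w. snd c (F (chart_inv c (fst w), chart_inv c (snd w))))"
  define S where "S = {w \<in> snd c ` fst c \<times> snd c ` fst c. F (chart_inv c (fst w), chart_inv c (snd
      w)) \<in> fst c}"
  have S: "open S" and sm: "smooth_on S H"
    using smooth_map_prod_charts[OF F chart chart] unfolding S_def H_def by auto
  have oS: "(e0, e0) \<in> S" using one_in_chart by (simp add: S_def F_def group_simps)
  obtain D where D: "(H has_derivative D) (at (e0, e0))"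
    using smooth_on_has_derivative[OF S sm oS] by blast
  have "((\<lambda>u. H (u, u)) has_derivative (\<lambda>v. D (v, v))) (at e0)"
    using diff_chain_at[of "\<lambda>u. (u, u)" "\<lambda>v. (v, v)" e0 H D] D
    by (simp add: o_def has_derivative_Pair)
  moreover have "(\<lambda>u. H (u, u)) = (\<lambda>u. e0)" by (simp add: H_def F_def group_simps)
  ultimately have "(\<lambda>v. D (v, v)) = (\<lambda>v. 0)"
    using has_derivative_unique has_derivative_const by metis
  then have D0: "D (X, X) = 0" by meson
  have "((\<lambda>s. (snd c (p s), snd c (q s))) has_vector_derivative (X, X)) (at t)"
    using p q unfolding curve1_def by (intro has_vector_derivative_Pair) auto
  then have "((\<lambda>s. H (snd c (p s), snd c (q s))) has_vector_derivative D (X, X)) (at t)"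
    using vector_derivative_diff_chain_within[of "\<lambda>s. (snd c (p s), snd c (q s))" "(X, X)" t UNIV
        H D]
      D p q by (simp add: o_def has_derivative_at_withinI curve1_def)
  then have "((\<lambda>s. snd c (F (p s, q s))) has_vector_derivative 0) (at t)"
    unfolding has_vector_derivative_def D0
  proof (rule has_derivative_transform_eventually)
    have ev: "\<forall>\<^sub>F s in nhds t. H (snd c (p s), snd c (q s)) = snd c (F (p s, q s))"
      using curve1_eventually[OF p] curve1_eventually[OF q]
      by eventually_elim (simp add: H_def)
    show "\<forall>\<^sub>F s in at t. H (snd c (p s), snd c (q s)) = snd c (F (p s, q s))"
      "H (snd c (p t), snd c (q t)) = snd c (F (p t, q t))"
      using ev by (simp_all add: eventually_nhds_conv_at)
  qed simp
  then show ?thesis using p q unfolding curve1_def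
    by (auto simp: F_def group_simps intro!: isCont_group_mult isCont_group_inverse)
qed

text \<open>The hypothesis says that the left logarithmic derivative of \<open>h\<close> vanishes.
  In the chart translated to \<open>h a\<close> this is an ordinary zero derivative, so
  \<open>h\<close> is locally constant, and connectedness of \<open>S\<close> does the rest.\<close>

lemma curve_constant:
  fixes S :: "real set"
  assumes S: "open S" "connected S" and h: "\<And>t. t \<in> S \<Longrightarrow> curve1 (\<lambda>s. inverse (h t) * h s) t 0"
    and "a \<in> S" "b \<in> S"
  shows "h a = h b"
proof (rule connected_local_const[OF S(2) \<open>a \<in> S\<close> \<open>b \<in> S\<close>], intro ballI)
  have cont: "isCont h t" if "t \<in> S" for t
  proof -
    have "isCont (\<lambda>s. h t * (inverse (h t) * h s)) t"
      by (rule isCont_group_mult) (use h[OF that] in \<open>simp_all add: curve1_def\<close>)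
    then show ?thesis by (simp add: group_simps)
  qed
  fix a assume a: "a \<in> S"
  have "isCont (\<lambda>s. inverse (h a) * h s) a"
    using h[OF a] by (simp add: curve1_def)
  then have "\<forall>\<^sub>F s in nhds a. inverse (h a) * h s \<in> fst c"
    using one_in_chart by (intro isCont_eventually_in chart_open[OF atlas chart]) (auto simp:
        group_simps)
  moreover have "\<forall>\<^sub>F s in nhds a. s \<in> S" using S(1) a by (rule eventually_nhds_in_open)
  ultimately have "\<forall>\<^sub>F s in nhds a. inverse (h a) * h s \<in> fst c \<and> s \<in> S"
    by eventually_elim simp
  then obtain e where e: "e > 0" "\<And>s. dist s a < e \<Longrightarrow> inverse (h a) * h s \<in> fst c \<and> s \<in> S"
    unfolding eventually_nhds_metric by blast
  have eq: "h a = h b" if b: "b \<in> ball a e" for b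
  proof -
    have "((\<lambda>s. snd c (inverse (h a) * h s)) has_vector_derivative 0) (at t within ball a e)"
      if t: "t \<in> ball a e" for t
    proof -
      \<comment> \<open>Left translation by \<open>?g\<close> turns the increment based at
        \<open>h t\<close> into the one based at \<open>h a\<close>; its differential maps the
        velocity 0 to 0.\<close>
      let ?g = "inverse (h a) * h t"
      have tS: "t \<in> S" "?g \<in> fst c" using e(2)[of t] t by (auto simp: dist_commute)
      have "(\<lambda>u. snd c (?g * chart_inv c u)) differentiable (at e0)"
        by (rule smooth_translate[OF chart one_in_chart, of "\<lambda>y. ?g * y"])
          (intro smooth_AI, simp add: tS)
      then obtain D where D: "((\<lambda>u. snd c (?g * chart_inv c u)) has_derivative D) (at e0)"
        by (auto simp: differentiable_def)
      have "((\<lambda>s. snd c (?g * (inverse (h t) * h s))) has_vector_derivative D 0) (at t)"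
        using curve1_deriv[where f = "\<lambda>y. snd c (?g * y)", OF h[OF tS(1)] D] .
      moreover have "D 0 = 0" using linear_0[OF has_derivative_linear[OF D]] .
      ultimately show ?thesis
        by (simp add: group_simps has_vector_derivative_at_within)
    qed
    then obtain k where k: "\<And>s. s \<in> ball a e \<Longrightarrow> snd c (inverse (h a) * h s) = k"
      using has_vector_derivative_zero_constant[OF convex_ball] by metis
    have "snd c (inverse (h a) * h b) = snd c (inverse (h a) * h a)"
      using k[OF b] k[of a] e(1) by simp
    then have "inverse (h a) * h b = inverse (h a) * h a"
      using inv_left e(2)[of b] e(2)[of a] e(1) b by (metis dist_commute dist_self mem_ball)
    then show ?thesis by (metis group_inverse_cancel(2))
  qed
  then show "\<forall>\<^sub>F b in at a within S. h a = h b"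
    unfolding eventually_at using e(1) by (auto simp: dist_commute)
qed

text \<open>Two curves with the same left logarithmic derivative differ by a constant left factor:
  the increment of \<open>p * inverse q\<close> is the quotient of the two increments, conjugated by
  \<open>q t\<close>, and \<open>curve1_quotient\<close> gives it velocity 0.\<close>

lemma curve_unique:
  fixes S :: "real set"
  assumes "open S" "connected S"
    and p: "\<And>t. t \<in> S \<Longrightarrow> curve1 (\<lambda>s. inverse (p t) * p s) t X"
    and q: "\<And>t. t \<in> S \<Longrightarrow> curve1 (\<lambda>s. inverse (q t) * q s) t X"
    and "a \<in> S" "b \<in> S" "p a = q a"
  shows "p b = q b"
proof -
  have "p a * inverse (q a) = p b * inverse (q b)"
  proof (rule curve_constant[of S "\<lambda>t. p t * inverse (q t)", OF assms(1,2) _ assms(5,6)])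
    fix t assume "t \<in> S"
    from curve1_quotient[OF p[OF this] q[OF this], of "q t"]
    show "curve1 (\<lambda>s. inverse (p t * inverse (q t)) * (p s * inverse (q s))) t 0"
      by (simp add: group_simps)
  qed
  then have "p b * inverse (q b) = 1" using assms(7) by (simp add: group_simps)
  then show ?thesis by (metis group_inverse_inverse group_inverse_unique)
qed

end

section \<open>Local solutions of autonomous differential equations\<close>

text \<open>Directional derivatives along \<open>Basis\<close> are bounded on a compact ball, the
  sum of these bounds dominates the operator norm, and the mean value inequality on the convex ball
  concludes.\<close>

lemma smooth_on_locally_Lipschitz:
  fixes F :: "'a::euclidean_space \<Rightarrow> 'b::euclidean_space"
  assumes "open S" "smooth_on S F" "x0 \<in> S"
  obtains r L where "r > 0" "cball x0 r \<subseteq> S"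
    "\<And>x y. x \<in> cball x0 r \<Longrightarrow> y \<in> cball x0 r \<Longrightarrow> norm (F x - F y) \<le> L * norm (x - y)"
proof -
  obtain r where r: "r > 0" "cball x0 r \<subseteq> S" using assms open_contains_cball by blast
  have "\<exists>M. \<forall>x\<in>cball x0 r. norm (frechet_derivative F (at x) b) \<le> M" for b
  proof -
    have "continuous_on (cball x0 r) (\<lambda>x. frechet_derivative F (at x) b)"
      using smooth_on_imp_continuous_on[OF smooth_on_derivative[OF assms(2)]] r(2)
        continuous_on_subset by blast
    then have "bounded ((\<lambda>x. frechet_derivative F (at x) b) ` cball x0 r)"
      by (intro compact_imp_bounded compact_continuous_image) auto
    then show ?thesis unfolding bounded_iff by auto
  qed
  then obtain M where M: "\<And>b x. x \<in> cball x0 r \<Longrightarrow> norm (frechet_derivative F (at x) b) \<le> M b"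
    by metis
  have "norm (F x - F y) \<le> (\<Sum>b\<in>Basis. M b) * norm (x - y)"
    if "x \<in> cball x0 r" "y \<in> cball x0 r" for x y
  proof (rule differentiable_bound[OF convex_cball _ _ that])
    fix z assume z: "z \<in> cball x0 r"
    have D: "(F has_derivative frechet_derivative F (at z)) (at z)"
      using smooth_on_has_derivative[OF assms(1,2)] z r(2) by blast
    then show "(F has_derivative frechet_derivative F (at z)) (at z within cball x0 r)"
      by (rule has_derivative_at_withinI)
    show "onorm (frechet_derivative F (at z)) \<le> (\<Sum>b\<in>Basis. M b)"
    proof (rule onorm_le)
      fix v
      have "norm (frechet_derivative F (at z) v) =
          norm (\<Sum>b\<in>Basis. (v \<bullet> b) *\<^sub>R frechet_derivative F (at z) b)"
        using linear_expand_Basis[OF has_derivative_linear[OF D], of v] by simp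
      also have "\<dots> \<le> (\<Sum>b\<in>Basis. norm ((v \<bullet> b) *\<^sub>R frechet_derivative F (at z) b))"
        by (rule norm_sum)
      also have "\<dots> \<le> (\<Sum>b\<in>Basis. M b * norm v)"
      proof (rule sum_mono)
        fix b :: 'a assume "b \<in> Basis"
        then have "\<bar>v \<bullet> b\<bar> * norm (frechet_derivative F (at z) b) \<le> norm v * M b"
          by (intro mult_mono M[OF z] Basis_le_norm) auto
        then show "norm ((v \<bullet> b) *\<^sub>R frechet_derivative F (at z) b) \<le> M b * norm v"
          by (simp add: mult.commute)
      qed
      finally show "norm (frechet_derivative F (at z) v) \<le> (\<Sum>b\<in>Basis. M b) * norm v"
        by (simp add: sum_distrib_right)
    qed
  qed
  with that r show ?thesis by blast
qed

lemma primitive_bound: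
  fixes G :: "real \<Rightarrow> 'a::euclidean_space"
  assumes G: "\<And>t. t \<in> {-d..d} \<Longrightarrow> (G has_vector_derivative g t) (at t within {-d..d})"
    and B: "\<And>t. norm (g t) \<le> B" and "G 0 = 0" "d \<ge> 0" "t \<in> {-d..d}"
  shows "norm (G t) \<le> B * d"
proof -
  have "norm (G t - G 0) \<le> B * norm (t - 0)"
  proof (rule differentiable_bound[of "{-d..d}" G "\<lambda>t x. x *\<^sub>R g t"])
    fix s assume "s \<in> {-d..d}"
    then show "(G has_derivative (\<lambda>x. x *\<^sub>R g s)) (at s within {-d..d})"
      using G by (simp add: has_vector_derivative_def)
    show "onorm (\<lambda>x. x *\<^sub>R g s) \<le> B"
    proof (rule onorm_le)
      show "norm (x *\<^sub>R g s) \<le> B * norm x" for x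
        using mult_left_mono[OF B[of s], of "\<bar>x\<bar>"] by (simp add: mult.commute)
    qed
  qed (use assms in auto)
  also have "\<dots> \<le> B * d"
    using assms(5) order_trans[OF norm_ge_zero B[of 0]] by (intro mult_left_mono) auto
  finally show ?thesis using assms(3) by simp
qed

text \<open>Picard iteration: the integral equation is a contraction on the bounded continuous
  curves with values in the closed ball.\<close>

lemma autonomous_ode_local_solution:
  fixes F :: "'a::euclidean_space \<Rightarrow> 'a"
  assumes "r > 0"
    and L: "\<And>x y. x \<in> cball x0 r \<Longrightarrow> y \<in> cball x0 r \<Longrightarrow> norm (F x - F y) \<le> L * norm (x - y)"
  obtains d u where "d > 0" "u 0 = x0"
    "\<And>t. t \<in> {-d<..<d} \<Longrightarrow> u t \<in> cball x0 r"
    "\<And>t. t \<in> {-d<..<d} \<Longrightarrow> (u has_vector_derivative F (u t)) (at t)"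
proof -
  \<comment> \<open>A Lipschitz constant that is at least 1, so that it can be divided by.\<close>
  define L' where "L' = max L 1"
  have L': "norm (F x - F y) \<le> L' * norm (x - y)" if "x \<in> cball x0 r" "y \<in> cball x0 r" for x y
    by (rule order_trans[OF L[OF that]]) (simp add: L'_def mult_right_mono)
  have L'1: "L' \<ge> 1" by (simp add: L'_def)
  define M where "M = norm (F x0) + L' * r"
  have M: "norm (F x) \<le> M" if "x \<in> cball x0 r" for x
  proof -
    have "norm (F x - F x0) \<le> L' * norm (x - x0)" using L'[OF that, of x0] \<open>r > 0\<close> by simp
    also have "\<dots> \<le> L' * r" using that L'1 by (intro mult_left_mono) (auto simp: dist_norm
        norm_minus_commute)
    finally show ?thesis using norm_triangle_sub[of "F x" "F x0"] by (simp add: M_def)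
  qed
  have M0: "M > 0" using \<open>r > 0\<close> L'1 norm_ge_zero[of "F x0"] unfolding M_def
    by (intro add_nonneg_pos mult_pos_pos) auto
  \<comment> \<open>The bound \<open>r / M\<close> keeps the iterates in the ball; the bound
    \<open>1 / (2 * L')\<close> gives contraction factor one half.\<close>
  define d where "d = min (r / M) (1 / (2 * L'))"
  have d: "d > 0" "M * d \<le> r" "L' * d \<le> 1 / 2"
  proof -
    show "d > 0" using M0 L'1 \<open>r > 0\<close> by (simp add: d_def)
    have "d \<le> r / M" "d \<le> 1 / (2 * L')" by (auto simp: d_def)
    then show "M * d \<le> r" "L' * d \<le> 1 / 2" using M0 L'1 by (auto simp: field_simps)
  qed
  \<comment> \<open>Bounded continuous functions live on the whole line, so time is clamped to the
    interval on which the equation is solved.\<close>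
  define cl where "cl = (\<lambda>t. max (-d) (min d t))"
  have cl: "cl t \<in> {-d..d}" for t using d(1) by (auto simp: cl_def)
  have cl_id: "cl t = t" if "t \<in> {-d..d}" for t using that by (auto simp: cl_def)
  \<comment> \<open>The primitive of \<open>g\<close> vanishing at 0. It starts from
    \<open>-d\<close> because the integral over \<open>{0..t}\<close> is 0 for negative
    \<open>t\<close>.\<close>
  define G where "G = (\<lambda>g t. integral {-d..t} g - integral {-d..0} g :: 'a)"
  have G: "(G g has_vector_derivative g t) (at t within {-d..d})"
    if "continuous_on UNIV g" "t \<in> {-d..d}" for g t
  proof -
    have "((\<lambda>t. integral {-d..t} g - integral {-d..0} g) has_vector_derivative g t
        - 0) (at t within {-d..d})"
      by (intro has_vector_derivative_diff integral_has_vector_derivative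
          has_vector_derivative_const that
          continuous_on_subset[OF that(1)]) auto
    then show ?thesis by (simp add: G_def)
  qed
  have G0: "G g 0 = 0" for g by (simp add: G_def)
  have G_cont: "continuous_on UNIV (\<lambda>t. G g (cl t))" if "continuous_on UNIV g" for g
  proof (rule continuous_on_compose2[of "{-d..d}" "G g"])
    show "continuous_on {-d..d} (G g)"
      using G[OF that] has_vector_derivative_continuous by (force simp:
          continuous_on_eq_continuous_within)
    show "continuous_on UNIV cl" unfolding cl_def by (intro continuous_intros)
  qed (use cl in auto)
  have F_cont: "continuous_on (cball x0 r) F"
  proof (rule continuous_on_iff[THEN iffD2], intro ballI allI impI)
    fix x e assume x: "x \<in> cball x0 r" and "0 < (e::real)"
    have "dist (F y) (F x) < e" if "y \<in> cball x0 r" "dist y x < e / L'" for y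
      using L'[OF that(1) x] that(2) L'1 by (simp add: dist_norm field_simps)
    then show "\<exists>d>0. \<forall>y\<in>cball x0 r. dist y x < d \<longrightarrow> dist (F y) (F x) < e"
      using \<open>0 < e\<close> L'1 by (intro exI[of _ "e / L'"]) auto
  qed
  define S where "S = PiC UNIV (\<lambda>_::real. cball x0 r)"
  have S: "u \<in> S \<longleftrightarrow> (\<forall>t. apply_bcontfun u t \<in> cball x0 r)" for u by (auto simp: S_def mem_PiC_iff)
  have Fu: "continuous_on UNIV (\<lambda>t. F (apply_bcontfun u t))" if "u \<in> S" for u
    by (rule continuous_on_compose2[OF F_cont]) (use that in \<open>auto simp: S image_subset_iff simp
        del: mem_cball\<close>)
  define T where "T = (\<lambda>u. Bcontfun (\<lambda>t. x0 + G (\<lambda>s. F (apply_bcontfun u s)) (cl t)))"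
  have Gb: "norm (G (\<lambda>s. F (apply_bcontfun u s)) (cl t)) \<le> r" if "u \<in> S" for u t
    using primitive_bound[of d "G (\<lambda>s. F (apply_bcontfun u s))", OF G[OF Fu[OF that]] _ G0 _ cl]
      M d that by (meson S less_imp_le order_trans)
  have T: "apply_bcontfun (T u) t = x0 + G (\<lambda>s. F (apply_bcontfun u s)) (cl t)" if "u \<in> S" for u t
  proof -
    have "(\<lambda>t. x0 + G (\<lambda>s. F (apply_bcontfun u s)) (cl t)) \<in> bcontfun"
    proof (rule bcontfun_normI)
      show "continuous_on UNIV (\<lambda>t. x0 + G (\<lambda>s. F (apply_bcontfun u s)) (cl t))"
        by (intro continuous_intros G_cont Fu that)
      show "norm (x0 + G (\<lambda>s. F (apply_bcontfun u s)) (cl t)) \<le> norm x0 + r" for t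
        using norm_triangle_ineq Gb[OF that] by (meson add_left_mono order_trans)
    qed
    then show ?thesis by (simp add: T_def Bcontfun_inverse)
  qed
  have "\<exists>!u. u \<in> S \<and> T u = u"
  proof (rule Banach_fix)
    show "complete S" unfolding S_def by (intro closed_PiC complete_eq_closed[THEN iffD2]) auto
    have "const_bcontfun x0 \<in> S" using \<open>r > 0\<close> by (simp add: S const_bcontfun.rep_eq)
    then show "S \<noteq> {}" by blast
    show "T ` S \<subseteq> S"
      using Gb by (auto simp: S[of "T _"] T dist_norm)
    show "dist (T u) (T v) \<le> 1 / 2 * dist u v" if "u \<in> S" "v \<in> S" for u v
    proof (rule dist_bound)
      fix t
      let ?g = "\<lambda>s. F (apply_bcontfun u s) - F (apply_bcontfun v s)"
      have "norm (G (\<lambda>s. F (apply_bcontfun u s)) (cl t) - G (\<lambda>s. F (apply_bcontfun v s)) (cl t))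
          \<le> (L' * dist u v) * d"
      proof (rule primitive_bound[of d "\<lambda>t. G (\<lambda>s. F (apply_bcontfun u s)) t
          - G (\<lambda>s. F (apply_bcontfun v s)) t" ?g])
        show "norm (?g s) \<le> L' * dist u v" for s
        proof -
          have "norm (?g s) \<le> L' * dist (apply_bcontfun u s) (apply_bcontfun v s)"
            using L' that by (simp add: S dist_norm)
          also have "\<dots> \<le> L' * dist u v" using L'1 by (intro mult_left_mono dist_bounded) auto
          finally show ?thesis .
        qed
      qed (use d cl G0 that in \<open>auto intro!: has_vector_derivative_diff G Fu\<close>)
      also have "\<dots> = (L' * d) * dist u v" by simp
      also have "\<dots> \<le> 1 / 2 * dist u v" using d(3) by (intro mult_right_mono) auto
      finally show "dist (apply_bcontfun (T u) t) (apply_bcontfun (T v) t) \<le> 1 / 2 * dist u v"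
        using that by (simp add: T dist_norm)
    qed
  qed auto
  then obtain u where u: "u \<in> S" "T u = u" by blast
  have ut: "apply_bcontfun u t = x0 + G (\<lambda>s. F (apply_bcontfun u s)) (cl t)" for t
    using T[OF u(1), of t] unfolding u(2) .
  show ?thesis
  proof
    show "d > 0" by (rule d)
    show "apply_bcontfun u 0 = x0" by (subst ut) (use cl_id[of 0] d(1) in \<open>simp add: G0\<close>)
    fix t assume t: "t \<in> {-d<..<d}"
    show "apply_bcontfun u t \<in> cball x0 r" using u(1) S by blast
    have "((\<lambda>t. x0 + G (\<lambda>s. F (apply_bcontfun u s)) t) has_vector_derivative 0
        + F (apply_bcontfun u t))
        (at t within {-d..d})"
      using t by (intro has_vector_derivative_add has_vector_derivative_const G Fu u) auto
    then have "((\<lambda>t. x0 + G (\<lambda>s. F (apply_bcontfun u s)) t)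
        has_vector_derivative F (apply_bcontfun u t))
        (at t)"
      using t at_within_interior[of t "{-d..d}"] by (simp add: interior_atLeastAtMost_real)
    then show "(apply_bcontfun u has_vector_derivative F (apply_bcontfun u t)) (at t)"
    proof (rule has_vector_derivative_transform_within_open[of _ _ _ "{-d<..<d}"])
      show "x0 + G (\<lambda>s. F (apply_bcontfun u s)) s = apply_bcontfun u s" if "s \<in> {-d<..<d}" for s
        by (subst (2) ut) (use cl_id[of s] that in simp)
    qed (use t in auto)
  qed
qed

section \<open>One-parameter subgroups\<close>

lemma group_power_commuting:
  fixes a b :: "'a::monoid_mult"
  assumes "a * b = b * a"
  shows "(a * b) ^ n = a ^ n * b ^ n"
proof (induction n)
  case (Suc n)
  have "b * a ^ n = a ^ n * b" using power_commuting_commutes[OF assms] by simp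
  then have "a * b * (a ^ n * b ^ n) = a * a ^ n * (b * b ^ n)"
    by (metis mult.assoc)
  with Suc show ?case by simp
qed simp

context lie_chart
begin

lemma curve1_shift:
  assumes "curve1 p (a + t) X"
  shows "curve1 (\<lambda>s. p (a + s)) t X"
proof -
  have "isCont (\<lambda>s. p (a + s)) t"
    by (rule isCont_o2[where f = "\<lambda>s. a + s" and g = p]) (use assms in \<open>auto simp: curve1_def\<close>)
  moreover have "((\<lambda>s. a + s) has_vector_derivative 1) (at t)"
    by (auto intro!: derivative_eq_intros)
  then have "((\<lambda>s. snd c (p (a + s))) has_vector_derivative X) (at t)"
    using assms vector_diff_chain_at[of "\<lambda>s. a + s" 1 t "\<lambda>s. snd c (p s)" X] by (simp add:
        curve1_def o_def)
  ultimately show ?thesis using assms by (simp add: curve1_def)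
qed

text \<open>In coordinates the left-invariant field of \<open>X\<close> is the partial derivative of
  the multiplication in its second variable at 1, in the fixed direction
  \<open>(0, X)\<close>.\<close>

lemma smooth_on_left_invariant_field:
  "smooth_on (snd c ` fst c) (\<lambda>u. frechet_derivative (\<lambda>v. snd c (chart_inv c u * chart_inv c v))
      (at e0) X)"
proof -
  define H where "H = (\<lambda>w. snd c (chart_inv c (fst w) * chart_inv c (snd w)))"
  define S where "S = {w \<in> snd c ` fst c \<times> snd c ` fst c. chart_inv c (fst w) * chart_inv c (snd
      w) \<in> fst c}"
  have "smooth_map (prod_atlas A A) A (\<lambda>z. fst z * snd z)" by (intro smooth_PI)
  from smooth_map_prod_charts[OF this chart chart]
  have S: "open S" and sm: "smooth_on S H" unfolding S_def H_def by auto
  have uS: "(u, e0) \<in> S" if "u \<in> snd c ` fst c" for u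
    using that e0_in inv_right(1)[OF that] by (simp add: S_def)
  have eq: "frechet_derivative (\<lambda>v. snd c (chart_inv c u * chart_inv c v)) (at e0) X =
      frechet_derivative H (at (u, e0)) (0, X)" if "u \<in> snd c ` fst c" for u
  proof -
    have "((\<lambda>v. H (u, v)) has_derivative (\<lambda>v. frechet_derivative H (at (u, e0)) (0, v))) (at e0)"
      using diff_chain_at[of "\<lambda>v. (u, v)" "\<lambda>v. (0, v)" e0 H] smooth_on_has_derivative[OF S sm
          uS[OF that]]
      by (simp add: o_def has_derivative_Pair)
    from frechet_derivative_at[OF this] show ?thesis by (metis (no_types, lifting) H_def fst_conv
        snd_conv ext)
  qed
  have O: "open (snd c ` fst c)" by (rule chart_open_image[OF atlas chart])
  have "smooth_on (snd c ` fst c) (\<lambda>u. frechet_derivative H (at (u, e0)) (0, X))"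
    by (rule smooth_on_compose[where f = "\<lambda>u. (u, e0)" and g =
        "\<lambda>w. frechet_derivative H (at w) (0, X)" and T = S])
      (use O S uS in \<open>auto intro!: smooth_on_Pair smooth_on_derivative sm\<close>)
  then show ?thesis by (rule smooth_on_transform[OF _ O]) (simp add: eq)
qed

lemma local_integral_curve:
  obtains d g where "d > 0" "g 0 = 1" "\<And>t. \<bar>t\<bar> < d \<Longrightarrow> curve1 (\<lambda>s. inverse (g t) * g s) t X"
    "\<And>t. \<bar>t\<bar> < d \<Longrightarrow> g t \<in> fst c" "smooth_on {-d<..<d} (\<lambda>t. snd c (g t))"
proof -
  define F where "F = (\<lambda>u. frechet_derivative (\<lambda>v. snd c (chart_inv c u * chart_inv c v)) (at e0)
      X)"
  have O: "open (snd c ` fst c)" by (rule chart_open_image[OF atlas chart])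
  have F: "smooth_on (snd c ` fst c) F" unfolding F_def by (rule smooth_on_left_invariant_field)
  obtain r L where r: "r > 0" "cball e0 r \<subseteq> snd c ` fst c"
    "\<And>x y. x \<in> cball e0 r \<Longrightarrow> y \<in> cball e0 r \<Longrightarrow> norm (F x - F y) \<le> L * norm (x - y)"
    by (rule smooth_on_locally_Lipschitz[OF O F e0_in]) blast
  obtain d u where d: "d > 0" and u: "u 0 = e0" "\<And>t. t \<in> {-d<..<d} \<Longrightarrow> u t \<in> cball e0 r"
    "\<And>t. t \<in> {-d<..<d} \<Longrightarrow> (u has_vector_derivative F (u t)) (at t)"
    by (rule autonomous_ode_local_solution[of r e0 F L, OF r(1)], rule r(3); assumption?) (rule
        that; assumption)
  have uU: "u t \<in> snd c ` fst c" if "t \<in> {-d<..<d}" for t using u(2)[OF that] r(2) by blast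
  define g where "g = (\<lambda>t. chart_inv c (u t))"
  have gU: "g t \<in> fst c" "snd c (g t) = u t" if "t \<in> {-d<..<d}" for t
    using inv_right[OF uU[OF that]] by (auto simp: g_def)
  have "curve1 (\<lambda>s. inverse (g t) * g s) t X" if t: "t \<in> {-d<..<d}" for t
  proof -
    have ucont: "isCont u t" using u(3)[OF t] has_vector_derivative_continuous by blast
    have "isCont (chart_inv c) (u t)"
      using chart_homeo[OF atlas chart] O uU[OF t] continuous_on_eq_continuous_at
      by (auto simp: homeomorphism_def)
    with ucont have gcont: "isCont g t" unfolding g_def by (rule isCont_o2)
    have "(\<lambda>v. snd c (inverse (g t) * chart_inv c v)) differentiable (at (snd c (g t)))"
      by (rule smooth_translate[OF chart gU(1)[OF t], of "\<lambda>y. inverse (g t) * y"])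
        (intro smooth_AI, simp add: group_simps one_in_chart)
    then obtain D where D: "((\<lambda>v. snd c (inverse (g t) * chart_inv c v))
        has_derivative D) (at (u t))"
      using gU(2)[OF t] by (auto simp: differentiable_def)
    \<comment> \<open>\<open>E\<close> and \<open>D\<close> are the differentials of left
      translation by \<open>g t\<close> and by its inverse, so \<open>D (E x) = x\<close>. Since
      \<open>F (u t)\<close> is \<open>E X\<close>, the velocity of the translated curve is
      \<open>X\<close>.\<close>
    define E where "E = frechet_derivative (\<lambda>v. snd c (g t * chart_inv c v)) (at e0)"
    have "(\<lambda>v. snd c (g t * chart_inv c v)) differentiable (at e0)"
      by (rule smooth_translate[OF chart one_in_chart, of "\<lambda>y. g t * y"])
        (intro smooth_AI, simp add: gU(1)[OF t])
    then have E: "((\<lambda>v. snd c (g t * chart_inv c v)) has_derivative E) (at e0)"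
      unfolding E_def by (simp add: frechet_derivative_works)
    have "((\<lambda>v. snd c (inverse (g t) * chart_inv c (snd c (g t * chart_inv c v))))
        has_derivative (\<lambda>x. D (E x))) (at e0)"
      using diff_chain_at[OF E, of "\<lambda>v. snd c (inverse (g t) * chart_inv c v)" D] D gU(2)[OF t]
          by (simp add: o_def)
    moreover have "open (snd c ` (fst c \<inter> (\<lambda>y. g t * y) -` fst c))"
    proof (rule smooth_map_open_dom[OF atlas atlas chart chart smooth_mapD(1)])
      show "smooth_map A A (\<lambda>y. g t * y)" by (intro smooth_AI)
    qed
    ultimately have "((\<lambda>v. v) has_derivative (\<lambda>x. D (E x))) (at e0)"
    proof (rule has_derivative_transform_within_open)
      show "e0 \<in> snd c ` (fst c \<inter> (\<lambda>y. g t * y) -` fst c)"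
        using one_in_chart gU(1)[OF t] by simp
    qed (auto simp: inv_left group_simps)
    then have "(\<lambda>x. D (E x)) = (\<lambda>x. x)" using has_derivative_unique has_derivative_ident by blast
    then have DE: "D (F (u t)) = X" by (metis E_def F_def g_def)
    have "((\<lambda>s. snd c (inverse (g t) * chart_inv c (u s)))
        has_vector_derivative D (F (u t))) (at t)"
      using vector_derivative_diff_chain_within[of u "F (u t)" t UNIV
          "\<lambda>v. snd c (inverse (g t) * chart_inv c v)" D]
        u(3)[OF t] D by (simp add: o_def has_derivative_at_withinI)
    then have "((\<lambda>s. snd c (inverse (g t) * g s)) has_vector_derivative X) (at t)"
      unfolding DE by (simp add: g_def)
    then show ?thesis using gcont unfolding curve1_def
      by (auto simp: group_simps intro: isCont_group_mult)
  qed
  moreover have "smooth_on {-d<..<d} (\<lambda>t. snd c (g t))"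
  proof -
    \<comment> \<open>Bootstrapping: the derivative of \<open>u\<close> is \<open>F (u t)\<close>,
      so order \<open>k\<close> for \<open>u\<close> gives order \<open>k\<close> for its
      derivative.\<close>
    have "Ck_on k {-d<..<d} u" for k
    proof (induction k)
      case 0
      have "isCont u t" if "t \<in> {-d<..<d}" for t
        using u(3)[OF that] has_vector_derivative_continuous by blast
      then show ?case by (simp add: continuous_at_imp_continuous_on)
    next
      case (Suc k)
      show ?case
      proof (rule Ck_on_SucI)
        show "(u has_derivative (\<lambda>x. x *\<^sub>R F (u t))) (at t)" if "t \<in> {-d<..<d}" for t
          using u(3)[OF that] by (simp add: has_vector_derivative_def)
        have "Ck_on k {-d<..<d} (\<lambda>t. F (u t))"
          by (rule Ck_on_compose[where f = u and g = F, OF _ O _ Suc])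
            (use F uU in \<open>auto simp: smooth_on_def\<close>)
        then show "Ck_on k {-d<..<d} (\<lambda>t. x *\<^sub>R F (u t))" for x
          by (rule Ck_on_linear_comp[OF _ bounded_linear_scaleR_right, rotated]) simp
      qed simp
    qed
    then have "smooth_on {-d<..<d} u" by (simp add: smooth_on_def)
    then show ?thesis by (rule smooth_on_transform) (auto simp: gU)
  qed
  moreover have "g 0 = 1" by (simp add: g_def u(1))
  ultimately show ?thesis using that[of d g] d gU(1) by (simp add: abs_less_iff)
qed

text \<open>As functions of \<open>t\<close>, both sides of the group law have left logarithmic
  derivative \<open>X\<close> and the same value at 0, so they coincide.\<close>

lemma local_one_parameter_group:
  obtains d g where "d > 0" "g 0 = 1" "curve1 g 0 X"
    "\<And>s t. \<bar>s\<bar> < d \<Longrightarrow> \<bar>t\<bar> < d \<Longrightarrow> \<bar>s + t\<bar> < d \<Longrightarrow> g (s + t) = g s * g t"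
    "\<And>t. \<bar>t\<bar> < d \<Longrightarrow> g t \<in> fst c" "smooth_on {-d<..<d} (\<lambda>t. snd c (g t))"
proof -
  obtain d g where d: "d > 0" and g: "g 0 = 1" "\<And>t. \<bar>t\<bar> < d \<Longrightarrow> curve1 (\<lambda>s. inverse (g t) * g s) t X"
    "\<And>t. \<bar>t\<bar> < d \<Longrightarrow> g t \<in> fst c" "smooth_on {-d<..<d} (\<lambda>t. snd c (g t))"
    by (rule local_integral_curve) (rule that; assumption)
  have "g (s + t) = g s * g t" if "\<bar>s\<bar> < d" "\<bar>t\<bar> < d" "\<bar>s + t\<bar> < d" for s t
  \<comment> \<open>This interval is the set of \<open>t\<close> for which \<open>t\<close> and
    \<open>s + t\<close> both lie in the domain; it is open and connected and contains 0.\<close>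
  proof (rule curve_unique[of "{max (-d) (-d-s)<..<min d (d-s)}" "\<lambda>t. g (s + t)" X "\<lambda>t. g s * g t"
      0 t])
    fix t assume t: "t \<in> {max (-d) (-d-s)<..<min d (d-s)}"
    then have t: "\<bar>t\<bar> < d" "\<bar>s + t\<bar> < d" by auto
    show "curve1 (\<lambda>r. inverse (g (s + t)) * g (s + r)) t X"
      using curve1_shift[OF g(2)[OF t(2)]] .
    show "curve1 (\<lambda>r. inverse (g s * g t) * (g s * g r)) t X"
      using g(2)[OF t(1)] by (simp add: group_simps)
  qed (use that g(1) in auto)
  moreover have "curve1 g 0 X" using g(2)[of 0] d g(1) by (simp add: group_simps)
  ultimately show ?thesis using that d g by blast
qed

definition one_param :: "'e \<Rightarrow> (real \<Rightarrow> 'g) \<Rightarrow> bool" where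
  "one_param X g \<longleftrightarrow> smooth_map euclid_atlas A g \<and> (\<forall>s t. g (s + t) = g s * g t) \<and>
     ((\<lambda>t. snd c (g t)) has_vector_derivative X) (at 0)"

text \<open>The local one-parameter group \<open>g\<close> is extended by \<open>t \<mapsto> g (t / 2\<^sup>n) ^ 2\<^sup>n\<close> for large \<open>n\<close>.\<close>

lemma one_param_exists: "\<exists>g. one_param X g"
proof -
  obtain d g where d: "d > 0" and g: "g 0 = 1" "curve1 g 0 X"
    "\<And>s t. \<bar>s\<bar> < d \<Longrightarrow> \<bar>t\<bar> < d \<Longrightarrow> \<bar>s + t\<bar> < d \<Longrightarrow> g (s + t) = g s * g t"
    "\<And>t. \<bar>t\<bar> < d \<Longrightarrow> g t \<in> fst c" "smooth_on {-d<..<d} (\<lambda>t. snd c (g t))"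
    by (rule local_one_parameter_group) (rule that; assumption)
  \<comment> \<open>\<open>P n t\<close> does not change with \<open>n\<close> once
    \<open>t / 2 ^ n\<close> lies in the domain of \<open>g\<close>: one more halving is undone by
    one more squaring.\<close>
  define P where "P = (\<lambda>n t. g (t / 2 ^ n) ^ 2 ^ n)"
  have step: "P (Suc n) t = P n t" if "\<bar>t / 2 ^ n\<bar> < d" for n t
  proof -
    have "\<bar>t / 2 ^ Suc n\<bar> < d" using that by (simp add: field_simps)
    then have "g (t / 2 ^ Suc n) * g (t / 2 ^ Suc n) = g (t / 2 ^ n)"
      using g(3)[of "t / 2 ^ Suc n" "t / 2 ^ Suc n"] that by simp
    then show ?thesis by (simp add: P_def power_mult power2_eq_square)
  qed
  have mono: "P m t = P n t" if "n \<le> m" "\<bar>t / 2 ^ n\<bar> < d" for m n t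
    using that(1)
  proof (induction m rule: dec_induct)
    case (step k)
    have "\<bar>t / 2 ^ k\<bar> \<le> \<bar>t / 2 ^ n\<bar>" using step by (simp add: divide_left_mono)
    then have "\<bar>t / 2 ^ k\<bar> < d" using that(2) by simp
    from \<open>\<And>n t. \<bar>t / 2 ^ n\<bar> < d \<Longrightarrow> P (Suc n) t = P n t\<close>[OF this] step show ?case by simp
  qed simp
  have "\<exists>n. \<bar>t / 2 ^ n\<bar> < d" for t
  proof -
    obtain n where "\<bar>t\<bar> / d < 2 ^ n" using real_arch_pow[of 2] by auto
    then show ?thesis using d by (intro exI[of _ n]) (simp add: field_simps)
  qed
  then obtain N where N: "\<And>t. \<bar>t / 2 ^ N t\<bar> < d" by metis
  define h where "h = (\<lambda>t. P (N t) t)"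
  have hP: "h t = P m t" if "N t \<le> m" for t m using mono[OF that N] by (simp add: h_def)
  have hg: "h t = g t" if "\<bar>t\<bar> < d" for t
    using mono[of 0 "N t" t] that by (simp add: h_def P_def)
  have hom: "h (s + t) = h s * h t" for s t
  proof -
    \<comment> \<open>One level of subdivision that is fine enough for \<open>s\<close>,
      \<open>t\<close> and \<open>s + t\<close> at once.\<close>
    define m where "m = N s + N t + N (s + t)"
    have small: "\<bar>r / 2 ^ m\<bar> < d" if "N r \<le> m" for r
    proof -
      have "\<bar>r / 2 ^ m\<bar> \<le> \<bar>r / 2 ^ N r\<bar>" using that by (simp add: divide_left_mono)
      then show ?thesis using N[of r] by simp
    qed
    have sm: "\<bar>s / 2 ^ m\<bar> < d" "\<bar>t / 2 ^ m\<bar> < d" "\<bar>s / 2 ^ m + t / 2 ^ m\<bar> < d"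
      using small[of s] small[of t] small[of "s + t"] by (auto simp: m_def add_divide_distrib)
    have a: "g (s / 2 ^ m + t / 2 ^ m) = g (s / 2 ^ m) * g (t / 2 ^ m)"
      by (rule g(3)[OF sm])
    \<comment> \<open>With the preceding equation this makes the two factors commute, so the power
      of their product splits.\<close>
    have b: "g (s / 2 ^ m + t / 2 ^ m) = g (t / 2 ^ m) * g (s / 2 ^ m)"
      using g(3)[OF sm(2,1)] sm(3) by (simp add: add.commute)
    have "P m (s + t) = (g (s / 2 ^ m) * g (t / 2 ^ m)) ^ 2 ^ m"
      by (simp add: P_def add_divide_distrib a)
    also have "\<dots> = P m s * P m t"
      using a b by (simp add: P_def group_power_commuting)
    finally show ?thesis using hP[of s m] hP[of t m] hP[of "s + t" m] by (simp add: m_def)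
  qed
  \<comment> \<open>Near \<open>a\<close> the extension is a left translate of the local group;
    continuity and smoothness at \<open>a\<close> are thereby reduced to those of \<open>g\<close>
    near 0.\<close>
  have h_near: "h t = h a * g (t - a)" if "\<bar>t - a\<bar> < d" for t a
    using hom[of a "t - a"] hg[OF that] by simp
  have der: "((\<lambda>t. snd c (h t)) has_vector_derivative X) (at 0)"
    using g(2) unfolding curve1_def
    by (auto intro!: has_vector_derivative_transform_within_open[of "\<lambda>t. snd c (g t)" X 0
        "{-d<..<d}" "\<lambda>t. snd c (h t)"]
        simp: d hg abs_less_iff)
  have cont: "isCont h a" for a
  proof -
    have "isCont (\<lambda>t. g (t - a)) a"
      using curve1_shift[of g "- a" a X] g(2) by (simp add: curve1_def)
    then have "isCont (\<lambda>t. h a * g (t - a)) a" by (intro isCont_group_mult continuous_const)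
    moreover have "\<forall>\<^sub>F t in nhds a. h t = h a * g (t - a)"
      unfolding eventually_nhds_metric using d h_near by (auto simp: dist_real_def)
    ultimately show ?thesis using isCont_cong[where f = h and x = a and g = "\<lambda>t. h a * g (t - a)"]
        by blast
  qed
  have "smooth_map euclid_atlas A h"
  proof (rule smooth_mapI)
    show "continuous_on UNIV h" using cont by (simp add: continuous_at_imp_continuous_on)
    fix k e assume "k \<in> (euclid_atlas :: (real, real) chart set)" and e: "e \<in> A"
    then have k: "k = (UNIV, \<lambda>x::real. x)" by (simp add: euclid_atlas_def)
    have "smooth_on (h -` fst e) (\<lambda>t. snd e (h t))"
    proof (rule smooth_on_local)
      fix a assume a: "a \<in> h -` fst e"
      define N where "N = {a-d<..<a+d} \<inter> h -` fst e"
      have oN: "open N" unfolding N_def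
        by (intro open_Int open_vimage chart_open[OF atlas e]) (use cont in \<open>auto simp:
            continuous_at_imp_continuous_on\<close>)
      have L: "smooth_map A A (\<lambda>y. h a * y)" by (intro smooth_AI)
      define S where "S = snd c ` (fst c \<inter> (\<lambda>y. h a * y) -` fst e)"
      have S: "open S" "smooth_on S (\<lambda>v. snd e (h a * chart_inv c v))" unfolding S_def
        by (rule smooth_map_open_dom[OF atlas atlas chart e smooth_mapD(1)[OF L]],
            rule smooth_mapD(2)[OF L chart e])
      have tr: "smooth_on {a-d<..<a+d} (\<lambda>t. snd c (g (t - a)))"
      proof (rule smooth_on_compose[where f = "\<lambda>t. t - a" and g = "\<lambda>t. snd c (g t)", OF _ _ _ _
          g(5)])
        show "smooth_on {a - d<..<a + d} (\<lambda>t. t - a)"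
          using smooth_on_add[of "{a - d<..<a + d}" "\<lambda>t. t" "\<lambda>t. - a"] by simp
      qed auto
      have "smooth_on N (\<lambda>t. snd e (h a * chart_inv c (snd c (g (t - a)))))"
      proof (rule smooth_on_compose[where f = "\<lambda>t. snd c (g (t - a))" and g =
          "\<lambda>v. snd e (h a * chart_inv c v)", OF oN S(1) _ _ S(2)])
        show "smooth_on N (\<lambda>t. snd c (g (t - a)))" by (rule smooth_on_subset[OF tr]) (auto simp:
            N_def)
        show "(\<lambda>t. snd c (g (t - a))) ` N \<subseteq> S"
        proof
          fix y assume "y \<in> (\<lambda>t. snd c (g (t - a))) ` N"
          then obtain t where t: "t \<in> N" "y = snd c (g (t - a))" by blast
          have "\<bar>t - a\<bar> < d" using t(1) by (auto simp: N_def)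
          then show "y \<in> S" using t g(4)[of "t - a"] h_near[of t a] by (auto simp: S_def N_def)
        qed
      qed
      then have "smooth_on N (\<lambda>t. snd e (h t))"
      proof (rule smooth_on_transform[OF _ oN])
        fix t assume "t \<in> N"
        then have "\<bar>t - a\<bar> < d" by (auto simp: N_def)
        then show "snd e (h a * chart_inv c (snd c (g (t - a)))) = snd e (h t)"
          using g(4)[of "t - a"] h_near[of t a] by (simp add: inv_left)
      qed
      then show "\<exists>N. open N \<and> a \<in> N \<and> smooth_on N (\<lambda>t. snd e (h t))"
        using oN a d by (intro exI[of _ N]) (auto simp: N_def)
    qed
    then show "smooth_on (snd k ` (fst k \<inter> h -` fst e)) (\<lambda>u. snd e (h (chart_inv k u)))"
      by (simp add: k)
  qed
  then show ?thesis using hom der unfolding one_param_def by blast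
qed

lemma one_param_0:
  assumes "one_param X g"
  shows "g 0 = 1"
proof -
  have "g 0 = g 0 * g 0" using assms unfolding one_param_def by (metis add_0)
  then show ?thesis by (metis group_inverse_cancel(1) group_left_inverse)
qed

text \<open>By the group law the increment \<open>inverse (g t) * g s\<close> is
  \<open>g (s - t)\<close>, so the velocity at 0 is the left logarithmic derivative at every
  time.\<close>

lemma one_param_curve1:
  assumes "one_param X g"
  shows "curve1 (\<lambda>s. inverse (g t) * g s) t X"
proof -
  have hom: "g (s + t) = g s * g t" for s t using assms by (simp add: one_param_def)
  have "isCont g 0"
    using assms smooth_mapD(1)[of euclid_atlas A g] by (auto simp: one_param_def
        continuous_on_eq_continuous_at)
  then have "curve1 g 0 X" using assms one_param_0[OF assms] by (simp add: curve1_def one_param_def)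
  then have "curve1 (\<lambda>s. g (- t + s)) t X" by (intro curve1_shift) simp
  moreover have "inverse (g t) = g (- t)"
    by (rule group_inverse_unique) (simp add: hom[symmetric] one_param_0[OF assms])
  ultimately show ?thesis by (simp add: hom[symmetric])
qed

lemma one_param_unique:
  assumes "one_param X g" "one_param X h"
  shows "g t = h t"
  by (rule curve_unique[of UNIV g X h 0 t])
    (use assms in \<open>auto simp: one_param_0 intro: one_param_curve1\<close>)

lemma lie_exp_eq:
  assumes "one_param X g"
  shows "lie_exp A c X = g 1"
  unfolding lie_exp_def
proof (rule the_equality)
  show "\<exists>\<gamma>. smooth_map euclid_atlas A \<gamma> \<and> (\<forall>s t. \<gamma> (s + t) = \<gamma> s * \<gamma> t) \<and>
      ((\<lambda>t. snd c (\<gamma> t)) has_vector_derivative X) (at 0) \<and> g 1 = \<gamma> 1"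
    using assms unfolding one_param_def by blast
next
  fix y assume "\<exists>\<gamma>. smooth_map euclid_atlas A \<gamma> \<and> (\<forall>s t. \<gamma> (s + t) = \<gamma> s * \<gamma> t) \<and>
      ((\<lambda>t. snd c (\<gamma> t)) has_vector_derivative X) (at 0) \<and> y = \<gamma> 1"
  then obtain h where "one_param X h" "y = h 1" unfolding one_param_def by blast
  then show "y = g 1" using one_param_unique[OF assms] by simp
qed

lemma one_param_scale:
  assumes "one_param X g"
  shows "one_param (r *\<^sub>R X) (\<lambda>t. g (r * t))"
  unfolding one_param_def
proof (intro conjI allI)
  have "smooth_map euclid_atlas euclid_atlas (\<lambda>t::real. r * t)"
    by (rule smooth_map_linear_comp[OF smooth_atlas_euclid smooth_map_ident[OF
        smooth_atlas_euclid]])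
      (simp add: linear_times)
  moreover have "smooth_map euclid_atlas A g" using assms by (simp add: one_param_def)
  ultimately show "smooth_map euclid_atlas A (\<lambda>t. g (r * t))"
    by (rule smooth_map_compose[OF smooth_atlas_euclid smooth_atlas_euclid atlas])
  show "g (r * (s + t)) = g (r * s) * g (r * t)" for s t
    using assms by (simp add: one_param_def distrib_left)
  have "((\<lambda>t::real. r * t) has_vector_derivative r) (at 0)"
    by (auto intro!: derivative_eq_intros)
  then show "((\<lambda>t. snd c (g (r * t))) has_vector_derivative r *\<^sub>R X) (at 0)"
    using assms vector_diff_chain_at[of "\<lambda>t. r * t" r 0 "\<lambda>t. snd c (g t)" X] by (simp add:
        one_param_def o_def)
qed

lemma one_param_lie_exp: "one_param X (\<lambda>t. lie_exp A c (t *\<^sub>R X))"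
proof -
  obtain g where g: "one_param X g" using one_param_exists by blast
  have "lie_exp A c (t *\<^sub>R X) = g t" for t using lie_exp_eq[OF one_param_scale[OF g]] by simp
  then show ?thesis using g by simp
qed

lemma lie_exp_add: "lie_exp A c ((s + t) *\<^sub>R X) = lie_exp A c (s *\<^sub>R X) * lie_exp A c (t *\<^sub>R X)"
  using one_param_lie_exp[of X] unfolding one_param_def by blast

lemma lie_exp_0 [simp]: "lie_exp A c 0 = 1"
  using one_param_0[OF one_param_lie_exp[of 0]] by simp

lemma inverse_lie_exp: "inverse (lie_exp A c (t *\<^sub>R X)) = lie_exp A c ((- t) *\<^sub>R X)"
  by (rule group_inverse_unique) (use lie_exp_add[of t "- t" X] in simp)

lemma curve1_lie_exp: "curve1 (\<lambda>t. lie_exp A c (t *\<^sub>R X)) 0 X"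
  using one_param_curve1[OF one_param_lie_exp, of 0 X] by (simp add: group_simps)

end

section \<open>Inner products and traces\<close>

locale inner_form =
  fixes B :: "'a::euclidean_space \<Rightarrow> 'a \<Rightarrow> real"
  assumes bilinear: "bilinear B" and sym: "B x y = B y x" and pos: "x \<noteq> 0 \<Longrightarrow> 0 < B x x"
begin

lemma linear_left: "linear (\<lambda>x. B x y)" and linear_right: "linear (B x)"
  using bilinear by (auto simp: bilinear_def)

lemmas form_simps = bilinear_ladd[OF bilinear] bilinear_radd[OF bilinear]
  bilinear_lsub[OF bilinear] bilinear_rsub[OF bilinear] bilinear_lmul[OF bilinear]
  bilinear_rmul[OF bilinear] bilinear_lneg[OF bilinear] bilinear_rneg[OF bilinear]
  bilinear_lzero[OF bilinear] bilinear_rzero[OF bilinear]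

lemma eq_zero: "B x x = 0 \<Longrightarrow> x = 0"
  using pos by fastforce

lemma nonneg: "0 \<le> B x x"
  using pos[of x] by (cases "x = 0") (auto simp: form_simps)

lemma orthonormal_expansion:
  assumes "finite S" "\<And>s t. s \<in> S \<Longrightarrow> t \<in> S \<Longrightarrow> B s t = (if s = t then 1 else 0)" "x \<in> span S"
  shows "x = (\<Sum>s\<in>S. B x s *\<^sub>R s)"
proof -
  obtain u where u: "x = (\<Sum>v\<in>S. u v *\<^sub>R v)"
    using assms(3) unfolding span_finite[OF assms(1)] by auto
  have "B x s = u s" if "s \<in> S" for s
  proof -
    have "B x s = (\<Sum>v\<in>S. u v * B v s)"
      unfolding u by (simp add: linear_sum[OF linear_left] form_simps)
    also have "\<dots> = (\<Sum>v\<in>S. if v = s then u v else 0)"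
      by (rule sum.cong) (auto simp: assms(2) that)
    finally show ?thesis using that assms(1) by simp
  qed
  then show ?thesis using u by simp
qed

text \<open>Gram-Schmidt for the form \<open>B\<close>.\<close>

lemma orthonormal_spanning_set:
  assumes "finite F"
  shows "\<exists>S. finite S \<and> span S = span F \<and> (\<forall>s\<in>S. \<forall>t\<in>S. B s t = (if s = t then 1 else 0))"
  using assms
proof (induction F rule: finite_induct)
  case empty
  show ?case by (intro exI[of _ "{}"]) auto
next
  case (insert a F)
  then obtain S where S: "finite S" "span S = span F" "\<And>s t. s \<in> S \<Longrightarrow> t \<in> S \<Longrightarrow> B s t = (if s
      = t then 1 else 0)"
    by blast
  define b where "b = a - (\<Sum>s\<in>S. B a s *\<^sub>R s)"
  have sumS: "(\<Sum>s\<in>S. B a s *\<^sub>R s) \<in> span S" by (intro span_sum span_scale span_base)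
  have span_b: "span (insert b S) = span (insert a F)"
  proof -
    have "span (insert b S) = span (insert a S)" unfolding b_def
      by (rule eq_span_insert_eq) (simp add: span_neg[OF sumS])
    also have "\<dots> = span (insert a F)" unfolding span_insert[of a] by (simp add: S(2))
    finally show ?thesis .
  qed
  have orth: "B b t = 0" if "t \<in> S" for t
  proof -
    have "B (\<Sum>s\<in>S. B a s *\<^sub>R s) t = (\<Sum>s\<in>S. B a s * B s t)"
      by (simp add: linear_sum[OF linear_left] form_simps)
    also have "\<dots> = (\<Sum>s\<in>S. if s = t then B a s else 0)"
      by (rule sum.cong) (auto simp: S(3) that)
    finally show ?thesis using that S(1) by (simp add: b_def form_simps)
  qed
  show ?case
  \<comment> \<open>A zero remainder means that \<open>a\<close> already lies in the span of
    \<open>S\<close>, so \<open>S\<close> is kept unchanged.\<close>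
  proof (cases "b = 0")
    case True
    then have "span (insert b S) = span S" by (simp add: span_insert_0)
    then show ?thesis using S span_b by metis
  next
    case False
    define k where "k = 1 / sqrt (B b b)"
    have k: "k \<noteq> 0" "k * k * B b b = 1"
      using pos[OF False] by (auto simp: k_def field_simps)
    have "span (insert (k *\<^sub>R b) S) = span (insert b S)"
    proof (rule span_eq[THEN iffD2], intro conjI)
      show "insert (k *\<^sub>R b) S \<subseteq> span (insert b S)"
        by (auto intro: span_scale span_base)
      have "(1 / k) *\<^sub>R (k *\<^sub>R b) \<in> span (insert (k *\<^sub>R b) S)"
        by (intro span_scale span_base) simp
      then show "insert b S \<subseteq> span (insert (k *\<^sub>R b) S)"
        using k(1) by (auto intro: span_base)
    qed
    moreover have "B s t = (if s = t then 1 else 0)" if "s \<in> insert (k *\<^sub>R b) S"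
        "t \<in> insert (k *\<^sub>R b) S" for s t
    proof -
      have "k *\<^sub>R b \<notin> S"
        using orth[of "k *\<^sub>R b"] k pos[OF False] by (auto simp: form_simps)
      moreover have "B (k *\<^sub>R b) (k *\<^sub>R b) = 1" using k(2) by (simp add: form_simps)
      moreover have "B (k *\<^sub>R b) u = 0" "B u (k *\<^sub>R b) = 0" if "u \<in> S" for u
        using orth[OF that] sym[of u b] by (auto simp: form_simps)
      ultimately show ?thesis using that S(3) by auto
    qed
    ultimately show ?thesis using S(1) span_b
      by (intro exI[of _ "insert (k *\<^sub>R b) S"]) auto
  qed
qed

lemma orthogonal_projection:
  assumes "subspace V"
  obtains y where "y \<in> V" "\<And>z. z \<in> V \<Longrightarrow> B (x - y) z = 0"
proof -
  obtain F where F: "F \<subseteq> V" "independent F" "V \<subseteq> span F" using basis_exists by metis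
  have spanF: "span F = V" using F assms by (simp add: span_minimal subset_antisym)
  obtain S where S: "finite S" "span S = V" "\<And>s t. s \<in> S \<Longrightarrow> t \<in> S \<Longrightarrow> B s t = (if s = t then 1 else 0)"
    using orthonormal_spanning_set[OF independent_imp_finite[OF F(2)]] spanF by auto
  define y where "y = (\<Sum>s\<in>S. B x s *\<^sub>R s)"
  have y: "y \<in> V" unfolding y_def S(2)[symmetric] by (intro span_sum span_scale span_base)
  have orth: "B (x - y) t = 0" if "t \<in> S" for t
  proof -
    have "B y t = (\<Sum>s\<in>S. B x s * B s t)"
      unfolding y_def by (simp add: linear_sum[OF linear_left] form_simps)
    also have "\<dots> = (\<Sum>s\<in>S. if s = t then B x s else 0)"
      by (rule sum.cong) (auto simp: S(3) that)
    finally show ?thesis using that S(1) by (simp add: form_simps)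
  qed
  have "B (x - y) z = 0" if "z \<in> V" for z
  proof -
    have "z \<in> span S" using that S(2) by simp
    from linear_eq_0_on_span[OF linear_right _ this, of "x - y"] orth show ?thesis by blast
  qed
  with y show ?thesis by (rule that)
qed

text \<open>Independence of the trace from the basis: expand \<open>b\<close> in \<open>S\<close>,
  swap the sums, and contract over \<open>Basis\<close>.\<close>

lemma trace_orthonormal:
  assumes "linear f" "finite S" "span S = UNIV"
    "\<And>s t. s \<in> S \<Longrightarrow> t \<in> S \<Longrightarrow> B s t = (if s = t then 1 else 0)"
  shows "(\<Sum>b\<in>Basis. f b \<bullet> b) = (\<Sum>s\<in>S. B (f s) s)"
proof -
  have "(\<Sum>b\<in>Basis. f b \<bullet> b) = (\<Sum>b\<in>Basis. \<Sum>s\<in>S. B b s * (f s \<bullet> b))"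
  proof (rule sum.cong[OF refl])
    fix b :: 'a
    have "f b = f (\<Sum>s\<in>S. B b s *\<^sub>R s)"
      using orthonormal_expansion[OF assms(2,4), of b] assms(3) by simp
    then show "f b \<bullet> b = (\<Sum>s\<in>S. B b s * (f s \<bullet> b))"
      by (simp add: linear_sum[OF assms(1)] linear_cmul[OF assms(1)] inner_sum_left)
  qed
  also have "\<dots> = (\<Sum>s\<in>S. \<Sum>b\<in>Basis. B b s * (f s \<bullet> b))" by (rule sum.swap)
  also have "\<dots> = (\<Sum>s\<in>S. B (f s) s)"
  proof (rule sum.cong[OF refl])
    fix s
    show "(\<Sum>b\<in>Basis. B b s * (f s \<bullet> b)) = B (f s) s"
      using linear_expand_Basis[OF linear_left, of "f s" s] by (simp add: mult.commute)
  qed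
  finally show ?thesis .
qed

text \<open>In a \<open>B\<close>-orthonormal basis the trace of the square is minus the sum of the
  values \<open>B (T s) (T s)\<close>. This provides the sign of the Killing form.\<close>

lemma trace_skew_square:
  assumes T: "linear T" and skew: "\<And>x y. B (T x) y = - B x (T y)"
  shows "(\<Sum>b\<in>Basis. T (T b) \<bullet> b) \<le> 0"
    and "(\<Sum>b\<in>Basis. T (T b) \<bullet> b) = 0 \<Longrightarrow> T x = 0"
proof -
  obtain S where S: "finite S" "span S = UNIV" "\<And>s t. s \<in> S \<Longrightarrow> t \<in> S \<Longrightarrow> B s t = (if s
      = t then 1 else 0)"
    using orthonormal_spanning_set[of "Basis :: 'a set"] by auto
  have "linear (\<lambda>x. T (T x))" using linear_compose[OF T T] by (simp add: o_def)
  from trace_orthonormal[OF this S]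
  have tr: "(\<Sum>b\<in>Basis. T (T b) \<bullet> b) = - (\<Sum>s\<in>S. B (T s) (T s))"
    by (simp add: skew sum_negf)
  then show "(\<Sum>b\<in>Basis. T (T b) \<bullet> b) \<le> 0" by (simp add: sum_nonneg nonneg)
  assume "(\<Sum>b\<in>Basis. T (T b) \<bullet> b) = 0"
  then have "\<forall>s\<in>S. B (T s) (T s) = 0"
    using tr sum_nonneg_eq_0_iff[OF S(1), of "\<lambda>s. B (T s) (T s)"] by (simp add: nonneg)
  then have "T s = 0" if "s \<in> S" for s using that eq_zero by blast
  moreover have "x \<in> span S" using S(2) by simp
  ultimately show "T x = 0" using linear_eq_0_on_span[OF T, of S x] by blast
qed

end

section \<open>Invariant inner products of bounded flows\<close>

lemma common_convergent_subsequence: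
  fixes f :: "'i \<Rightarrow> nat \<Rightarrow> real"
  assumes "finite I" "\<And>i. i \<in> I \<Longrightarrow> bounded (range (f i))"
  shows "\<exists>r. strict_mono r \<and> (\<forall>i\<in>I. convergent (f i \<circ> r))"
  using assms
proof (induction I rule: finite_induct)
  case empty
  show ?case by (intro exI[of _ "\<lambda>n. n"]) (simp add: strict_mono_def)
next
  case (insert i I)
  then obtain r where r: "strict_mono r" "\<forall>i\<in>I. convergent (f i \<circ> r)" by blast
  have "bounded (range (f i \<circ> r))"
    using insert.prems[of i] by (rule_tac bounded_subset) auto
  then obtain l r' where r': "strict_mono r'" "((f i \<circ> r) \<circ> r') \<longlonglongrightarrow> l"
    using bounded_imp_convergent_subsequence by blast
  have "convergent (f j \<circ> (r \<circ> r'))" if "j \<in> insert i I" for j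
  proof (cases "j = i")
    case True
    then show ?thesis using r'(2) by (auto simp: convergent_def o_assoc)
  next
    case False
    then show ?thesis using r(2) r'(1) that convergent_subseq_convergent[of "f j \<circ> r" r'] by (auto
        simp: o_assoc)
  qed
  then show ?case using strict_mono_o[OF r(1) r'(1)] by blast
qed

text \<open>Averaging the Euclidean inner product along a bounded flow produces an inner product for
  which the generator is skew.\<close>

lemma bounded_flow_invariant_form:
  fixes U :: "real \<Rightarrow> 'a::euclidean_space \<Rightarrow> 'a"
  assumes linU: "\<And>t. linear (U t)" and inv: "\<And>t Y. U (- t) (U t Y) = Y"
    and der: "\<And>t Y. ((\<lambda>s. U s Y) has_vector_derivative U t (T Y)) (at t)"
    and bd: "\<And>t Y. norm (U t Y) \<le> M * norm Y"
  obtains B where "inner_form B" "\<And>Y Z. B (T Y) Z = - B Y (T Z)"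
proof -
  have cont: "continuous_on S (\<lambda>t. U t Y)" for S Y
    using der has_vector_derivative_continuous by (blast intro: continuous_at_imp_continuous_on)
  have int: "(\<lambda>t. U t Y \<bullet> U t Z) integrable_on {0..r}" for Y Z and r :: real
    by (intro integrable_continuous_real continuous_intros cont)
  obtain b0 :: 'a where b0: "b0 \<in> Basis" using nonempty_Basis by blast
  have M0: "M \<ge> 0" using order_trans[OF norm_ge_zero bd[of 0 b0]] b0 by simp
  \<comment> \<open>Comes from transporting a unit vector there and back; it excludes
    \<open>M = 0\<close>, so \<open>M\<close> may stand in denominators.\<close>
  have "1 \<le> M * M"
  proof -
    have "norm b0 \<le> M * norm (U 0 b0)" using bd[of "- 0" "U 0 b0"] inv[of 0 b0] by simp
    moreover have "M * norm (U 0 b0) \<le> M * (M * norm b0)" by (intro mult_left_mono bd M0)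
    ultimately show ?thesis using b0 by simp
  qed
  then have M: "M > 0" using M0 by (cases "M = 0") auto
  \<comment> \<open>Time average over an interval of length \<open>n + 1\<close>; the successor
    keeps the length positive.\<close>
  define C where "C = (\<lambda>n Y Z. integral {0..real (Suc n)} (\<lambda>t. U t Y \<bullet> U t Z) / real (Suc n))"
  have C_lin1: "linear (\<lambda>Y. C n Y Z)" for n Z
    by (rule linearI) (simp_all add: C_def linear_add[OF linU] linear_cmul[OF linU] inner_add_left
        integral_add[OF int int] add_divide_distrib)
  have C_sym: "C n Y Z = C n Z Y" for n Y Z by (simp add: C_def inner_commute)
  have C_lin2: "linear (C n Y)" for n Y
    using C_lin1[of n Y] by (simp add: C_sym[of n _ Y])
  have C_bd: "\<bar>C n Y Z\<bar> \<le> (M * norm Y) * (M * norm Z)" for n Y Z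
  proof -
    have "norm (integral {0..real (Suc n)} (\<lambda>t. U t Y \<bullet> U t Z))
        \<le> (M * norm Y) * (M * norm Z) * (real (Suc n) - 0)"
    proof (rule integral_bound)
      fix t
      have "norm (U t Y \<bullet> U t Z) \<le> norm (U t Y) * norm (U t Z)" by (simp add: Cauchy_Schwarz_ineq2)
      also have "\<dots> \<le> (M * norm Y) * (M * norm Z)" using M by (intro mult_mono bd) auto
      finally show "norm (U t Y \<bullet> U t Z) \<le> (M * norm Y) * (M * norm Z)" .
    qed (auto intro!: continuous_intros cont)
    then show ?thesis by (simp add: C_def field_simps abs_mult)
  qed
  have C_pos: "norm Y * norm Y / (M * M) \<le> C n Y Y" for n Y
  proof -
    have "norm Y * norm Y / (M * M) * real (Suc n) = integral {0..real (Suc n)} (\<lambda>t. norm Y * norm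
        Y / (M * M))"
      by simp
    also have "\<dots> \<le> integral {0..real (Suc n)} (\<lambda>t. U t Y \<bullet> U t Y)"
    proof (rule integral_le[OF _ int])
      fix t
      \<comment> \<open>The bound for the inverse flow gives a uniform lower bound, which keeps the
        limit form definite.\<close>
      have "norm Y \<le> M * norm (U t Y)" using bd[of "- t" "U t Y"] inv[of t Y] by simp
      then have "norm Y * norm Y \<le> (M * norm (U t Y)) * (M * norm (U t Y))"
        using M0 by (intro mult_mono) auto
      then show "norm Y * norm Y / (M * M) \<le> U t Y \<bullet> U t Y"
        using M by (simp add: field_simps dot_square_norm power2_eq_square)
    qed (intro integrable_continuous_real continuous_on_const)
    finally show ?thesis by (simp add: C_def field_simps)
  qed
  \<comment> \<open>The integrand is the time derivative of the inner product of
    \<open>U t Y\<close> and \<open>U t Z\<close>, so only bounded boundary terms remain and the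
    defect of skewness is of order \<open>1 / n\<close>.\<close>
  have C_skew: "C n (T Y) Z + C n Y (T Z) = (U (real (Suc n)) Y \<bullet> U (real (Suc n)) Z
      - U 0 Y \<bullet> U 0 Z) / real (Suc n)"
    for n Y Z
  proof -
    have "((\<lambda>t. U t Y \<bullet> U t (T Z) + U t (T Y) \<bullet> U t Z) has_integral
        U (real (Suc n)) Y \<bullet> U (real (Suc n)) Z - U 0 Y \<bullet> U 0 Z) {0..real (Suc n)}"
    proof (rule fundamental_theorem_of_calculus)
      fix t :: real
      show "((\<lambda>t. U t Y \<bullet> U t Z) has_vector_derivative U t Y \<bullet> U t (T Z)
          + U t (T Y) \<bullet> U t Z) (at t within {0..real (Suc n)})"
        by (intro bounded_bilinear.has_vector_derivative[OF bounded_bilinear_inner]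
            has_vector_derivative_at_within[OF der])
    qed simp
    then have "integral {0..real (Suc n)} (\<lambda>t. U t Y \<bullet> U t (T Z) + U t (T Y) \<bullet> U t Z) =
        U (real (Suc n)) Y \<bullet> U (real (Suc n)) Z - U 0 Y \<bullet> U 0 Z" by (rule integral_unique)
    then show ?thesis
      by (simp add: C_def integral_add[OF int int] add_divide_distrib[symmetric] add.commute)
  qed
  \<comment> \<open>Convergence is arranged along a subsequence for the finitely many pairs of basis
    vectors; bilinearity extends it to all arguments.\<close>
  have "\<exists>r. strict_mono r \<and> (\<forall>p\<in>Basis \<times> Basis. convergent ((\<lambda>n. C n (fst p) (snd p)) \<circ> r))"
  proof (rule common_convergent_subsequence)
    fix p :: "'a \<times> 'a"
    show "bounded (range (\<lambda>n. C n (fst p) (snd p)))"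
      using C_bd by (auto simp: bounded_iff)
  qed simp
  then obtain r where r: "strict_mono r"
    "\<And>b b'. b \<in> Basis \<Longrightarrow> b' \<in> Basis \<Longrightarrow> convergent (\<lambda>n. C (r n) b b')"
    by (auto simp: o_def)
  define B where "B = (\<lambda>Y Z. lim (\<lambda>n. C (r n) Y Z))"
  have expand: "C n Y Z = (\<Sum>b\<in>Basis. \<Sum>b'\<in>Basis. (Y \<bullet> b) * (Z \<bullet> b') * C n b b')" for n Y Z
  proof -
    have "C n Y Z = (\<Sum>b\<in>Basis. (Y \<bullet> b) * C n b Z)"
      using linear_expand_Basis[OF C_lin1, of n Y Z] by simp
    also have "\<dots> = (\<Sum>b\<in>Basis. \<Sum>b'\<in>Basis. (Y \<bullet> b) * (Z \<bullet> b') * C n b b')"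
    proof (rule sum.cong[OF refl])
      fix b :: 'a
      show "(Y \<bullet> b) * C n b Z = (\<Sum>b'\<in>Basis. (Y \<bullet> b) * (Z \<bullet> b') * C n b b')"
        using linear_expand_Basis[OF C_lin2[of n b], of Z]
        by (simp add: sum_distrib_left mult.assoc)
    qed
    finally show ?thesis .
  qed
  have "convergent (\<lambda>n. C (r n) Y Z)" for Y Z
    unfolding expand[of _ Y Z]
    by (intro convergent_sum convergent_mult convergent_const r) auto
  then have lim: "(\<lambda>n. C (r n) Y Z) \<longlonglongrightarrow> B Y Z" for Y Z
    by (simp add: B_def convergent_LIMSEQ_iff)
  have B_sym: "B Y Z = B Z Y" for Y Z by (simp add: B_def C_sym)
  have B_lin: "linear (\<lambda>Y. B Y Z)" for Z
  proof (rule linearI)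
    fix Y Y' :: 'a and k :: real
    have "(\<lambda>n. C (r n) Y Z + C (r n) Y' Z) \<longlonglongrightarrow> B Y Z + B Y' Z" by (intro tendsto_add lim)
    then show "B (Y + Y') Z = B Y Z + B Y' Z"
      using lim[of "Y + Y'" Z] LIMSEQ_unique by (simp add: linear_add[OF C_lin1])
    have "(\<lambda>n. k * C (r n) Y Z) \<longlonglongrightarrow> k * B Y Z" by (intro tendsto_mult lim tendsto_const)
    then show "B (k *\<^sub>R Y) Z = k *\<^sub>R B Y Z"
      using lim[of "k *\<^sub>R Y" Z] LIMSEQ_unique by (simp add: linear_cmul[OF C_lin1])
  qed
  have "inner_form B"
  proof
    have "B Y = (\<lambda>Z. B Z Y)" for Y by (rule ext) (rule B_sym)
    then have "linear (B Y)" for Y using B_lin[of Y] by metis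
    then show "bilinear B" unfolding bilinear_def using B_lin by blast
    show "B Y Z = B Z Y" for Y Z by (rule B_sym)
    show "0 < B Y Y" if "Y \<noteq> 0" for Y
    proof -
      have "norm Y * norm Y / (M * M) \<le> B Y Y"
        by (rule LIMSEQ_le_const[OF lim]) (use C_pos in auto)
      moreover have "0 < norm Y * norm Y / (M * M)" using that M by simp
      ultimately show ?thesis by linarith
    qed
  qed
  moreover have "B (T Y) Z = - B Y (T Z)" for Y Z
  proof -
    let ?K = "M * norm Y * (M * norm Z) + M * norm Y * (M * norm Z)"
    have "(\<lambda>n. C n (T Y) Z + C n Y (T Z)) \<longlonglongrightarrow> 0"
    proof (rule Lim_null_comparison)
      show "\<forall>\<^sub>F n in sequentially. norm (C n (T Y) Z + C n Y (T Z)) \<le> ?K / real (Suc n)"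
      proof (intro always_eventually allI)
        fix n
        have b: "\<bar>U t Y \<bullet> U t Z\<bar> \<le> M * norm Y * (M * norm Z)" for t
          using M by (intro order_trans[OF Cauchy_Schwarz_ineq2] mult_mono bd) auto
        have "\<bar>U (real (Suc n)) Y \<bullet> U (real (Suc n)) Z - U 0 Y \<bullet> U 0 Z\<bar> \<le> ?K"
          using b[of "real (Suc n)"] b[of 0] by linarith
        then show "norm (C n (T Y) Z + C n Y (T Z)) \<le> ?K / real (Suc n)"
          unfolding C_skew by (simp add: abs_divide divide_right_mono)
      qed
      show "(\<lambda>n. ?K / real (Suc n)) \<longlonglongrightarrow> 0"
        using LIMSEQ_Suc[OF lim_const_over_n[of ?K]] by simp
    qed
    from LIMSEQ_subseq_LIMSEQ[OF this r(1)]
    have "(\<lambda>n. C (r n) (T Y) Z + C (r n) Y (T Z)) \<longlonglongrightarrow> 0" by (simp add: o_def)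
    moreover have "(\<lambda>n. C (r n) (T Y) Z + C (r n) Y (T Z)) \<longlonglongrightarrow> B (T Y) Z + B Y (T Z)"
      by (intro tendsto_add lim)
    ultimately have "B (T Y) Z + B Y (T Z) = 0" using LIMSEQ_unique by blast
    then show ?thesis by simp
  qed
  ultimately show ?thesis by (rule that)
qed

section \<open>The adjoint representation and the bracket\<close>

context lie_chart
begin

abbreviation br :: "'e \<Rightarrow> 'e \<Rightarrow> 'e" where "br \<equiv> lie_bracket c"

text \<open>The left-invariant vector field of \<open>X\<close> applied to \<open>f\<close>.\<close>

definition tderiv :: "('g \<Rightarrow> 'b::euclidean_space) \<Rightarrow> 'g \<Rightarrow> 'e \<Rightarrow> 'b" where
  "tderiv f x X = frechet_derivative (\<lambda>u. f (x * chart_inv c u)) (at e0) X"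

lemma tderiv_has_derivative:
  assumes "smooth_map A euclid_atlas f"
  shows "((\<lambda>u. f (x * chart_inv c u)) has_derivative tderiv f x) (at e0)"
proof -
  have "smooth_map A A (\<lambda>y. x * y)" by (intro smooth_AI)
  then have "smooth_map A euclid_atlas (\<lambda>y. f (x * y))"
    by (rule smooth_map_compose[OF atlas atlas smooth_atlas_euclid _ assms])
  from smooth_on_has_derivative[OF chart_open_image[OF atlas chart] smooth_map_euclidD[OF this
      chart] e0_in]
  show ?thesis by (simp add: tderiv_def[abs_def])
qed

lemma tderiv_curve:
  assumes "smooth_map A euclid_atlas f" "curve1 p t X"
  shows "((\<lambda>s. f (x * p s)) has_vector_derivative tderiv f x X) (at t)"
  using curve1_deriv[where f = "\<lambda>y. f (x * y)", OF assms(2) tderiv_has_derivative[OF assms(1)]] .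

lemma linear_tderiv: "smooth_map A euclid_atlas f \<Longrightarrow> linear (tderiv f x)"
  using has_derivative_linear[OF tderiv_has_derivative] .

lemma deriv_along_eq:
  assumes "smooth_map A euclid_atlas f"
  shows "deriv_along A c V f x = tderiv f x (V x)"
  unfolding deriv_along_def
  by (rule vector_derivative_at[OF tderiv_curve[OF assms curve1_lie_exp]])

text \<open>Main device for \<open>Ad\<close>: both sides of an identity are exhibited as the
  velocity of one curve.\<close>

lemma curve1_unique:
  assumes "curve1 p t X" "curve1 p t Y"
  shows "X = Y"
  using assms vector_derivative_unique_at unfolding curve1_def by blast

lemma Ad_mult: "Ad c (x * y) X = Ad c x (Ad c y X)"
proof (rule curve1_unique)
  show "curve1 (\<lambda>t. x * (y * lie_exp A c (t *\<^sub>R X) * inverse y) * inverse x) 0 (Ad c x (Ad c y X))"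
    by (intro curve1_conj curve1_lie_exp)
  show "curve1 (\<lambda>t. x * (y * lie_exp A c (t *\<^sub>R X) * inverse y) * inverse x) 0 (Ad c (x * y) X)"
    using curve1_conj[OF curve1_lie_exp, of "x * y" X] by (simp add: group_simps)
qed

lemma Ad_one [simp]: "Ad c 1 X = X"
  using curve1_unique[OF _ curve1_lie_exp] curve1_conj[OF curve1_lie_exp, of 1 X]
  by (simp add: group_inverse_one)

lemma Ad_inverse [simp]: "Ad c x (Ad c (inverse x) X) = X" "Ad c (inverse x) (Ad c x X) = X"
  by (simp_all add: Ad_mult[symmetric] group_simps)

text \<open>A one-parameter subgroup is commutative, so conjugation by its elements fixes it
  pointwise.\<close>

lemma Ad_lie_exp_self: "Ad c (lie_exp A c (s *\<^sub>R X)) X = X"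
proof (rule curve1_unique[OF _ curve1_lie_exp])
  have "lie_exp A c (s *\<^sub>R X) * lie_exp A c (t *\<^sub>R X) * inverse (lie_exp A c (s *\<^sub>R X))
      = lie_exp A c (t *\<^sub>R X)" for t
    unfolding inverse_lie_exp lie_exp_add[symmetric] by simp
  then show "curve1 (\<lambda>t. lie_exp A c (t *\<^sub>R X)) 0 (Ad c (lie_exp A c (s *\<^sub>R X)) X)"
    using curve1_conj[OF curve1_lie_exp, of "lie_exp A c (s *\<^sub>R X)" X] by simp
qed

text \<open>\<open>Ad\<close> is the partial derivative at 1, in the second variable, of the jointly
  smooth map \<open>(x, y) \<mapsto> x * y * inverse x\<close>.\<close>

lemma smooth_map_Ad: "smooth_map A euclid_atlas (\<lambda>x. Ad c x Y)"
proof (rule smooth_map_euclidI[OF atlas])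
  fix d assume d: "d \<in> A"
  define F where "F = (\<lambda>z::'g \<times> 'g. fst z * snd z * inverse (fst z))"
  have F: "smooth_map (prod_atlas A A) A F" unfolding F_def by (intro smooth_PI)
  define H where "H = (\<lambda>w. snd c (F (chart_inv d (fst w), chart_inv c (snd w))))"
  define S where "S = {w \<in> snd d ` fst d \<times> snd c ` fst c. F (chart_inv d (fst w), chart_inv c (snd
      w)) \<in> fst c}"
  from smooth_map_prod_charts[OF F d chart]
  have S: "open S" and sm: "smooth_on S H" unfolding S_def H_def by auto
  have uS: "(u, e0) \<in> S" if "u \<in> snd d ` fst d" for u
    using that e0_in one_in_chart by (simp add: S_def F_def group_simps)
  have eq: "Ad c (chart_inv d u) Y = frechet_derivative H (at (u, e0)) (0, Y)" if
      "u \<in> snd d ` fst d" for u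
  proof -
    have "((\<lambda>v. H (u, v)) has_derivative (\<lambda>v. frechet_derivative H (at (u, e0)) (0, v))) (at e0)"
      using diff_chain_at[of "\<lambda>v. (u, v)" "\<lambda>v. (0, v)" e0 H] smooth_on_has_derivative[OF S sm
          uS[OF that]]
      by (simp add: o_def has_derivative_Pair)
    moreover have "(\<lambda>v. H (u, v)) = (\<lambda>v. snd c (chart_inv d u * chart_inv c v * inverse (chart_inv
        d u)))"
      by (simp add: H_def F_def)
    ultimately show ?thesis using has_derivative_unique[OF Ad_has_derivative] by metis
  qed
  have O: "open (snd d ` fst d)" by (rule chart_open_image[OF atlas d])
  have "smooth_on (snd d ` fst d) (\<lambda>u. frechet_derivative H (at (u, e0)) (0, Y))"
    by (rule smooth_on_compose[where f = "\<lambda>u. (u, e0)" and g =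
        "\<lambda>w. frechet_derivative H (at w) (0, Y)" and T = S])
      (use O S uS in \<open>auto intro!: smooth_on_Pair smooth_on_derivative sm\<close>)
  then show "smooth_on (snd d ` fst d) (\<lambda>u. Ad c (chart_inv d u) Y)"
    by (rule smooth_on_transform[OF _ O]) (simp add: eq)
qed

lemma br_eq_tderiv: "br X Y = tderiv (\<lambda>x. Ad c x Y) 1 X"
  by (simp add: lie_bracket_def tderiv_def)

text \<open>Multiplicativity factors the fixed linear map \<open>Ad c x\<close> out of the
  derivative, which leaves the derivative at 1, that is, the bracket.\<close>

lemma tderiv_Ad: "tderiv (\<lambda>x. Ad c x Y) x X = Ad c x (br X Y)"
proof -
  have "((\<lambda>s. Ad c x (Ad c (1 * lie_exp A c (s *\<^sub>R X)) Y))
      has_vector_derivative Ad c x (br X Y)) (at 0)"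
    unfolding br_eq_tderiv
    by (rule bounded_linear.has_vector_derivative[OF linear_conv_bounded_linear[THEN iffD1, OF
        linear_Ad]
        tderiv_curve[OF smooth_map_Ad curve1_lie_exp]])
  then have "((\<lambda>s. Ad c (x * lie_exp A c (s *\<^sub>R X)) Y) has_vector_derivative Ad c x (br X Y)) (at
      0)"
    by (simp add: Ad_mult)
  moreover have "((\<lambda>s. Ad c (x * lie_exp A c (s *\<^sub>R X)) Y)
      has_vector_derivative tderiv (\<lambda>x. Ad c x Y) x X) (at 0)"
    by (rule tderiv_curve[OF smooth_map_Ad curve1_lie_exp])
  ultimately show ?thesis using vector_derivative_unique_at by blast
qed

lemma Ad_curve:
  assumes "curve1 p t X"
  shows "((\<lambda>s. Ad c (p s) Y) has_vector_derivative br X Y) (at t)"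
  using tderiv_curve[OF smooth_map_Ad assms, where x = 1] by (simp add: br_eq_tderiv)

text \<open>Linearity in the first argument is that of a differential. In the second it is inherited
  from the linear maps \<open>Ad c (p s)\<close> by comparing derivatives at 0.\<close>

lemma bilinear_br: "bilinear br"
  unfolding bilinear_def
proof (intro conjI allI)
  show "linear (\<lambda>X. br X Y)" for Y
    unfolding br_eq_tderiv by (rule linear_tderiv[OF smooth_map_Ad])
  show "linear (br X)" for X
  proof (rule linearI)
    let ?p = "\<lambda>s. lie_exp A c (s *\<^sub>R X)"
    fix Y Z and r :: real
    have "((\<lambda>s. Ad c (?p s) Y + Ad c (?p s) Z) has_vector_derivative br X Y + br X Z) (at 0)"
      by (intro has_vector_derivative_add Ad_curve curve1_lie_exp)
    then show "br X (Y + Z) = br X Y + br X Z"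
      using vector_derivative_unique_at[OF Ad_curve[OF curve1_lie_exp, of X "Y + Z"]]
      by (simp add: linear_add[OF linear_Ad])
    have "((\<lambda>s. r *\<^sub>R Ad c (?p s) Y) has_vector_derivative r *\<^sub>R br X Y) (at 0)"
      by (rule bounded_linear.has_vector_derivative[OF bounded_linear_scaleR_right Ad_curve[OF
          curve1_lie_exp]])
    then show "br X (r *\<^sub>R Y) = r *\<^sub>R br X Y"
      using vector_derivative_unique_at[OF Ad_curve[OF curve1_lie_exp, of X "r *\<^sub>R Y"]]
      by (simp add: linear_cmul[OF linear_Ad])
  qed
qed

lemma bounded_bilinear_br: "bounded_bilinear br"
  using bilinear_br by (simp add: bilinear_conv_bounded_bilinear)

lemmas br_simps = bilinear_ladd[OF bilinear_br] bilinear_radd[OF bilinear_br]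
  bilinear_lsub[OF bilinear_br] bilinear_rsub[OF bilinear_br] bilinear_lmul[OF bilinear_br]
  bilinear_rmul[OF bilinear_br] bilinear_lneg[OF bilinear_br] bilinear_rneg[OF bilinear_br]
  bilinear_lzero[OF bilinear_br] bilinear_rzero[OF bilinear_br]

lemma linear_br: "linear (br X)" "linear (\<lambda>X. br X Y)"
  using bilinear_br by (auto simp: bilinear_def)

lemma br_self [simp]: "br X X = 0"
proof -
  have "((\<lambda>s. Ad c (lie_exp A c (s *\<^sub>R X)) X) has_vector_derivative br X X) (at 0)"
    by (rule Ad_curve[OF curve1_lie_exp])
  moreover have "((\<lambda>s::real. X) has_vector_derivative 0) (at 0)" by (rule
      has_vector_derivative_const)
  ultimately show ?thesis unfolding Ad_lie_exp_self by (rule vector_derivative_unique_at)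
qed

lemma br_skew: "br X Y = - br Y X"
proof -
  have "br (X + Y) (X + Y) = 0" by (rule br_self)
  then have "br X Y + br Y X = 0" unfolding bilinear_ladd[OF bilinear_br] by (simp add: br_simps)
  then show ?thesis by (simp add: eq_neg_iff_add_eq_0)
qed

text \<open>Apply \<open>Ad c x\<close> to the curve defining the bracket: it becomes
  \<open>Ad\<close> along the conjugated one-parameter subgroup, whose velocity is
  \<open>Ad c x Y\<close>.\<close>

lemma Ad_br: "Ad c x (br Y Z) = br (Ad c x Y) (Ad c x Z)"
proof -
  let ?p = "\<lambda>s. lie_exp A c (s *\<^sub>R Y)"
  have "((\<lambda>s. Ad c x (Ad c (?p s) Z)) has_vector_derivative Ad c x (br Y Z)) (at 0)"
    by (rule bounded_linear.has_vector_derivative[OF linear_conv_bounded_linear[THEN iffD1, OF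
        linear_Ad]
        Ad_curve[OF curve1_lie_exp]])
  moreover have "Ad c x (Ad c (?p s) Z) = Ad c (x * ?p s * inverse x) (Ad c x Z)" for s
    by (simp add: Ad_mult)
  moreover have "((\<lambda>s. Ad c (x * ?p s * inverse x) (Ad c x Z))
      has_vector_derivative br (Ad c x Y) (Ad c x Z)) (at 0)"
    by (intro Ad_curve curve1_conj curve1_lie_exp)
  ultimately show ?thesis using vector_derivative_unique_at by simp
qed

text \<open>The derivative of \<open>Ad_br\<close> along the one-parameter subgroup of
  \<open>X\<close>.\<close>

lemma Jacobi: "br X (br Y Z) = br (br X Y) Z + br Y (br X Z)"
proof -
  let ?p = "\<lambda>s. lie_exp A c (s *\<^sub>R X)"
  have "((\<lambda>s. br (Ad c (?p s) Y) (Ad c (?p s) Z)) has_vector_derivative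
      br (Ad c (?p 0) Y) (br X Z) + br (br X Y) (Ad c (?p 0) Z)) (at 0)"
    by (intro bounded_bilinear.has_vector_derivative[OF bounded_bilinear_br] Ad_curve
        curve1_lie_exp)
  then have "((\<lambda>s. Ad c (?p s) (br Y Z)) has_vector_derivative br Y (br X Z)
      + br (br X Y) Z) (at 0)"
    by (simp add: Ad_br)
  from vector_derivative_unique_at[OF Ad_curve[OF curve1_lie_exp] this]
  show ?thesis by simp
qed

section \<open>The Killing form\<close>

lemma linear_trace_commute:
  assumes "linear f" "linear (g :: 'e \<Rightarrow> 'e)"
  shows "linear_trace (\<lambda>x. f (g x)) = linear_trace (\<lambda>x. g (f x))"
proof -
  have expand: "f (g b) \<bullet> b = (\<Sum>b'\<in>Basis. (g b \<bullet> b') * (f b' \<bullet> b))" if "linear f" for f g ::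
      "'e \<Rightarrow> 'e" and b
    by (subst linear_expand_Basis[OF that, of "g b"]) (simp add: inner_sum_left)
  have "linear_trace (\<lambda>x. f (g x)) = (\<Sum>b\<in>Basis. \<Sum>b'\<in>Basis. (g b \<bullet> b') * (f b' \<bullet> b))"
    unfolding linear_trace_def by (simp only: expand[OF assms(1)])
  also have "\<dots> = (\<Sum>b'\<in>Basis. \<Sum>b\<in>Basis. (f b' \<bullet> b) * (g b \<bullet> b'))"
    by (subst sum.swap) (simp only: mult.commute)
  also have "\<dots> = linear_trace (\<lambda>x. g (f x))"
    unfolding linear_trace_def by (simp only: expand[OF assms(2)])
  finally show ?thesis .
qed

lemma linear_trace_add: "linear_trace (\<lambda>x. f x + g x) = linear_trace f
    + linear_trace (g :: 'e \<Rightarrow> 'e)"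
  and linear_trace_diff: "linear_trace (\<lambda>x. f x - g x) = linear_trace f
      - linear_trace (g :: 'e \<Rightarrow> 'e)"
  and linear_trace_cmul: "linear_trace (\<lambda>x. r *\<^sub>R f x) = r * linear_trace (f :: 'e \<Rightarrow> 'e)"
  by (simp_all add: linear_trace_def inner_add_left inner_diff_left sum.distrib sum_subtractf
      sum_distrib_left)

lemma linear_br_br: "linear (\<lambda>W. br X (br Y W))"
  using linear_compose[OF linear_br(1)[of Y] linear_br(1)[of X]] by (simp add: o_def)

lemma Kil_sym: "Kil c X Y = Kil c Y X"
  unfolding Kil_def using linear_trace_commute[OF linear_br(1) linear_br(1)] by simp

lemma bilinear_Kil: "bilinear (Kil c)"
proof -
  have l: "linear (\<lambda>X. Kil c X Y)" for Y
    by (rule linearI) (simp_all add: Kil_def br_simps linear_trace_add linear_trace_cmul)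
  have "Kil c X = (\<lambda>Y. Kil c Y X)" for X by (rule ext) (rule Kil_sym)
  then have "linear (Kil c X)" for X using l[of X] by metis
  then show ?thesis using l by (simp add: bilinear_def)
qed

lemma Kil_br: "Kil c (br X Y) Z = Kil c X (br Y Z)"
proof -
  have "br (br X Y) (br Z W) = br X (br Y (br Z W)) - br Y (br X (br Z W))" for W
    using Jacobi[of X Y "br Z W"] by simp
  then have 1: "Kil c (br X Y) Z = - (linear_trace (\<lambda>W. br X (br Y (br Z W)))
      - linear_trace (\<lambda>W. br Y (br X (br Z W))))"
    by (simp add: Kil_def linear_trace_diff)
  have "br X (br (br Y Z) W) = br X (br Y (br Z W)) - br X (br Z (br Y W))" for W
    using Jacobi[of Y Z W] by (simp add: br_simps)
  then have 2: "Kil c X (br Y Z) = - (linear_trace (\<lambda>W. br X (br Y (br Z W)))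
      - linear_trace (\<lambda>W. br X (br Z (br Y W))))"
    by (simp add: Kil_def linear_trace_diff)
  \<comment> \<open>The first traces agree, and the second ones differ by a cyclic permutation of
    the three operators.\<close>
  show ?thesis unfolding 1 2
    using linear_trace_commute[OF linear_br(1)[of Y] linear_br_br[of X Z]] by simp
qed

text \<open>By \<open>Ad_br\<close>, the operator \<open>ad (Ad x X)\<close> is the conjugate of
  \<open>ad X\<close> by \<open>Ad x\<close>, and the trace is invariant under conjugation.\<close>

lemma Kil_Ad: "Kil c (Ad c x X) (Ad c x Y) = Kil c X Y"
proof -
  have "br (Ad c x X) (br (Ad c x Y) W) = Ad c x (br X (br Y (Ad c (inverse x) W)))" for W
    by (simp add: Ad_br)
  then have "Kil c (Ad c x X) (Ad c x Y) = - linear_trace (\<lambda>W. Ad c x (br X (br Y (Ad c (inverse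
      x) W))))"
    by (simp add: Kil_def)
  also have "linear_trace (\<lambda>W. Ad c x (br X (br Y (Ad c (inverse x) W))))
      = linear_trace (\<lambda>W. br X (br Y (Ad c (inverse x) (Ad c x W))))"
  proof (rule linear_trace_commute[OF linear_Ad])
    show "linear (\<lambda>W. br X (br Y (Ad c (inverse x) W)))"
      using linear_compose[OF linear_Ad linear_br_br] by (simp add: o_def)
  qed
  finally show ?thesis by (simp add: Kil_def)
qed

end

locale compact_semisimple = lie_chart +
  assumes compact_group: "compact (UNIV :: 'a set)" and semisimple: "semisimple_lie_algebra c"
begin

section \<open>Positive definiteness of the negative Killing form\<close>

lemma Ad_bounded: obtains M where "\<And>x Y. norm (Ad c x Y) \<le> M * norm Y"
proof -
  have "\<exists>M. \<forall>x. norm (Ad c x b) \<le> M" for b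
  proof -
    have "continuous_on UNIV (\<lambda>x. Ad c x b)" by (rule smooth_mapD(1)[OF smooth_map_Ad])
    then have "bounded (range (\<lambda>x. Ad c x b))"
      by (intro compact_imp_bounded compact_continuous_image compact_group)
    then show ?thesis by (auto simp: bounded_iff)
  qed
  then obtain M where M: "\<And>b x. norm (Ad c x b) \<le> M b" by metis
  have "norm (Ad c x Y) \<le> (\<Sum>b\<in>Basis. M b) * norm Y" for x Y
  proof -
    have "norm (Ad c x Y) = norm (\<Sum>b\<in>Basis. (Y \<bullet> b) *\<^sub>R Ad c x b)"
      using linear_expand_Basis[OF linear_Ad, of x Y] by simp
    also have "\<dots> \<le> (\<Sum>b\<in>Basis. norm ((Y \<bullet> b) *\<^sub>R Ad c x b))" by (rule norm_sum)
    also have "\<dots> \<le> (\<Sum>b\<in>Basis. norm Y * M b)"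
      by (rule sum_mono) (auto intro!: mult_mono M Basis_le_norm)
    finally show ?thesis by (simp add: sum_distrib_left mult.commute)
  qed
  then show ?thesis by (rule that)
qed

lemma
  shows Kil_self_nonneg: "0 \<le> Kil c X X" and Kil_self_zero: "Kil c X X = 0 \<Longrightarrow> br X Y = 0"
proof -
  obtain M where M: "\<And>x Y. norm (Ad c x Y) \<le> M * norm Y" by (rule Ad_bounded) blast
  obtain B where B: "inner_form B" "\<And>Y Z. B (br X Y) Z = - B Y (br X Z)"
  proof (rule bounded_flow_invariant_form[of "\<lambda>t. Ad c (lie_exp A c (t *\<^sub>R X))" "br X" M])
    show "linear (Ad c (lie_exp A c (t *\<^sub>R X)))" for t by (rule linear_Ad)
    show "Ad c (lie_exp A c (- t *\<^sub>R X)) (Ad c (lie_exp A c (t *\<^sub>R X)) Y) = Y" for t Y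
      by (simp only: inverse_lie_exp[symmetric] Ad_inverse)
    show "((\<lambda>s. Ad c (lie_exp A c (s *\<^sub>R X)) Y) has_vector_derivative
        Ad c (lie_exp A c (t *\<^sub>R X)) (br X Y)) (at t)" for t Y
      using tderiv_curve[OF smooth_map_Ad one_param_curve1[OF one_param_lie_exp], where x =
          "lie_exp A c (t *\<^sub>R X)" and t = t and X = X]
      by (simp add: tderiv_Ad group_simps)
    show "norm (Ad c (lie_exp A c (t *\<^sub>R X)) Y) \<le> M * norm Y" for t Y by (rule M)
  qed blast
  interpret B: inner_form B by (rule B(1))
  have K: "Kil c X X = - (\<Sum>b\<in>Basis. br X (br X b) \<bullet> b)" by (simp add: Kil_def linear_trace_def)
  show "0 \<le> Kil c X X"
    using B.trace_skew_square(1)[OF linear_br(1) B(2)] K by simp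
  show "br X Y = 0" if "Kil c X X = 0"
    using B.trace_skew_square(2)[OF linear_br(1) B(2)] K that by simp
qed

text \<open>The centre is an ideal whose derived algebra is already zero, hence a solvable one, and
  semisimplicity applies with \<open>n = 1\<close>.\<close>

lemma centre_trivial:
  assumes "\<And>Y. br X Y = 0"
  shows "X = 0"
proof -
  define I where "I = {X. \<forall>Y. br X Y = 0}"
  have "subspace I" unfolding subspace_def I_def by (simp add: br_simps)
  moreover have "br Y X \<in> I" if "X \<in> I" for X Y
    using that br_skew[of Y X] by (simp add: I_def br_simps)
  ultimately have "lie_ideal c I" by (simp add: lie_ideal_def)
  moreover have "0 \<in> I" by (simp add: I_def br_simps)
  then have "{br X Y | X Y. X \<in> I \<and> Y \<in> I} = {0}" by (fastforce simp: I_def)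
  then have "(derived_algebra c ^^ 1) I = {0}" by (simp add: derived_algebra_def)
  ultimately have "I = {0}" using semisimple unfolding semisimple_lie_algebra_def by blast
  then show ?thesis using assms by (auto simp: I_def)
qed

sublocale Kil: inner_form "Kil c"
proof
  show "bilinear (Kil c)" by (rule bilinear_Kil)
  show "Kil c X Y = Kil c Y X" for X Y by (rule Kil_sym)
  show "0 < Kil c X X" if "X \<noteq> 0" for X
  proof -
    have "Kil c X X \<noteq> 0" using Kil_self_zero[of X] centre_trivial[of X] that by blast
    then show ?thesis using Kil_self_nonneg[of X] by simp
  qed
qed

end

section \<open>The coadjoint orbit\<close>

locale coadjoint_orbit = compact_semisimple +
  fixes \<mu> :: "'b \<Rightarrow> real"
  assumes linear_mu: "linear \<mu>"
begin

abbreviation Z where "Z \<equiv> Zmu c \<mu>"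
abbreviation kk where "kk \<equiv> kalg A c \<mu>"
abbreviation mm where "mm \<equiv> mperp A c \<mu>"
abbreviation P where "P \<equiv> proj_m A c \<mu>"

section \<open>The element \<open>Z\<close>, the stabilizer algebra and its orthogonal
  complement\<close>

lemma mu_eq_Kil: "\<mu> X = Kil c X Z"
proof -
  \<comment> \<open>\<open>L Z\<close> is the Euclidean representative of the functional
    \<open>Kil c _ Z\<close>. Definiteness makes \<open>L\<close> injective, hence surjective, so
    every linear functional has a Killing representative.\<close>
  define L where "L = (\<lambda>Z. \<Sum>b\<in>Basis. Kil c b Z *\<^sub>R b)"
  have L: "L Z \<bullet> X = Kil c X Z" for X Z
    using linear_expand_Basis[OF Kil.linear_left, of X Z]
    unfolding L_def inner_sum_left by (simp add: inner_commute mult.commute)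
  have "linear L"
    unfolding L_def by (rule linearI) (simp_all add: Kil.form_simps scaleR_add_left sum.distrib
        scaleR_sum_right)
  moreover have "inj L"
  proof (rule linear_injective_0[OF \<open>linear L\<close>, THEN iffD2], intro allI impI)
    fix W assume "L W = 0"
    then have "Kil c W W = 0" using L[of W W] by simp
    then show "W = 0" by (rule Kil.eq_zero)
  qed
  ultimately have "surj L" by (rule linear_injective_imp_surjective) simp
  then obtain Z0 where Z0: "L Z0 = (\<Sum>b\<in>Basis. \<mu> b *\<^sub>R b)" by (metis surjD)
  have mu0: "\<mu> X = Kil c X Z0" for X
    unfolding L[symmetric] Z0 inner_sum_left using linear_expand_Basis[OF linear_mu, of X]
    by (simp add: inner_commute mult.commute)
  have "(THE Z. \<forall>X. \<mu> X = Kil c X Z) = Z0"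
  proof (rule the_equality)
    fix W assume W: "\<forall>X. \<mu> X = Kil c X W"
    then have "Kil c (W - Z0) (W - Z0) = 0" using mu0 by (simp add: Kil.form_simps)
    then show "W = Z0" using Kil.eq_zero by force
  qed (use mu0 in blast)
  then show ?thesis using mu0 by (simp add: Zmu_def)
qed

lemma Kil_eqI: "(\<And>X. Kil c X Y = Kil c X W) \<Longrightarrow> Y = W"
  using Kil.eq_zero[of "Y - W"] by (simp add: Kil.form_simps)

lemma Kil_br_skew: "Kil c (br X Y) W = - Kil c Y (br X W)"
  using Kil_br[of Y X W] br_skew[of X Y] by (simp add: Kil.form_simps)

lemma mu_br: "\<mu> (br X Y) = Kil c (br Z X) Y"
proof -
  have "\<mu> (br X Y) = Kil c X (br Y Z)" by (simp add: mu_eq_Kil Kil_br)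
  also have "\<dots> = - Kil c X (br Z Y)" using br_skew[of Y Z] by (simp add: Kil.form_simps)
  finally show ?thesis using Kil_br_skew[of Z X Y] by simp
qed

lemma mem_stab: "s \<in> stab c \<mu> \<longleftrightarrow> (\<forall>X. \<mu> (Ad c (inverse s) X) = \<mu> X)"
  by (auto simp: stab_def coadjoint_def fun_eq_iff)

text \<open>The stabilizer algebra is the centralizer of \<open>Z\<close>: invariance of
  \<open>\<mu>\<close> under the flow of \<open>X\<close> is differentiated in one direction and
  integrated in the other.\<close>

lemma mem_kalg: "X \<in> kk \<longleftrightarrow> br Z X = 0"
proof -
  \<comment> \<open>The minus sign stems from the inverse in the coadjoint action.\<close>
  let ?g = "\<lambda>t. lie_exp A c (t *\<^sub>R (- X))"
  have X: "X \<in> kk \<longleftrightarrow> (\<forall>t Y. \<mu> (Ad c (?g t) Y) = \<mu> Y)"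
    by (simp add: kalg_def subgroup_lie_algebra_def mem_stab inverse_lie_exp)
  \<comment> \<open>The derivative is needed at every time, since the converse deduces constancy
    from it. \<open>X\<close> can be moved past \<open>Ad c (?g t)\<close> because that map fixes
    it.\<close>
  have der: "((\<lambda>s. \<mu> (Ad c (?g s) Y)) has_vector_derivative - \<mu> (br X (Ad c (?g t) Y))) (at t)"
      for t Y
  proof -
    have "((\<lambda>s. Ad c (?g t * (inverse (?g t) * ?g s)) Y)
        has_vector_derivative Ad c (?g t) (br (- X) Y)) (at t)"
      unfolding tderiv_Ad[symmetric]
      by (rule tderiv_curve[OF smooth_map_Ad one_param_curve1[OF one_param_lie_exp]])
    then have "((\<lambda>s. Ad c (?g s) Y) has_vector_derivative br (- X) (Ad c (?g t) Y)) (at t)"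
      by (simp only: group_simps Ad_br Ad_lie_exp_self)
    from bounded_linear.has_vector_derivative[OF linear_conv_bounded_linear[THEN iffD1, OF
        linear_mu] this]
    show ?thesis by (simp add: br_simps linear_neg[OF linear_mu])
  qed
  show ?thesis
  proof
    assume "X \<in> kk"
    then have const: "\<mu> (Ad c (?g t) Y) = \<mu> Y" for t Y using X by blast
    have "\<mu> (br X Y) = 0" for Y
      using vector_derivative_unique_at[OF der[of Y 0, unfolded const]
          has_vector_derivative_const] by simp
    then have "Kil c (br Z X) (br Z X) = 0" by (simp add: mu_br)
    then show "br Z X = 0" by (rule Kil.eq_zero)
  next
    assume "br Z X = 0"
    then have "((\<lambda>s. \<mu> (Ad c (?g s) Y)) has_vector_derivative 0) (at t within UNIV)" for t Y
      using der[of Y t] by (simp add: mu_br Kil.form_simps)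
    then obtain k where k: "\<And>Y s. \<mu> (Ad c (?g s) Y) = k Y"
      using has_vector_derivative_zero_constant[OF convex_UNIV] by (metis UNIV_I)
    have "\<mu> (Ad c (?g t) Y) = \<mu> Y" for t Y using k[of t Y] k[of 0 Y] by simp
    then show "X \<in> kk" using X by blast
  qed
qed

lemma subspace_kalg: "subspace kk"
  by (auto simp: subspace_def mem_kalg br_simps)

lemma subspace_mperp: "subspace mm"
  by (auto simp: subspace_def mperp_def Kil.form_simps)

lemma mem_mperp: "X \<in> mm \<Longrightarrow> Y \<in> kk \<Longrightarrow> Kil c X Y = 0"
  by (simp add: mperp_def)

lemma kalg_mperp: "X \<in> kk \<Longrightarrow> X \<in> mm \<Longrightarrow> X = 0"
  using mem_mperp Kil.eq_zero by blast

text \<open>Subtracting the Killing-orthogonal projection onto \<open>kk\<close> gives existence;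
  \<open>kk\<close> and \<open>mm\<close> meet only in 0, which settles the definite description in
  \<open>proj_m\<close>.\<close>

lemma
  shows proj_in: "P X \<in> mm" and proj_diff: "X - P X \<in> kk"
    and proj_unique: "Y \<in> mm \<Longrightarrow> X - Y \<in> kk \<Longrightarrow> P X = Y"
proof -
  have uniq: "Y = Y'" if "Y \<in> mm" "X - Y \<in> kk" "Y' \<in> mm" "X - Y' \<in> kk" for Y Y'
  proof -
    have "(X - Y') - (X - Y) \<in> kk" by (rule subspace_diff[OF subspace_kalg that(4,2)])
    then have "Y - Y' = 0" by (intro kalg_mperp subspace_diff[OF subspace_mperp] that) simp
    then show ?thesis by simp
  qed
  obtain W where W: "W \<in> kk" "\<And>Y. Y \<in> kk \<Longrightarrow> Kil c (X - W) Y = 0"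
    using Kil.orthogonal_projection[OF subspace_kalg] by metis
  have XW: "X - W \<in> mm \<and> X - (X - W) \<in> kk" using W by (simp add: mperp_def)
  have "P X = X - W"
    unfolding proj_m_def by (rule the_equality) (use uniq XW in blast)+
  with XW show "P X \<in> mm" "X - P X \<in> kk" by auto
  with uniq show "Y \<in> mm \<Longrightarrow> X - Y \<in> kk \<Longrightarrow> P X = Y" by blast
qed

lemma proj_id: "X \<in> mm \<Longrightarrow> P X = X"
  by (rule proj_unique) (simp_all add: subspace_0[OF subspace_kalg])

lemma proj_kalg: "X \<in> kk \<Longrightarrow> P X = 0"
  by (rule proj_unique) (simp_all add: subspace_0[OF subspace_mperp])

lemma linear_proj: "linear P"
proof (rule linearI)
  fix X Y and r :: real
  have "(X - P X) + (Y - P Y) \<in> kk" by (intro subspace_add[OF subspace_kalg] proj_diff)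
  then show "P (X + Y) = P X + P Y"
    by (intro proj_unique subspace_add[OF subspace_mperp] proj_in) (simp add: algebra_simps)
  have "r *\<^sub>R (X - P X) \<in> kk" by (intro subspace_scale[OF subspace_kalg] proj_diff)
  then show "P (r *\<^sub>R X) = r *\<^sub>R P X"
    by (intro proj_unique subspace_scale[OF subspace_mperp] proj_in) (simp add: scaleR_diff_right)
qed

lemma Kil_proj: "U \<in> mm \<Longrightarrow> Kil c (P X) U = Kil c X U"
  using mem_mperp[OF _ proj_diff, of U X] Kil_sym[of U "X - P X"] by (simp add: Kil.form_simps)

lemma br_Z_in: "br Z X \<in> mm"
  unfolding mperp_def by (auto simp: Kil_br_skew mem_kalg Kil.form_simps)

lemma br_Z_proj: "br Z (P X) = br Z X"
  using proj_diff[of X] by (simp add: mem_kalg br_simps)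

lemma Gam_eq:
  assumes "X \<in> mm"
  shows "Gam A c \<mu> X = br Z X"
  unfolding Gam_def
proof (rule the_equality)
  show "br Z X \<in> mm \<and> (\<forall>Y\<in>mm. \<mu> (br X Y) = Kil c (br Z X) Y)"
    by (simp add: br_Z_in mu_br)
  fix W assume W: "W \<in> mm \<and> (\<forall>Y\<in>mm. \<mu> (br X Y) = Kil c W Y)"
  then have "W - br Z X \<in> mm" by (intro subspace_diff[OF subspace_mperp] br_Z_in) simp
  with W have "Kil c (W - br Z X) (W - br Z X) = 0"
    by (simp add: mu_br Kil.form_simps(3))
  then show "W = br Z X" using Kil.eq_zero by force
qed

lemma stab_inverse: "s \<in> stab c \<mu> \<Longrightarrow> inverse s \<in> stab c \<mu>"
  unfolding mem_stab by (metis Ad_inverse(2) group_inverse_inverse)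

lemma Ad_stab_Z:
  assumes "s \<in> stab c \<mu>"
  shows "Ad c s Z = Z"
proof (rule Kil_eqI)
  fix X
  have "Kil c X (Ad c s Z) = Kil c (Ad c (inverse s) X) Z"
    using Kil_Ad[of s "Ad c (inverse s) X" Z] by simp
  then show "Kil c X (Ad c s Z) = Kil c X Z"
    using assms by (simp add: mem_stab mu_eq_Kil)
qed

lemma Ad_stab_kalg: "s \<in> stab c \<mu> \<Longrightarrow> X \<in> kk \<Longrightarrow> Ad c s X \<in> kk"
  using Ad_br[of s Z X] by (simp add: mem_kalg Ad_stab_Z linear_0[OF linear_Ad])

lemma Ad_stab_mperp:
  assumes "s \<in> stab c \<mu>" "X \<in> mm"
  shows "Ad c s X \<in> mm"
  unfolding mperp_def
proof (intro CollectI ballI)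
  fix Y assume "Y \<in> kk"
  then have "Kil c X (Ad c (inverse s) Y) = 0"
    using assms by (intro mem_mperp Ad_stab_kalg stab_inverse)
  then show "Kil c (Ad c s X) Y = 0"
    using Kil_Ad[of s X "Ad c (inverse s) Y"] by simp
qed

lemma proj_Ad_stab:
  assumes "s \<in> stab c \<mu>"
  shows "P (Ad c s X) = Ad c s (P X)"
  by (rule proj_unique)
    (use assms in \<open>auto simp: linear_diff[OF linear_Ad, symmetric] intro: Ad_stab_mperp
        Ad_stab_kalg proj_in proj_diff\<close>)

text \<open>Permits evaluating weights, and the equations that define the weight spaces, at
  \<open>Z\<close>.\<close>

lemma Z_in_talg: "Z \<in> talg A c \<mu>"
  unfolding talg_def subgroup_lie_algebra_def torus_def using closure_subset by fast

end

locale polar_orbit = coadjoint_orbit +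
  fixes S J :: "'b \<Rightarrow> 'b"
  assumes polar: "polar_decomposition_on mm (Kil c) (Gam A c \<mu>) S J"
begin

abbreviation gg where "gg \<equiv> orbit_metric c \<mu> J"

section \<open>The polar decomposition on \<open>mm\<close> and eigenvectors of the square of
  \<open>ad Z\<close>\<close>

lemma
  shows S_in: "X \<in> mm \<Longrightarrow> S X \<in> mm"
    and S_sym: "X \<in> mm \<Longrightarrow> Y \<in> mm \<Longrightarrow> Kil c (S X) Y = Kil c X (S Y)"
    and S_nonneg: "X \<in> mm \<Longrightarrow> 0 \<le> Kil c (S X) X"
    and S_scale: "X \<in> mm \<Longrightarrow> S (r *\<^sub>R X) = r *\<^sub>R S X"
    and S_add: "X \<in> mm \<Longrightarrow> Y \<in> mm \<Longrightarrow> S (X + Y) = S X + S Y"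
    and J_scale: "X \<in> mm \<Longrightarrow> J (r *\<^sub>R X) = r *\<^sub>R J X"
    and J_add: "X \<in> mm \<Longrightarrow> Y \<in> mm \<Longrightarrow> J (X + Y) = J X + J Y"
    and J_in: "X \<in> mm \<Longrightarrow> J X \<in> mm"
    and J_isometry: "X \<in> mm \<Longrightarrow> Y \<in> mm \<Longrightarrow> Kil c (J X) (J Y) = Kil c X Y"
    and J_surj: "X \<in> mm \<Longrightarrow> \<exists>Y\<in>mm. X = J Y"
    and SJ: "X \<in> mm \<Longrightarrow> S (J X) = br Z X"
  using polar unfolding polar_decomposition_on_def linear_on_subspace_def
  by (auto simp: image_subset_iff Gam_eq)

lemmas m_diff = subspace_diff[OF subspace_mperp]
lemmas m_scale = subspace_scale[OF subspace_mperp]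
lemmas m_add = subspace_add[OF subspace_mperp]
lemmas m_zero = subspace_0[OF subspace_mperp]
lemmas m_neg = subspace_neg[OF subspace_mperp]

lemma mperp_eqI:
  assumes "X \<in> mm" "Y \<in> mm" "\<And>V. V \<in> mm \<Longrightarrow> Kil c X V = Kil c Y V"
  shows "X = Y"
proof -
  have "Kil c (X - Y) (X - Y) = 0"
    using assms(3)[OF m_diff[OF assms(1,2)]] by (simp add: Kil.form_simps(3))
  then show ?thesis using Kil.eq_zero by force
qed

lemma J_inj:
  assumes "X \<in> mm" "Y \<in> mm" "J X = J Y"
  shows "X = Y"
  by (rule mperp_eqI[OF assms(1,2)]) (metis J_isometry assms)

text \<open>Skewness of \<open>ad Z = S J\<close>: its transpose is the inverse of \<open>J\<close>
  followed after \<open>S\<close>, and it equals \<open>- S J\<close>; applying \<open>J\<close>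
  gives the claim.\<close>

lemma JSJ:
  assumes X: "X \<in> mm"
  shows "J (S (J X)) = - S X"
proof (rule mperp_eqI)
  fix V assume V: "V \<in> mm"
  obtain V' where V': "V' \<in> mm" "V = J V'" using J_surj[OF V] by blast
  have "Kil c (J (S (J X))) V = Kil c (br Z X) V'"
    using X V' by (simp add: J_isometry J_in S_in SJ br_Z_in)
  also have "\<dots> = - Kil c X (S (J V'))" using V' by (simp add: Kil_br_skew SJ)
  also have "\<dots> = Kil c (- S X) V" using X V V' by (simp add: S_sym Kil.form_simps)
  finally show "Kil c (J (S (J X))) V = Kil c (- S X) V" .
qed (use X in \<open>auto intro: J_in S_in m_neg\<close>)

text \<open>Two applications of \<open>JSJ\<close>. Commutation with the square of \<open>S\<close>
  is purely algebraic; on eigenvectors \<open>S_square_root\<close> then brings it down to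
  \<open>S\<close>.\<close>

lemma JSS:
  assumes X: "X \<in> mm"
  shows "J (S (S X)) = S (S (J X))"
proof -
  obtain U where U: "U \<in> mm" "S X = J U" using J_surj[OF S_in[OF X]] by blast
  have "J (S (J X)) = J (- U)" using JSJ[OF X] U J_scale[of U "-1"] by simp
  then have SJX: "S (J X) = - U" by (rule J_inj[rotated 2]) (use X U in \<open>auto intro: J_in S_in
      m_neg\<close>)
  have "S (- U) = - S U" using S_scale[OF U(1), of "-1"] by simp
  then show ?thesis using JSJ[OF U(1)] U(2) SJX by simp
qed

lemma br_Z_br_Z: "X \<in> mm \<Longrightarrow> br Z (br Z X) = - S (S X)"
proof -
  assume X: "X \<in> mm"
  have "br Z (br Z X) = S (J (S (J X)))" using X by (simp add: SJ br_Z_in)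
  also have "\<dots> = S (- S X)" by (simp add: JSJ X)
  finally show ?thesis using S_scale[OF S_in[OF X], of "-1"] by simp
qed

text \<open>Uniqueness of the nonnegative square root, on a single vector:
  \<open>W = S X - l X\<close> satisfies \<open>S W = - l W\<close>, which nonnegativity of
  \<open>S\<close> allows only for \<open>W = 0\<close>.\<close>

lemma S_square_root:
  assumes "X \<in> mm" "S (S X) = (l * l) *\<^sub>R X" "0 < l"
  shows "S X = l *\<^sub>R X"
proof -
  define W where "W = S X + (- l) *\<^sub>R X"
  have W: "W \<in> mm" unfolding W_def by (intro m_add m_scale S_in assms(1))
  have "S W = S (S X) + (- l) *\<^sub>R S X"
    unfolding W_def using assms(1) by (simp only: S_add S_scale S_in m_scale)
  then have "S W = (- l) *\<^sub>R W"
    by (simp add: W_def assms(2) scaleR_diff_right)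
  then have "0 \<le> - (l * Kil c W W)" using S_nonneg[OF W] by (simp add: Kil.form_simps)
  then have "Kil c W W \<le> 0" using assms(3) by (simp add: mult_le_0_iff)
  then have "W = 0" using Kil.pos[of W] by fastforce
  then show ?thesis by (simp add: W_def)
qed

text \<open>Converts information on the square of \<open>ad Z\<close> into information on
  \<open>S\<close>, \<open>J\<close> and \<open>ad Z\<close> themselves. It serves for weight
  vectors and equally for \<open>E\<close> and \<open>P F\<close>, which need not be weight
  vectors.\<close>

lemma br_Z_eigen:
  assumes X: "X \<in> mm" and eig: "br Z (br Z X) = - ((l * l) *\<^sub>R X)" and l: "0 < l"
  shows "S X = l *\<^sub>R X" and "br Z X = l *\<^sub>R J X" and "J (J X) = - X"
proof -
  have SS: "S (S X) = (l * l) *\<^sub>R X" using br_Z_br_Z[OF X] eig by simp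
  show 1: "S X = l *\<^sub>R X" by (rule S_square_root[OF X SS l])
  have "S (S (J X)) = (l * l) *\<^sub>R J X" using JSS[OF X] SS X by (simp add: J_scale)
  then have 2: "S (J X) = l *\<^sub>R J X" by (intro S_square_root J_in X l)
  then show "br Z X = l *\<^sub>R J X" using SJ[OF X] by simp
  have "l *\<^sub>R J (J X) = l *\<^sub>R (- X)" using JSJ[OF X] 1 2 X by (simp add: J_scale J_in)
  then show "J (J X) = - X" using l scaleR_left_imp_eq[of l] by (metis less_irrefl)
qed

text \<open>The weight equation makes \<open>J X\<close> an eigenvector of \<open>S\<close>;
  \<open>JSS\<close> and injectivity of \<open>J\<close> transfer the squared eigenvalue to
  \<open>X\<close>. The sign of \<open>\<alpha> Z\<close> does not enter.\<close>

lemma weight_space_eigen: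
  assumes X: "X \<in> weight_space A c \<mu> J \<alpha>"
  shows "X \<in> mm" and "br Z (br Z X) = - ((\<alpha> Z * \<alpha> Z) *\<^sub>R X)"
proof -
  show m: "X \<in> mm" using X by (simp add: weight_space_def)
  have SJX: "S (J X) = \<alpha> Z *\<^sub>R J X"
    using X Z_in_talg SJ[OF m] by (simp add: weight_space_def)
  then have "J (S (S X)) = J ((\<alpha> Z * \<alpha> Z) *\<^sub>R X)" using JSS[OF m] m by (simp add: S_scale J_scale
      J_in)
  then have "S (S X) = (\<alpha> Z * \<alpha> Z) *\<^sub>R X"
    by (rule J_inj[rotated 2]) (auto intro: S_in m m_scale)
  then show "br Z (br Z X) = - ((\<alpha> Z * \<alpha> Z) *\<^sub>R X)" using br_Z_br_Z[OF m] by simp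
qed

text \<open>\<open>\<alpha> Z\<close> is the eigenvalue of the nonnegative \<open>S\<close> at
  \<open>J X\<close>, and it cannot vanish because \<open>X\<close> would then lie in
  \<open>kk\<close> and in \<open>mm\<close>. Hence the denominator
  \<open>\<alpha> Z + \<beta> Z\<close> is positive.\<close>

lemma weight_pos:
  assumes "\<alpha> \<in> weights A c \<mu> J"
  shows "0 < \<alpha> Z"
proof -
  have "0 \<in> weight_space A c \<mu> J \<alpha>"
    using J_scale[OF m_zero, of 0] by (simp add: weight_space_def m_zero br_simps)
  then obtain X where X: "X \<in> weight_space A c \<mu> J \<alpha>" "X \<noteq> 0"
    using assms by (auto simp: weights_def)
  have m: "X \<in> mm" using X by (simp add: weight_space_def)
  have brX: "br Z X = \<alpha> Z *\<^sub>R J X" using X Z_in_talg by (simp add: weight_space_def)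
  have "0 < Kil c (J X) (J X)" using Kil.pos[OF X(2)] m by (simp add: J_isometry)
  moreover have "0 \<le> Kil c (S (J X)) (J X)" by (intro S_nonneg J_in m)
  ultimately have "0 \<le> \<alpha> Z" by (simp add: SJ m brX Kil.form_simps zero_le_mult_iff)
  moreover have "br Z X \<noteq> 0" using kalg_mperp[OF _ m] X(2) by (auto simp: mem_kalg)
  then have "\<alpha> Z \<noteq> 0" using brX by auto
  ultimately show ?thesis by simp
qed

section \<open>The metric on \<open>mm\<close> and the pointwise Koszul equation\<close>

lemma metric_eq: "gg X Y = Kil c (br Z X) (J Y)"
  by (simp add: orbit_metric_def mu_br)

lemma metric_sym: "X \<in> mm \<Longrightarrow> Y \<in> mm \<Longrightarrow> gg X Y = gg Y X"
  using SJ[of X] SJ[of Y] S_sym[of "J X" "J Y"] Kil_sym[of "J X" "S (J Y)"]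
  by (simp add: metric_eq J_in)

lemma metric_proj: "gg (P X) Y = gg X Y"
  by (simp add: metric_eq br_Z_proj)

lemma metric_left: "gg (X + X') Y = gg X Y + gg X' Y" "gg (X - X') Y = gg X Y - gg X' Y"
  "gg (r *\<^sub>R X) Y = r * gg X Y"
  by (simp_all add: metric_eq br_simps Kil.form_simps)

text \<open>Since \<open>J\<close> maps onto \<open>mm\<close>, some \<open>U\<close> has
  \<open>J U = br Z X\<close>, and testing against it gives the Killing norm of
  \<open>br Z X\<close>.\<close>

lemma metric_nondegenerate:
  assumes X: "X \<in> mm" and 0: "\<And>U. U \<in> mm \<Longrightarrow> gg X U = 0"
  shows "X = 0"
proof -
  obtain U where "U \<in> mm" "br Z X = J U" using J_surj[OF br_Z_in] by metis
  then have "Kil c (br Z X) (br Z X) = 0" using 0[of U] by (simp add: metric_eq)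
  then show ?thesis using Kil.eq_zero kalg_mperp[OF _ X] by (auto simp: mem_kalg)
qed

lemma metric_eigen:
  assumes "X \<in> mm" "br Z (br Z X) = - ((l * l) *\<^sub>R X)" "0 < l" "U \<in> mm"
  shows "gg X U = l * Kil c X U"
  using br_Z_eigen(2)[OF assms(1-3)] assms by (simp add: metric_eq Kil.form_simps J_isometry)

text \<open>Pure linear algebra at one point. The metric is nondegenerate, so the candidate only has
  to be paired with every \<open>U\<close> in \<open>mm\<close>; invariance of the Killing form
  moves \<open>U\<close> out of the brackets.\<close>

lemma Koszul_weight_solution:
  assumes X: "X \<in> weight_space A c \<mu> J \<alpha>" and Y: "Y \<in> weight_space A c \<mu> J \<beta>"
    and a: "0 < \<alpha> Z" and b: "0 < \<beta> Z" and D: "D \<in> mm"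
    and Koszul: "\<And>U. U \<in> mm \<Longrightarrow>
      2 * gg D U = gg (P (br X Y)) U - gg (P (br Y U)) X + gg (P (br U X)) Y"
  shows "D = (1 / 4) *\<^sub>R ((2 * \<beta> Z * inverse (\<alpha> Z + \<beta> Z)) *\<^sub>R (br X Y - br (J X) (J Y)) +
    (1 + sgn (\<beta> Z - \<alpha> Z)) *\<^sub>R P (br X Y + br (J X) (J Y)))"
proof -
  define a where "a = \<alpha> Z"
  define b where "b = \<beta> Z"
  have ab: "0 < a" "0 < b" using assms by (auto simp: a_def b_def)
  note Xm = weight_space_eigen[OF X, folded a_def] and Ym = weight_space_eigen[OF Y, folded b_def]
  note Xe = br_Z_eigen[OF Xm ab(1)] and Ye = br_Z_eigen[OF Ym ab(2)]
  have ZJ: "br Z (J X) = - (a *\<^sub>R X)" "br Z (J Y) = - (b *\<^sub>R Y)"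
    using SJ[OF J_in[OF Xm(1)]] SJ[OF J_in[OF Ym(1)]] Xe Ye Xm Ym S_scale[of X "-1"] S_scale[of Y
        "-1"] by auto
  define E where "E = br X Y - br (J X) (J Y)"
  define F where "F = br X Y + br (J X) (J Y)"
  have ZE: "br Z E = (a + b) *\<^sub>R (br (J X) Y + br X (J Y))"
    unfolding E_def by (simp add: br_simps Jacobi[of Z] Xe Ye ZJ algebra_simps)
  have ZZE: "br Z (br Z E) = - (((a + b) * (a + b)) *\<^sub>R E)"
  proof -
    have "br Z (br (J X) Y + br X (J Y)) = - ((a + b) *\<^sub>R E)"
      unfolding E_def by (simp add: br_simps Jacobi[of Z] Xe Ye ZJ algebra_simps)
    then show ?thesis by (simp add: ZE bilinear_rmul[OF bilinear_br])
  qed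
  have ZF: "br Z F = (a - b) *\<^sub>R (br (J X) Y - br X (J Y))"
    unfolding F_def by (simp add: br_simps Jacobi[of Z] Xe Ye ZJ algebra_simps)
  have ZZF: "br Z (br Z F) = - (((a - b) * (a - b)) *\<^sub>R F)"
  proof -
    have "br Z (br (J X) Y - br X (J Y)) = - ((a - b) *\<^sub>R F)"
      unfolding F_def by (simp add: br_simps Jacobi[of Z] Xe Ye ZJ algebra_simps)
    then show ?thesis by (simp add: ZF bilinear_rmul[OF bilinear_br])
  qed
  have Em: "E \<in> mm"
  proof -
    define k where "k = (a + b) * (a + b)"
    \<comment> \<open>\<open>E\<close> is a nonzero multiple of a vector in the range of
      \<open>ad Z\<close>, which lies in \<open>mm\<close>. For \<open>F\<close> the factor
      \<open>a - b\<close> may vanish, so there the projection stays.\<close>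
    have "(- inverse k) *\<^sub>R br Z (br Z E) \<in> mm" by (intro m_scale br_Z_in)
    moreover have "k \<noteq> 0" using ab by (simp add: k_def)
    ultimately show ?thesis unfolding ZZE k_def[symmetric] by simp
  qed
  have gE: "gg E U = (a + b) * Kil c E U" if "U \<in> mm" for U
    using ab by (intro metric_eigen Em ZZE that) simp
  \<comment> \<open>Multiplying by the sign replaces the eigenvalue, the absolute value of
    \<open>b - a\<close>, by \<open>b - a\<close> itself and covers \<open>a = b\<close>, where both
    sides are 0.\<close>
  have gF: "sgn (b - a) * gg (P F) U = (b - a) * Kil c F U" if U: "U \<in> mm" for U
  proof (cases "a = b")
    case False
    have "br Z (br Z (P F)) = P (br Z (br Z F))" by (simp add: br_Z_proj proj_id br_Z_in)
    also have "\<dots> = - ((\<bar>b - a\<bar> * \<bar>b - a\<bar>) *\<^sub>R P F)"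
    proof -
      have "(a - b) * (a - b) = \<bar>b - a\<bar> * \<bar>b - a\<bar>" by (simp add: algebra_simps)
      then show ?thesis unfolding ZZF by (simp only: linear_neg[OF linear_proj] linear_cmul[OF
          linear_proj])
    qed
    finally have "gg (P F) U = \<bar>b - a\<bar> * Kil c (P F) U"
      using False by (intro metric_eigen proj_in U) auto
    then show ?thesis by (simp add: Kil_proj U sgn_real_def abs_if)
  qed simp
  have brXY: "br X Y = (1 / 2) *\<^sub>R (E + F)"
    by (simp add: E_def F_def scaleR_2[symmetric])
  define D' where "D' = (1 / 4) *\<^sub>R ((2 * b * inverse (a + b)) *\<^sub>R E + (1 + sgn (b - a)) *\<^sub>R P F)"
  have "gg (D - D') U = 0" if U: "U \<in> mm" for U
  proof -
    \<comment> \<open>On the weight vector \<open>X\<close> the metric is \<open>a\<close> times the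
      Killing form, whose invariance then turns \<open>[Y, U]\<close> against \<open>X\<close> into
      \<open>[X, Y]\<close> against \<open>U\<close>.\<close>
    have 1: "gg (P (br Y U)) X = a * Kil c (br X Y) U"
    proof -
      have "gg (P (br Y U)) X = a * Kil c X (P (br Y U))"
        using metric_sym[OF proj_in Xm(1)] metric_eigen[OF Xm ab(1) proj_in] by simp
      also have "Kil c X (P (br Y U)) = Kil c (br X Y) U"
        using Kil_proj[OF Xm(1), of "br Y U"] Kil_br[of X Y U] Kil_sym[of X "P (br Y U)"]
            Kil_sym[of X "br Y U"] by simp
      finally show ?thesis .
    qed
    have 2: "gg (P (br U X)) Y = b * Kil c (br X Y) U"
    proof -
      have "gg (P (br U X)) Y = b * Kil c Y (P (br U X))"
        using metric_sym[OF proj_in Ym(1)] metric_eigen[OF Ym ab(2) proj_in] by simp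
      also have "Kil c Y (P (br U X)) = Kil c (br X Y) U"
        using Kil_proj[OF Ym(1), of "br U X"] Kil_br[of U X Y] Kil_sym[of Y "P (br U X)"]
            Kil_sym[of U "br X Y"] by simp
      finally show ?thesis .
    qed
    have "2 * gg D U = gg (br X Y) U + (b - a) * Kil c (br X Y) U"
      using Koszul[OF U] 1 2 by (simp add: metric_proj algebra_simps)
    also have "\<dots> = (1 / 2) * (gg E U + gg (P F) U + (b - a) * Kil c E U + sgn (b - a) * gg (P F) U)"
      unfolding brXY by (simp add: metric_left metric_proj Kil.form_simps gF[OF U, unfolded
          metric_proj] gE[OF U] field_simps)
    finally have "gg D U = (1 / 4) * (gg E U + (b - a) * Kil c E U + (1 + sgn (b
        - a)) * gg (P F) U)"
      by (simp add: algebra_simps)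
    \<comment> \<open>By \<open>gE\<close> the Killing form of \<open>E\<close> is the metric
      divided by \<open>a + b\<close>, and
      \<open>1 + (b - a) / (a + b) = 2 * b / (a + b)\<close>.\<close>
    also have "gg E U + (b - a) * Kil c E U = (2 * b * inverse (a + b)) * gg E U"
      using ab by (simp add: gE[OF U] field_simps)
    finally show ?thesis by (simp add: D'_def metric_left algebra_simps)
  qed
  moreover have "D' \<in> mm" unfolding D'_def by (intro m_scale m_add Em proj_in)
  ultimately have "D - D' = 0" by (intro metric_nondegenerate m_diff D)
  then show ?thesis by (simp add: D'_def a_def b_def E_def F_def)
qed

end

section \<open>Vector fields and the Levi-Civita connection\<close>

context polar_orbit
begin

abbreviation fields where "fields \<equiv> vector_fields A c \<mu>"

lemma fieldD:
  assumes "V \<in> fields"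
  shows "smooth_map A euclid_atlas V" "V x \<in> mm"
  using assms by (auto simp: vector_fields_def)

lemma smooth_map_Ad_inverse: "smooth_map A euclid_atlas (\<lambda>x. Ad c (inverse x) Y)"
proof (rule smooth_map_compose[OF atlas atlas smooth_atlas_euclid _ smooth_map_Ad])
  show "smooth_map A A (\<lambda>x. inverse x)" by (intro smooth_AI)
qed

lemma Ad_inverse_curve:
  "((\<lambda>t. Ad c (inverse (x * lie_exp A c (t *\<^sub>R X))) Y) has_vector_derivative
      - br X (Ad c (inverse x) Y)) (at 0)"
proof -
  have "((\<lambda>t. Ad c (lie_exp A c (t *\<^sub>R (- X))) (Ad c (inverse x) Y))
      has_vector_derivative br (- X) (Ad c (inverse x) Y)) (at 0)"
    by (rule Ad_curve[OF curve1_lie_exp])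
  then show ?thesis by (simp add: group_inverse_mult inverse_lie_exp Ad_mult br_simps)
qed

lemma field_curve:
  assumes "W \<in> fields"
  shows "((\<lambda>t. W (x * lie_exp A c (t *\<^sub>R X))) has_vector_derivative tderiv W x X) (at 0)"
  by (rule tderiv_curve[OF fieldD(1)[OF assms] curve1_lie_exp])

text \<open>Differentiate \<open>P (W y) = W y\<close>: a curve in a subspace has its velocity
  there.\<close>

lemma field_tderiv_in:
  assumes "W \<in> fields"
  shows "tderiv W x X \<in> mm"
proof -
  have "((\<lambda>t. P (W (x * lie_exp A c (t *\<^sub>R X)))) has_vector_derivative P (tderiv W x X)) (at 0)"
    by (rule bounded_linear.has_vector_derivative[OF linear_conv_bounded_linear[THEN iffD1, OF
        linear_proj] field_curve[OF assms]])
  then have "((\<lambda>t. W (x * lie_exp A c (t *\<^sub>R X))) has_vector_derivative P (tderiv W x X)) (at 0)"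
    by (simp add: proj_id fieldD(2)[OF assms])
  from vector_derivative_unique_at[OF field_curve[OF assms] this] show ?thesis
    using proj_in by metis
qed

text \<open>The differentials of these functions separate the tangent vectors of the orbit.\<close>

definition orbit_coord :: "'b \<Rightarrow> 'a \<Rightarrow> real" where
  "orbit_coord Y x = \<mu> (Ad c (inverse x) Y)"

lemma orbit_coord_orbit_function: "orbit_coord Y \<in> orbit_functions A c \<mu>"
proof -
  have "smooth_map A euclid_atlas (orbit_coord Y)"
    unfolding orbit_coord_def[abs_def] by (rule smooth_map_linear_comp[OF atlas
        smooth_map_Ad_inverse linear_mu])
  moreover have "orbit_coord Y (x * s) = orbit_coord Y x" if "s \<in> stab c \<mu>" for x s
    using that by (simp add: orbit_coord_def group_inverse_mult Ad_mult mem_stab)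
  ultimately show ?thesis by (simp add: orbit_functions_def)
qed

lemma deriv_along_orbit_coord:
  "deriv_along A c V (orbit_coord Y) = (\<lambda>x. - \<mu> (br (V x) (Ad c (inverse x) Y)))"
proof
  fix x
  show "deriv_along A c V (orbit_coord Y) x = - \<mu> (br (V x) (Ad c (inverse x) Y))"
    unfolding deriv_along_def orbit_coord_def
    using bounded_linear.has_vector_derivative[OF linear_conv_bounded_linear[THEN iffD1, OF
        linear_mu] Ad_inverse_curve, of x "V x" Y]
    by (intro vector_derivative_at) (simp add: linear_neg[OF linear_mu])
qed

lemma deriv_along_orbit_coord2:
  assumes "W \<in> fields"
  shows "deriv_along A c V (deriv_along A c W (orbit_coord Y)) x =
    - \<mu> (br (tderiv W x (V x)) (Ad c (inverse x) Y)) + \<mu> (br (W x) (br (V x) (Ad c (inverse x) Y)))"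
proof -
  let ?y = "\<lambda>t. x * lie_exp A c (t *\<^sub>R V x)"
  have "((\<lambda>t. br (W (?y t)) (Ad c (inverse (?y t)) Y)) has_vector_derivative
      br (W (?y 0)) (- br (V x) (Ad c (inverse x) Y)) + br (tderiv W x (V x)) (Ad c (inverse (?y
          0)) Y)) (at 0)"
    by (intro bounded_bilinear.has_vector_derivative[OF bounded_bilinear_br] field_curve[OF assms]
        Ad_inverse_curve)
  from has_vector_derivative_minus[OF bounded_linear.has_vector_derivative[OF
      linear_conv_bounded_linear[THEN iffD1, OF linear_mu] this]]
  show ?thesis unfolding deriv_along_orbit_coord
    unfolding deriv_along_def
    by (intro vector_derivative_at) (simp add: linear_add[OF linear_mu] linear_neg[OF linear_mu]
        linear_diff[OF linear_mu] br_simps)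
qed

text \<open>On coordinate functions the second-order terms of the commutator combine by the Jacobi
  identity into the bracket \<open>br (V x) (W x)\<close>. Torsion-freeness thus makes
  \<open>Q\<close> pair to zero under \<open>\<mu> (br Q B)\<close> for all \<open>B\<close>, so
  \<open>Q\<close> lies in \<open>kk\<close>, and \<open>P\<close> removes it.\<close>

lemma torsion_free_difference:
  assumes conn: "connection A c \<mu> nabla" and tf: "torsion_free A c \<mu> nabla"
    and V: "V \<in> fields" and W: "W \<in> fields"
  shows "(nabla V W x - tderiv W x (V x)) - (nabla W V x - tderiv V x (W x)) = P (br (V x) (W x))"
proof -
  define T where "T = nabla V W x - nabla W V x"
  have N: "nabla V W x \<in> mm" "nabla W V x \<in> mm"
    using conn V W fieldD(2) unfolding connection_def by blast+
  define Q where "Q = T - tderiv W x (V x) + tderiv V x (W x) - br (V x) (W x)"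
  have "\<mu> (br Q B) = 0" for B
  proof -
    \<comment> \<open>Chosen so that the differential at \<open>x\<close> of the coordinate function
      of \<open>Y\<close> is pairing with the prescribed \<open>B\<close>.\<close>
    define Y where "Y = Ad c x B"
    have B: "Ad c (inverse x) Y = B" by (simp add: Y_def)
    have "deriv_along A c (\<lambda>y. nabla V W y - nabla W V y) (orbit_coord Y) x =
        deriv_along A c V (deriv_along A c W (orbit_coord Y)) x - deriv_along A c W (deriv_along A
            c V (orbit_coord Y)) x"
      using tf V W orbit_coord_orbit_function unfolding torsion_free_def by blast
    then have "\<mu> (br T B) = \<mu> (br (tderiv W x (V x)) B) - \<mu> (br (W x) (br (V x) B))
        - \<mu> (br (tderiv V x (W x)) B) + \<mu> (br (V x) (br (W x) B))"
      unfolding deriv_along_orbit_coord2[OF V] deriv_along_orbit_coord2[OF W]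
      by (simp add: deriv_along_orbit_coord B T_def)
    moreover have "\<mu> (br (V x) (br (W x) B)) = \<mu> (br (br (V x) (W x)) B)
        + \<mu> (br (W x) (br (V x) B))"
      by (subst Jacobi) (simp add: linear_add[OF linear_mu])
    ultimately show ?thesis
      by (simp add: Q_def br_simps linear_add[OF linear_mu] linear_diff[OF linear_mu])
  qed
  then have "br Z Q = 0" using Kil.eq_zero[of "br Z Q"] by (simp add: mu_br)
  then have "P Q = 0" by (intro proj_kalg) (simp add: mem_kalg)
  then have "P (T - tderiv W x (V x) + tderiv V x (W x)) = P (br (V x) (W x))"
    by (simp add: Q_def linear_diff[OF linear_proj])
  then have "T - tderiv W x (V x) + tderiv V x (W x) = P (br (V x) (W x))"
    using N by (simp add: proj_id T_def m_add m_diff field_tderiv_in V W)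
  then show ?thesis by (simp add: T_def algebra_simps)
qed

text \<open>\<open>J\<close> is linear only on \<open>mm\<close>; inserting \<open>P\<close> in the
  second slot gives a form that is bilinear on the whole algebra and agrees with the metric on
  \<open>mm\<close>, so the product rule applies.\<close>

lemma bilinear_metric: "bilinear (\<lambda>X Y. gg X (P Y))"
  unfolding bilinear_def
proof (intro conjI allI)
  show "linear (\<lambda>X. gg X (P Y))" for Y by (rule linearI) (simp_all add: metric_left)
  have "linear (\<lambda>Y. J (P Y))"
    by (rule linearI) (simp_all add: linear_add[OF linear_proj] linear_cmul[OF linear_proj] J_add
        J_scale proj_in)
  from linear_compose[OF this Kil.linear_right]
  show "linear (\<lambda>Y. gg X (P Y))" for X by (simp add: metric_eq o_def)
qed

text \<open>Compatibility of the canonical connection: the metric is one fixed form on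
  \<open>mm\<close>, so only the two fields are differentiated.\<close>

lemma deriv_along_metric:
  assumes V: "V \<in> fields" and W: "W \<in> fields"
  shows "deriv_along A c U (\<lambda>y. gg (V y) (W y)) x =
    gg (tderiv V x (U x)) (W x) + gg (V x) (tderiv W x (U x))"
proof -
  let ?y = "\<lambda>t. x * lie_exp A c (t *\<^sub>R U x)"
  have "bounded_bilinear (\<lambda>X Y. gg X (P Y))"
    using bilinear_metric by (simp add: bilinear_conv_bounded_bilinear)
  from bounded_bilinear.has_vector_derivative[OF this field_curve[OF V] field_curve[OF W], of x
      "U x" x "U x"]
  have "((\<lambda>t. gg (V (?y t)) (W (?y t))) has_vector_derivative
      gg (V x) (tderiv W x (U x)) + gg (tderiv V x (U x)) (W x)) (at 0)"
    by (simp add: proj_id fieldD(2)[OF W] field_tderiv_in[OF W])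
  from vector_derivative_at[OF this] show ?thesis by (simp add: deriv_along_def)
qed

lemma compatible_difference:
  assumes conn: "connection A c \<mu> nabla" and comp: "metric_compatible A c \<mu> J nabla"
    and U: "U \<in> fields" and V: "V \<in> fields" and W: "W \<in> fields"
  shows "gg (nabla U V x - tderiv V x (U x)) (W x) + gg (nabla U W x - tderiv W x (U x)) (V x) = 0"
proof -
  have N: "nabla U V x \<in> mm" "nabla U W x \<in> mm"
    using conn U V W fieldD(2) unfolding connection_def by blast+
  have "gg (nabla U V x) (W x) + gg (V x) (nabla U W x) =
      gg (tderiv V x (U x)) (W x) + gg (V x) (tderiv W x (U x))"
    using comp U V W deriv_along_metric[OF V W, of U x] unfolding metric_compatible_def by auto
  moreover have "gg (V x) (nabla U W x) = gg (nabla U W x) (V x)"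
    "gg (V x) (tderiv W x (U x)) = gg (tderiv W x (U x)) (V x)"
    by (intro metric_sym fieldD(2)[OF V] N field_tderiv_in[OF W])+
  ultimately show ?thesis by (simp add: metric_left)
qed

lemma field_through:
  assumes "Y \<in> mm"
  obtains U where "U \<in> fields" "U x = Y"
proof
  let ?U = "\<lambda>y. P (Ad c (inverse y) (Ad c x Y))"
  have "smooth_map A euclid_atlas ?U"
    by (rule smooth_map_linear_comp[OF atlas smooth_map_Ad_inverse linear_proj])
  moreover have "?U (y * s) = Ad c (inverse s) (?U y)" if "s \<in> stab c \<mu>" for y s
    using proj_Ad_stab[OF stab_inverse[OF that]] by (simp add: group_inverse_mult Ad_mult)
  ultimately show "?U \<in> fields" by (simp add: vector_fields_def proj_in)
  show "?U x = Y" using assms by (simp add: proj_id)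
qed

lemma Levi_Civita_weight_fields:
  assumes lc: "levi_civita A c \<mu> J nabla"
    and w: "\<alpha> \<in> weights A c \<mu> J" "\<beta> \<in> weights A c \<mu> J"
    and VW: "V \<in> weight_fields A c \<mu> J \<alpha>" "W \<in> weight_fields A c \<mu> J \<beta>"
  shows "nabla V W x = deriv_along A c V W x +
    (1 / 4) *\<^sub>R ((2 * \<beta> Z * inverse (\<alpha> Z + \<beta> Z)) *\<^sub>R (br (V x) (W x) - br (J (V x)) (J (W x))) +
    (1 + sgn (\<beta> Z - \<alpha> Z)) *\<^sub>R P (br (V x) (W x) + br (J (V x)) (J (W x))))"
proof -
  have conn: "connection A c \<mu> nabla" and tf: "torsion_free A c \<mu> nabla"
    and comp: "metric_compatible A c \<mu> J nabla"
    using lc by (auto simp: levi_civita_def)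
  have V: "V \<in> fields" "V x \<in> weight_space A c \<mu> J \<alpha>" and W: "W \<in> fields"
      "W x \<in> weight_space A c \<mu> J \<beta>"
    using VW by (auto simp: weight_fields_def)
  define D where "D = (\<lambda>V W. nabla V W x - tderiv W x (V x))"
  have tors: "D V W - D W V = P (br (V x) (W x))" if "V \<in> fields" "W \<in> fields" for V W
    unfolding D_def by (rule torsion_free_difference[OF conn tf that])
  have skew: "gg (D U V) (W x) + gg (D U W) (V x) = 0" if "U \<in> fields" "V \<in> fields" "W \<in> fields"
      for U V W
    unfolding D_def by (rule compatible_difference[OF conn comp that])
  have "nabla V W x \<in> mm"
    using conn V(1) W(1) fieldD(2) unfolding connection_def by blast
  then have D: "D V W \<in> mm" unfolding D_def by (intro m_diff field_tderiv_in W)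
  have "D V W = (1 / 4) *\<^sub>R ((2 * \<beta> Z * inverse (\<alpha> Z + \<beta> Z)) *\<^sub>R (br (V x) (W x)
      - br (J (V x)) (J (W x))) +
    (1 + sgn (\<beta> Z - \<alpha> Z)) *\<^sub>R P (br (V x) (W x) + br (J (V x)) (J (W x))))"
  proof (rule Koszul_weight_solution[OF V(2) W(2) weight_pos[OF w(1)] weight_pos[OF w(2)] D])
    fix Y assume "Y \<in> mm"
    then obtain U where U: "U \<in> fields" "U x = Y" by (rule field_through)
    \<comment> \<open>Koszul trick: with the brackets rewritten as antisymmetrized values of
      \<open>D\<close>, the right side is \<open>2 * gg (D V W) Y\<close> once the three skewness
      relations cancel the other terms. \<open>U\<close> is an arbitrary field, not one of a single
      weight.\<close>
    show "2 * gg (D V W) Y = gg (P (br (V x) (W x))) Y - gg (P (br (W x) Y)) (V x)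
        + gg (P (br Y (V x))) (W x)"
      using skew[OF V(1) W(1) U(1)] skew[OF W(1) V(1) U(1)] skew[OF U(1) V(1) W(1)]
      unfolding U(2)[symmetric] tors[OF V(1) W(1), symmetric] tors[OF W(1) U(1), symmetric]
        tors[OF U(1) V(1), symmetric] metric_left by linarith
  qed
  then show ?thesis
    using deriv_along_eq[OF fieldD(1)[OF W(1)], of V x] unfolding D_def diff_eq_eq by (simp add:
        add.commute)
qed

end

theorem theorem3p3:
  fixes A :: "('g::{group_mult, t2_space, second_countable_topology}, 'e::euclidean_space) chart set"
    and c :: "('g, 'e) chart"
    and \<mu> :: "'e \<Rightarrow> real"
    and absGam J :: "'e \<Rightarrow> 'e"
    and nabla :: "('g \<Rightarrow> 'e) \<Rightarrow> ('g \<Rightarrow> 'e) \<Rightarrow> 'g \<Rightarrow> 'e"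
    and \<alpha> \<beta> :: "'e \<Rightarrow> real"
    and V W :: "'g \<Rightarrow> 'e"
    and x :: 'g
  assumes "lie_group A" and "c \<in> A" and "1 \<in> fst c"
    and "connected (UNIV :: 'g set)" and "compact (UNIV :: 'g set)"
    and "semisimple_lie_algebra c"
    and "linear \<mu>" and "\<mu> \<noteq> (\<lambda>X. 0)"
    and "polar_decomposition_on (mperp A c \<mu>) (Kil c) (Gam A c \<mu>) absGam J"
    and "levi_civita A c \<mu> J nabla"
    and "\<alpha> \<in> weights A c \<mu> J" and "\<beta> \<in> weights A c \<mu> J"
    and "V \<in> weight_fields A c \<mu> J \<alpha>" and "W \<in> weight_fields A c \<mu> J \<beta>"
  shows "nabla V W x = deriv_along A c V W x + (1 / 4) *\<^sub>R
    ((2 * \<beta> (Zmu c \<mu>) * inverse (\<alpha> (Zmu c \<mu>) + \<beta> (Zmu c \<mu>))) *\<^sub>R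
       (lie_bracket c (V x) (W x) - lie_bracket c (J (V x)) (J (W x))) +
     (1 + sgn (\<beta> (Zmu c \<mu>) - \<alpha> (Zmu c \<mu>))) *\<^sub>R
       proj_m A c \<mu> (lie_bracket c (V x) (W x) + lie_bracket c (J (V x)) (J (W x))))"
proof -
  interpret polar_orbit A c \<mu> absGam J
    by (intro polar_orbit.intro coadjoint_orbit.intro compact_semisimple.intro lie_chart.intro
        compact_semisimple_axioms.intro coadjoint_orbit_axioms.intro polar_orbit_axioms.intro assms)
  show ?thesis using assms(10-14) by (rule Levi_Civita_weight_fields)
qed

end
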